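(* Let $(M,\omega)$ be a symplectic manifold and let $G$ be a Lie group acting smoothly on $M$ from the left (the action is not assumed to preserve $\omega$). For $a\in \mathrm{Lie}(G)$ let $\tilde X_a$ denote the infinitesimal generator of the action associated to $a$. For $a,b\in\mathrm{Lie}(G)$ and $x\in M$ set $$\Omega(a,b)(x)=\omega(\tilde X_a,\tilde X_b)(x).$$ Then $\Omega$ is a $C^\infty(M)$-valued two-cocycle on $\mathrm{Lie}(G)$, i.e. $\Omega$ is an alternating bilinear map $\mathrm{Lie}(G)\times\mathrm{Lie}(G)\to C^\infty(M)$ with $\delta\Omega=0$.
   Context: The infinitesimal generator is $\tilde X_a(x)=\frac{d}{dt}\big|_{t=0}\exp(ta)\cdot x$. The group $G$ acts on $C^\infty(M)$ by $(g\cdot f)(x)=f(g^{-1}\cdot x)$, and the derivative of this action makes $C^\infty(M)$ a $\mathrm{Lie}(G)$-module via $a\cdot f=-L_{\tilde X_a}f$, where $L$ is the Lie derivative. An $n$-cochain on $\mathrm{Lie}(G)$ with values in $C^\infty(M)$ is an alternating $n$-multilinear map $\alpha:\mathrm{Lie}(G)^n\to C^\infty(M)$. The coboundary operator is $$(\delta\alpha)(a_1,\dots,a_{n+1})=\sum_{i=1}^{n+1}(-1)^{i+1}a_i\cdot\alpha(a_1,\dots,\hat a_i,\dots,a_{n+1})+\sum_{i<j}(-1)^{i+j}\alpha([a_i,a_j],a_1,\dots,\hat a_i,\dots,\hat a_j,\dots,a_{n+1}),$$ where a hat means that the variable is deleted. In particular, for a 2-cochain, $$(\delta\Omega)(a,b,c)=a\cdot\Omega(b,c)-b\cdot\Omega(a,c)+c\cdot\Omega(a,b)-\Omega([a,b],c)+\Omega([a,c],b)-\Omega([b,c],a).$$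 An $n$-cocycle is an $n$-cochain $\alpha$ with $\delta\alpha=0$. *)

theory Defs
  imports "HOL-Analysis.Analysis"
begin

section \<open>Smooth functions on model spaces\<close>

text \<open>
  Continuity of all iterated directional derivatives up to order \<open>n\<close>; for an open set \<open>S\<close>
  in a finite-dimensional space this is being of class \<open>C\<^sup>n\<close> on \<open>S\<close>.
\<close>

primrec ck_on ::
  "nat \<Rightarrow> ('a::real_normed_vector \<Rightarrow> 'b::real_normed_vector) \<Rightarrow> 'a set \<Rightarrow> bool" where
  "ck_on 0 f S \<longleftrightarrow> continuous_on S f"
| "ck_on (Suc n) f S \<longleftrightarrow>
     (\<forall>x\<in>S. f differentiable (at x)) \<and>
     (\<forall>v. ck_on n (\<lambda>x. frechet_derivative f (at x) v) S)"

definition smooth_on ::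
  "('a::real_normed_vector \<Rightarrow> 'b::real_normed_vector) \<Rightarrow> 'a set \<Rightarrow> bool" where
  "smooth_on f S \<longleftrightarrow> (\<forall>n. ck_on n f S)"


section \<open>Smooth manifolds\<close>

text \<open>
  A chart is a pair of a domain and a coordinate map; the values of the map outside the
  domain are irrelevant.
\<close>

type_synonym ('m, 'e) chart = "'m set \<times> ('m \<Rightarrow> 'e)"

abbreviation chart_dom :: "('m, 'e) chart \<Rightarrow> 'm set" where
  "chart_dom \<equiv> fst"

abbreviation chart_map :: "('m, 'e) chart \<Rightarrow> 'm \<Rightarrow> 'e" where
  "chart_map \<equiv> snd"

definition chart_image :: "('m, 'e) chart \<Rightarrow> 'e set" where
  "chart_image c = chart_map c ` chart_dom c"

definition chart_inv :: "('m, 'e) chart \<Rightarrow> 'e \<Rightarrow> 'm" where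
  "chart_inv c = inv_into (chart_dom c) (chart_map c)"

definition charts_at :: "('m, 'e) chart set \<Rightarrow> 'm \<Rightarrow> ('m, 'e) chart set" where
  "charts_at A p = {c \<in> A. p \<in> chart_dom c}"

text \<open>
  The underlying space is a whole (Hausdorff, second countable) type, and the smooth structure
  is given by an atlas, which need not be maximal.  The model space is a finite-dimensional
  real inner product space; the class \<open>euclidean_space\<close> is not used because it requires a
  nonempty basis, whereas one-point model spaces should be allowed, so that zero-dimensional
  manifolds and discrete Lie groups are included.  Given \<open>finite_dim\<close>, the sort \<open>banach\<close>
  imposes no further restriction.
\<close>

locale smooth_manifold =
  fixes A :: "('m::{t2_space, second_countable_topology}, 'e::{real_inner, banach}) chart set"
  assumes finite_dim: "\<exists>E. finite E \<and> span E = (UNIV :: 'e set)"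
    and chart_open: "c \<in> A \<Longrightarrow> open (chart_dom c) \<and> open (chart_image c)"
    and chart_homeomorphism:
      "c \<in> A \<Longrightarrow> homeomorphism (chart_dom c) (chart_image c) (chart_map c) (chart_inv c)"
    and charts_cover: "\<exists>c\<in>A. p \<in> chart_dom c"
    and charts_compatible:
      "c \<in> A \<Longrightarrow> d \<in> A \<Longrightarrow>
         smooth_on (chart_map d \<circ> chart_inv c) (chart_map c ` (chart_dom c \<inter> chart_dom d))"

text \<open>A normed space as a manifold over itself, used for maps into and out of the real line.\<close>

definition std_atlas :: "('e, 'e) chart set" where
  "std_atlas = {(UNIV, id)}"

definition prod_atlas ::
  "('m, 'e) chart set \<Rightarrow> ('n, 'f) chart set \<Rightarrow> ('m \<times> 'n, 'e \<times> 'f) chart set" where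
  "prod_atlas A B =
     {(chart_dom c \<times> chart_dom d, map_prod (chart_map c) (chart_map d)) | c d. c \<in> A \<and> d \<in> B}"

definition smooth_map ::
  "('m::topological_space, 'e::real_normed_vector) chart set \<Rightarrow>
   ('n::topological_space, 'f::real_normed_vector) chart set \<Rightarrow> ('m \<Rightarrow> 'n) \<Rightarrow> bool" where
  "smooth_map A B F \<longleftrightarrow>
     continuous_on UNIV F \<and>
     (\<forall>c\<in>A. \<forall>d\<in>B.
        smooth_on (chart_map d \<circ> F \<circ> chart_inv c)
          (chart_map c ` (chart_dom c \<inter> F -` chart_dom d)))"

definition smooth_functions ::
  "('m::topological_space, 'e::real_normed_vector) chart set \<Rightarrow> ('m \<Rightarrow> real) set" where
  "smooth_functions A = {f. smooth_map A std_atlas f}"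


section \<open>Tangent vectors and vector fields\<close>

text \<open>
  A tangent vector at \<open>p\<close> is the family of its components with respect to all charts around
  \<open>p\<close>, related to each other by the Jacobians of the coordinate changes.  Components for
  charts not containing \<open>p\<close> are set to 0, so that equality of tangent vectors is equality of
  families.
\<close>

type_synonym ('m, 'e) tvec = "('m, 'e) chart \<Rightarrow> 'e"

definition tangent_space ::
  "('m, 'e::real_normed_vector) chart set \<Rightarrow> 'm \<Rightarrow> ('m, 'e) tvec set" where
  "tangent_space A p =
     {v. (\<forall>c\<in>charts_at A p. \<forall>d\<in>charts_at A p.
            v d = frechet_derivative (chart_map d \<circ> chart_inv c) (at (chart_map c p)) (v c)) \<and>
         (\<forall>c. c \<notin> charts_at A p \<longrightarrow> v c = 0)}"

definition tvec_zero :: "('m, 'e::real_vector) tvec" where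
  "tvec_zero = (\<lambda>c. 0)"

definition tvec_add :: "('m, 'e::real_vector) tvec \<Rightarrow> ('m, 'e) tvec \<Rightarrow> ('m, 'e) tvec" where
  "tvec_add v w = (\<lambda>c. v c + w c)"

definition tvec_scale :: "real \<Rightarrow> ('m, 'e::real_vector) tvec \<Rightarrow> ('m, 'e) tvec" where
  "tvec_scale r v = (\<lambda>c. r *\<^sub>R v c)"

text \<open>The tangent vector at \<open>p\<close> with components \<open>u\<close> in the chart \<open>c\<close>.\<close>

definition coord_vec ::
  "('m, 'e::real_normed_vector) chart set \<Rightarrow> ('m, 'e) chart \<Rightarrow> 'm \<Rightarrow> 'e \<Rightarrow> ('m, 'e) tvec" where
  "coord_vec A c p u =
     (\<lambda>d. if d \<in> charts_at A p
          then frechet_derivative (chart_map d \<circ> chart_inv c) (at (chart_map c p)) u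
          else 0)"

definition chart_at :: "('m, 'e) chart set \<Rightarrow> 'm \<Rightarrow> ('m, 'e) chart" where
  "chart_at A p = (SOME c. c \<in> charts_at A p)"

text \<open>
  Tangent map and differential are computed in an arbitrarily chosen chart of the source; on
  tangent vectors the result does not depend on the choice.
\<close>

definition tangent_map ::
  "('m, 'e::real_normed_vector) chart set \<Rightarrow> ('n, 'f::real_normed_vector) chart set \<Rightarrow>
   ('m \<Rightarrow> 'n) \<Rightarrow> 'm \<Rightarrow> ('m, 'e) tvec \<Rightarrow> ('n, 'f) tvec" where
  "tangent_map A B F p v =
     (\<lambda>d. if d \<in> charts_at B (F p)
          then frechet_derivative (chart_map d \<circ> F \<circ> chart_inv (chart_at A p))
                 (at (chart_map (chart_at A p) p)) (v (chart_at A p))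
          else 0)"

definition differential ::
  "('m, 'e::real_normed_vector) chart set \<Rightarrow> ('m \<Rightarrow> real) \<Rightarrow> 'm \<Rightarrow> ('m, 'e) tvec \<Rightarrow> real" where
  "differential A f p v =
     frechet_derivative (f \<circ> chart_inv (chart_at A p))
       (at (chart_map (chart_at A p) p)) (v (chart_at A p))"

definition velocity ::
  "('m, 'e::real_normed_vector) chart set \<Rightarrow> (real \<Rightarrow> 'm) \<Rightarrow> real \<Rightarrow> ('m, 'e) tvec" where
  "velocity A \<gamma> t =
     (\<lambda>c. if c \<in> charts_at A (\<gamma> t) then vector_derivative (chart_map c \<circ> \<gamma>) (at t) else 0)"

definition lie_derivative ::
  "('m, 'e::real_normed_vector) chart set \<Rightarrow> ('m \<Rightarrow> ('m, 'e) tvec) \<Rightarrow> ('m \<Rightarrow> real) \<Rightarrow>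
   'm \<Rightarrow> real" where
  "lie_derivative A X f = (\<lambda>p. differential A f p (X p))"

text \<open>In a chart the bracket of vector fields is \<open>[X, Y] = DY(X) - DX(Y)\<close>.\<close>

definition vector_field_bracket ::
  "('m, 'e::real_normed_vector) chart set \<Rightarrow> ('m \<Rightarrow> ('m, 'e) tvec) \<Rightarrow>
   ('m \<Rightarrow> ('m, 'e) tvec) \<Rightarrow> 'm \<Rightarrow> ('m, 'e) tvec" where
  "vector_field_bracket A X Y p =
     (\<lambda>c. if c \<in> charts_at A p
          then frechet_derivative (\<lambda>y. Y (chart_inv c y) c) (at (chart_map c p)) (X p c)
             - frechet_derivative (\<lambda>y. X (chart_inv c y) c) (at (chart_map c p)) (Y p c)
          else 0)"


section \<open>Symplectic manifolds\<close>

type_synonym ('m, 'e) two_form = "'m \<Rightarrow> ('m, 'e) tvec \<Rightarrow> ('m, 'e) tvec \<Rightarrow> real"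

definition form_in_chart ::
  "('m, 'e::real_normed_vector) chart set \<Rightarrow> ('m, 'e) two_form \<Rightarrow> ('m, 'e) chart \<Rightarrow>
   'e \<Rightarrow> 'e \<Rightarrow> 'e \<Rightarrow> real" where
  "form_in_chart A \<omega> c y u v =
     \<omega> (chart_inv c y) (coord_vec A c (chart_inv c y) u) (coord_vec A c (chart_inv c y) v)"

text \<open>
  The exterior derivative in the chart \<open>c\<close>, evaluated on the constant coordinate fields
  \<open>u\<close>, \<open>v\<close>, \<open>w\<close>.
\<close>

definition ext_derivative_in_chart ::
  "('m, 'e::real_normed_vector) chart set \<Rightarrow> ('m, 'e) two_form \<Rightarrow> ('m, 'e) chart \<Rightarrow>
   'e \<Rightarrow> 'e \<Rightarrow> 'e \<Rightarrow> 'e \<Rightarrow> real" where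
  "ext_derivative_in_chart A \<omega> c y u v w =
     frechet_derivative (\<lambda>z. form_in_chart A \<omega> c z v w) (at y) u
   - frechet_derivative (\<lambda>z. form_in_chart A \<omega> c z u w) (at y) v
   + frechet_derivative (\<lambda>z. form_in_chart A \<omega> c z u v) (at y) w"

locale symplectic_manifold = smooth_manifold A
  for A :: "('m::{t2_space, second_countable_topology}, 'e::{real_inner, banach}) chart set" +
  fixes \<omega> :: "('m, 'e) two_form"
  assumes form_linear:
      "u \<in> tangent_space A p \<Longrightarrow> v \<in> tangent_space A p \<Longrightarrow> w \<in> tangent_space A p \<Longrightarrow>
         \<omega> p (tvec_add (tvec_scale r u) (tvec_scale s v)) w = r * \<omega> p u w + s * \<omega> p v w"
    and form_skew:
      "v \<in> tangent_space A p \<Longrightarrow> w \<in> tangent_space A p \<Longrightarrow> \<omega> p v w = - \<omega> p w v"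
    and form_smooth:
      "c \<in> A \<Longrightarrow> smooth_on (\<lambda>y. form_in_chart A \<omega> c y u' v') (chart_image c)"
    and form_nondegenerate:
      "v \<in> tangent_space A p \<Longrightarrow> (\<forall>w\<in>tangent_space A p. \<omega> p v w = 0) \<Longrightarrow> v = tvec_zero"
    and form_closed:
      "c \<in> A \<Longrightarrow> y \<in> chart_image c \<Longrightarrow> ext_derivative_in_chart A \<omega> c y u' v' w' = 0"


section \<open>Lie groups and smooth actions\<close>

locale lie_group = smooth_manifold B + group gmul gone ginv
  for B :: "('g::{t2_space, second_countable_topology}, 'h::{real_inner, banach}) chart set"
    and gmul :: "'g \<Rightarrow> 'g \<Rightarrow> 'g" and gone :: 'g and ginv :: "'g \<Rightarrow> 'g" +
  assumes smooth_mult: "smooth_map (prod_atlas B B) B (\<lambda>(g, h). gmul g h)"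
    and smooth_inv: "smooth_map B B ginv"

abbreviation lie_algebra ::
  "('g, 'h::real_normed_vector) chart set \<Rightarrow> 'g \<Rightarrow> ('g, 'h) tvec set" where
  "lie_algebra B gone \<equiv> tangent_space B gone"

definition left_invariant_field ::
  "('g, 'h::real_normed_vector) chart set \<Rightarrow> ('g \<Rightarrow> 'g \<Rightarrow> 'g) \<Rightarrow> 'g \<Rightarrow> ('g, 'h) tvec \<Rightarrow>
   'g \<Rightarrow> ('g, 'h) tvec" where
  "left_invariant_field B gmul gone a g = tangent_map B B (gmul g) gone a"

definition lie_bracket ::
  "('g, 'h::real_normed_vector) chart set \<Rightarrow> ('g \<Rightarrow> 'g \<Rightarrow> 'g) \<Rightarrow> 'g \<Rightarrow>
   ('g, 'h) tvec \<Rightarrow> ('g, 'h) tvec \<Rightarrow> ('g, 'h) tvec" where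
  "lie_bracket B gmul gone a b =
     vector_field_bracket B (left_invariant_field B gmul gone a)
       (left_invariant_field B gmul gone b) gone"

definition one_parameter_subgroup ::
  "('g::topological_space, 'h::real_normed_vector) chart set \<Rightarrow> ('g \<Rightarrow> 'g \<Rightarrow> 'g) \<Rightarrow>
   (real \<Rightarrow> 'g) \<Rightarrow> bool" where
  "one_parameter_subgroup B gmul \<gamma> \<longleftrightarrow>
     smooth_map std_atlas B \<gamma> \<and> (\<forall>s t. \<gamma> (s + t) = gmul (\<gamma> s) (\<gamma> t))"

definition lie_exp ::
  "('g::topological_space, 'h::real_normed_vector) chart set \<Rightarrow> ('g \<Rightarrow> 'g \<Rightarrow> 'g) \<Rightarrow>
   ('g, 'h) tvec \<Rightarrow> 'g" where
  "lie_exp B gmul a = (THE \<gamma>. one_parameter_subgroup B gmul \<gamma> \<and> velocity B \<gamma> 0 = a) 1"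

locale smooth_left_action = G: lie_group B gmul gone ginv + M: smooth_manifold A
  for B :: "('g::{t2_space, second_countable_topology}, 'h::{real_inner, banach}) chart set"
    and gmul :: "'g \<Rightarrow> 'g \<Rightarrow> 'g" and gone :: 'g and ginv :: "'g \<Rightarrow> 'g"
    and A :: "('m::{t2_space, second_countable_topology}, 'e::{real_inner, banach}) chart set" +
  fixes act :: "'g \<Rightarrow> 'm \<Rightarrow> 'm"
  assumes act_one: "act gone x = x"
    and act_mult: "act (gmul g h) x = act g (act h x)"
    and smooth_act: "smooth_map (prod_atlas B A) A (\<lambda>(g, x). act g x)"

definition infinitesimal_generator ::
  "('g::topological_space, 'h::real_normed_vector) chart set \<Rightarrow> ('g \<Rightarrow> 'g \<Rightarrow> 'g) \<Rightarrow>
   ('m, 'e::real_normed_vector) chart set \<Rightarrow> ('g \<Rightarrow> 'm \<Rightarrow> 'm) \<Rightarrow>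
   ('g, 'h) tvec \<Rightarrow> 'm \<Rightarrow> ('m, 'e) tvec" where
  "infinitesimal_generator B gmul A act a x =
     velocity A (\<lambda>t. act (lie_exp B gmul (tvec_scale t a)) x) 0"


section \<open>Cochains on the Lie algebra with values in the smooth functions\<close>

definition lie_module_action ::
  "('g::topological_space, 'h::real_normed_vector) chart set \<Rightarrow> ('g \<Rightarrow> 'g \<Rightarrow> 'g) \<Rightarrow>
   ('m, 'e::real_normed_vector) chart set \<Rightarrow> ('g \<Rightarrow> 'm \<Rightarrow> 'm) \<Rightarrow>
   ('g, 'h) tvec \<Rightarrow> ('m \<Rightarrow> real) \<Rightarrow> 'm \<Rightarrow> real" where
  "lie_module_action B gmul A act a f =
     (\<lambda>x. - lie_derivative A (infinitesimal_generator B gmul A act a) f x)"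

text \<open>
  An \<open>n\<close>-cochain is a function on lists of length \<open>n\<close> over the Lie algebra; its values on
  other lists are irrelevant.
\<close>

definition lie_cochain ::
  "('g, 'h::real_normed_vector) chart set \<Rightarrow> 'g \<Rightarrow>
   ('m::topological_space, 'e::real_normed_vector) chart set \<Rightarrow>
   nat \<Rightarrow> (('g, 'h) tvec list \<Rightarrow> 'm \<Rightarrow> real) \<Rightarrow> bool" where
  "lie_cochain B gone A n \<alpha> \<longleftrightarrow>
     (\<forall>as. length as = n \<and> set as \<subseteq> lie_algebra B gone \<longrightarrow>
        \<alpha> as \<in> smooth_functions A \<and>
        (\<forall>i<n. \<forall>r s. \<forall>u\<in>lie_algebra B gone. \<forall>v\<in>lie_algebra B gone. \<forall>x.
           \<alpha> (as[i := tvec_add (tvec_scale r u) (tvec_scale s v)]) x =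
             r * \<alpha> (as[i := u]) x + s * \<alpha> (as[i := v]) x) \<and>
        (\<forall>j<n. \<forall>i<j. as ! i = as ! j \<longrightarrow> (\<forall>x. \<alpha> as x = 0)))"

text \<open>
  List positions start at 0, so the sign of the term for \<open>a\<^sub>i\<^sub>+\<^sub>1 = as ! i\<close> is
  \<open>(-1) ^ i\<close>; \<open>nths as (- I)\<close> deletes the entries at the positions in \<open>I\<close>.
\<close>

definition lie_coboundary ::
  "('g::topological_space, 'h::real_normed_vector) chart set \<Rightarrow> ('g \<Rightarrow> 'g \<Rightarrow> 'g) \<Rightarrow> 'g \<Rightarrow>
   ('m, 'e::real_normed_vector) chart set \<Rightarrow> ('g \<Rightarrow> 'm \<Rightarrow> 'm) \<Rightarrow>
   (('g, 'h) tvec list \<Rightarrow> 'm \<Rightarrow> real) \<Rightarrow> ('g, 'h) tvec list \<Rightarrow> 'm \<Rightarrow> real" where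
  "lie_coboundary B gmul gone A act \<alpha> as x =
     (\<Sum>i<length as. (- 1) ^ i *
        lie_module_action B gmul A act (as ! i) (\<alpha> (nths as (- {i}))) x) +
     (\<Sum>j<length as. \<Sum>i<j. (- 1) ^ (i + j) *
        \<alpha> (lie_bracket B gmul gone (as ! i) (as ! j) # nths as (- {i, j})) x)"

definition lie_cocycle ::
  "('g::topological_space, 'h::real_normed_vector) chart set \<Rightarrow> ('g \<Rightarrow> 'g \<Rightarrow> 'g) \<Rightarrow> 'g \<Rightarrow>
   ('m::topological_space, 'e::real_normed_vector) chart set \<Rightarrow> ('g \<Rightarrow> 'm \<Rightarrow> 'm) \<Rightarrow>
   nat \<Rightarrow> (('g, 'h) tvec list \<Rightarrow> 'm \<Rightarrow> real) \<Rightarrow> bool" where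
  "lie_cocycle B gmul gone A act n \<alpha> \<longleftrightarrow>
     lie_cochain B gone A n \<alpha> \<and>
     (\<forall>as. length as = Suc n \<and> set as \<subseteq> lie_algebra B gone \<longrightarrow>
        (\<forall>x. lie_coboundary B gmul gone A act \<alpha> as x = 0))"

lemma lie_coboundary_2:
  "lie_coboundary B gmul gone A act \<alpha> [a, b, c] x =
     lie_module_action B gmul A act a (\<alpha> [b, c]) x
   - lie_module_action B gmul A act b (\<alpha> [a, c]) x
   + lie_module_action B gmul A act c (\<alpha> [a, b]) x
   - \<alpha> [lie_bracket B gmul gone a b, c] x
   + \<alpha> [lie_bracket B gmul gone a c, b] x
   - \<alpha> [lie_bracket B gmul gone b c, a] x"
  by (simp add: lie_coboundary_def nths_Cons lessThan_Suc numeral_3_eq_3 algebra_simps)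

definition pullback_cochain ::
  "('g::topological_space, 'h::real_normed_vector) chart set \<Rightarrow> ('g \<Rightarrow> 'g \<Rightarrow> 'g) \<Rightarrow>
   ('m, 'e::real_normed_vector) chart set \<Rightarrow> ('g \<Rightarrow> 'm \<Rightarrow> 'm) \<Rightarrow> ('m, 'e) two_form \<Rightarrow>
   ('g, 'h) tvec \<Rightarrow> ('g, 'h) tvec \<Rightarrow> 'm \<Rightarrow> real" where
  "pullback_cochain B gmul A act \<omega> a b x =
     \<omega> x (infinitesimal_generator B gmul A act a x) (infinitesimal_generator B gmul A act b x)"

end

theory Submission
  imports Defs
begin

text \<open>
Write \<open>X\<^sub>a\<close> for the infinitesimal generator of the action belonging to \<open>a\<close>. In the sign
conventions used here \<open>\<delta>\<Omega>(a, b, c) = - d\<omega>(X\<^sub>a, X\<^sub>b, X\<^sub>c)\<close>, which vanishes because \<open>\<omega>\<close> is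
closed. Indeed the Lie module structure is \<open>a \<cdot> f = - X\<^sub>a f\<close>, so the first three terms of
\<open>\<delta>\<Omega>\<close> are minus those of the global formula for \<open>d\<omega>\<close>, and the remaining three agree as
well because \<open>a \<mapsto> X\<^sub>a\<close> is a linear antihomomorphism: \<open>X\<^bsub>[a,b]\<^esub> = - [X\<^sub>a, X\<^sub>b]\<close>. Both the minus
sign of the module and that of the bracket reflect that \<open>g \<mapsto> (x \<mapsto> g x)\<close> is a left action.

The generators are defined through the exponential map, so the first task is to make sense
of it: every \<open>a\<close> is the initial velocity of exactly one one-parameter subgroup. Local
existence comes from the Picard-Lindeloef theorem (\<open>picard_lindelof\<close>) applied in a chart to
the left-invariant field of \<open>a\<close>. Uniqueness, and also the homomorphism property of the local
solution, follow from \<open>left_integral_curve_unique\<close>: the quotient \<open>k(t) l(t)\<inverse>\<close> of two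
integral curves has velocity zero. Repeated doubling \<open>k(t) = k(t/2) k(t/2)\<close> then extends a local
homomorphism to the whole line (\<open>local_hom_extension\<close>). Consequently \<open>X\<^sub>a(x)\<close> is the image
of \<open>a\<close> under the tangent map at the identity of \<open>g \<mapsto> g x\<close>
(\<open>generator_eq_tangent_map\<close>); so it is linear in \<open>a\<close>, smooth in \<open>x\<close>, and a genuine tangent
vector.

The bracket relation (\<open>generator_lie_bracket\<close>) is a computation in charts. Let \<open>\<Phi>(z, y)\<close> be
the action and \<open>m(z, w)\<close> the multiplication in coordinates, and let \<open>z\<^sub>0\<close> represent the
identity. Differentiating \<open>\<Phi>(m(z, w), y) = \<Phi>(z, \<Phi>(w, y))\<close> first in \<open>w\<close> and then in \<open>z\<close>, and
exchanging the order of the two derivatives on the right, expresses the mixed second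
derivative of \<open>m\<close> at \<open>(z\<^sub>0, z\<^sub>0)\<close>, moved to the manifold, through the derivative of \<open>X\<^sub>a\<close> along
\<open>X\<^sub>b\<close>, up to a term symmetric in \<open>a\<close> and \<open>b\<close> (\<open>local_action_second_order\<close>). Antisymmetrising in \<open>a\<close> and \<open>b\<close> turns the former into the
Lie bracket and the latter into the bracket of vector fields.

The exchange of derivatives is \<open>second_derivative_symmetric\<close>, the mean value theorem applied
twice to a second difference.
\<close>

section \<open>Functions of class C^n on finite-dimensional spaces\<close>

definition fin_dim :: "'a::real_vector itself \<Rightarrow> bool" where
  "fin_dim _ \<longleftrightarrow> (\<exists>E. finite E \<and> span E = (UNIV :: 'a set))"

text \<open>
An orthogonal spanning set gives bounded coordinate functionals without a choice of basis:
vectors of the set that are zero get coefficient zero, since division by zero yields zero.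
\<close>

lemma fin_dim_coordinates:
  assumes "fin_dim TYPE('a::real_inner)"
  obtains C :: "'a::real_inner set" and k :: "'a::real_inner \<Rightarrow> 'a \<Rightarrow> real"
  where "finite C" "\<And>c. bounded_linear (k c)" "\<And>v. (\<Sum>c\<in>C. k c v *\<^sub>R c) = v"
proof -
  obtain E :: "'a set" where "finite E" "span E = UNIV"
    using assms unfolding fin_dim_def by blast
  then obtain C :: "'a set" where C: "finite C" "span C = UNIV" "pairwise orthogonal C"
    using basis_orthogonal by metis
  define k :: "'a \<Rightarrow> 'a \<Rightarrow> real" where "k = (\<lambda>c v. (v \<bullet> c) / (c \<bullet> c))"
  have "bounded_linear (k c)" for c
    unfolding k_def using bounded_linear_compose[OF bounded_linear_divide bounded_linear_inner_left] by blast
  moreover have "(\<Sum>c\<in>C. k c v *\<^sub>R c) = v" for v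
  proof -
    define w where "w = v - (\<Sum>c\<in>C. k c v *\<^sub>R c)"
    have "orthogonal w b" if b: "b \<in> C" for b
    proof -
      have "(\<Sum>c\<in>C. k c v *\<^sub>R c) \<bullet> b = (\<Sum>c\<in>C. if c = b then k c v * (b \<bullet> b) else 0)"
        unfolding inner_sum_left using C(3) b
        by (intro sum.cong) (auto simp: pairwise_def orthogonal_def)
      also have "\<dots> = k b v * (b \<bullet> b)" using b C(1) by simp
      also have "\<dots> = v \<bullet> b" by (simp add: k_def)
      finally show ?thesis by (simp add: w_def orthogonal_def inner_diff_left)
    qed
    then have "orthogonal w w" using orthogonal_to_span[of w C w] C(2) by auto
    then show ?thesis by (simp add: w_def orthogonal_def)
  qed
  ultimately show ?thesis using that C(1) by blast
qed

lemma fin_dim_real: "fin_dim TYPE(real)"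
  unfolding fin_dim_def
proof (intro exI conjI)
  show "span {1::real} = UNIV" by (auto simp: span_singleton)
qed simp

lemma fin_dim_prod:
  assumes "fin_dim TYPE('a::real_vector)" "fin_dim TYPE('b::real_vector)"
  shows "fin_dim TYPE('a::real_vector \<times> 'b::real_vector)"
proof -
  obtain E :: "'a set" and F :: "'b set"
    where E: "finite E" "span E = UNIV" and F: "finite F" "span F = UNIV"
    using assms unfolding fin_dim_def by blast
  let ?l = "\<lambda>x::'a. (x, 0::'b)" and ?r = "\<lambda>y::'b. (0::'a, y)"
  have "linear ?l" "linear ?r" by (auto intro!: linearI)
  then have "span (?l ` E) = ?l ` UNIV" "span (?r ` F) = ?r ` UNIV"
    using E F by (simp_all add: linear_span_image)
  then have "(x, y) \<in> span (?l ` E \<union> ?r ` F)" for x y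
  proof -
    have "?l x \<in> span (?l ` E)" "?r y \<in> span (?r ` F)"
      using \<open>span (?l ` E) = _\<close> \<open>span (?r ` F) = _\<close> by auto
    then have "?l x \<in> span (?l ` E \<union> ?r ` F)" "?r y \<in> span (?l ` E \<union> ?r ` F)"
      by (meson span_mono sup_ge1 sup_ge2 subsetD)+
    from span_add[OF this] show ?thesis by simp
  qed
  then have "span (?l ` E \<union> ?r ` F) = UNIV" by auto
  then show ?thesis unfolding fin_dim_def using E F by (intro exI[of _ "?l ` E \<union> ?r ` F"]) auto
qed

lemma ck_on_SucD_has_derivative:
  "ck_on (Suc n) f S \<Longrightarrow> x \<in> S \<Longrightarrow> (f has_derivative frechet_derivative f (at x)) (at x)"
  by (simp add: frechet_derivative_works)

lemma ck_on_cong: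
  assumes "open S" "\<And>x. x \<in> S \<Longrightarrow> f x = g x" "ck_on n f S"
  shows "ck_on n g S"
  using assms(2,3)
proof (induction n arbitrary: f g)
  case 0
  then show ?case by (simp cong: continuous_on_cong)
next
  case (Suc n)
  have *: "(f has_derivative frechet_derivative f (at x)) (at x)" if "x \<in> S" for x
    using Suc.prems(2) that by (simp add: frechet_derivative_works)
  then have **: "(g has_derivative frechet_derivative f (at x)) (at x)" if "x \<in> S" for x
    using has_derivative_transform_within_open[OF * \<open>open S\<close>] that Suc.prems(1) by blast
  then have "frechet_derivative g (at x) = frechet_derivative f (at x)" if "x \<in> S" for x
    using frechet_derivative_at that by metis
  then have "ck_on n (\<lambda>x. frechet_derivative g (at x) v) S" for v
    using Suc.IH[of "\<lambda>x. frechet_derivative f (at x) v"] Suc.prems(2) by simp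
  then show ?case using ** by (auto simp: differentiable_def)
qed

lemma ck_on_SucI:
  assumes "open S" "\<And>x. x \<in> S \<Longrightarrow> (f has_derivative f' x) (at x)"
    and "\<And>v. ck_on n (\<lambda>x. f' x v) S"
  shows "ck_on (Suc n) f S"
proof -
  have "f' x = frechet_derivative f (at x)" if "x \<in> S" for x
    using frechet_derivative_at assms(2) that by blast
  then have "ck_on n (\<lambda>x. frechet_derivative f (at x) v) S" for v
    using ck_on_cong[OF assms(1) _ assms(3)[of v]] by simp
  then show ?thesis using assms(2) by (auto simp: differentiable_def)
qed

lemma ck_on_subset: "ck_on n f S \<Longrightarrow> T \<subseteq> S \<Longrightarrow> ck_on n f T"
  by (induction n arbitrary: f) (auto intro: continuous_on_subset)

lemma ck_on_SucD: "ck_on (Suc n) f S \<Longrightarrow> ck_on n f S"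
proof (induction n arbitrary: f)
  case 0
  then show ?case
    by (auto intro!: continuous_at_imp_continuous_on differentiable_imp_continuous_within)
next
  case (Suc n)
  have "f differentiable (at x)" if "x \<in> S" for x using Suc.prems that by simp
  moreover have "ck_on n (\<lambda>x. frechet_derivative f (at x) v) S" for v
    using Suc.IH Suc.prems ck_on.simps(2) by metis
  ultimately show ?case by simp
qed

lemma ck_on_local:
  assumes "\<And>x. x \<in> S \<Longrightarrow> \<exists>T. open T \<and> x \<in> T \<and> ck_on n f T"
  shows "ck_on n f S"
  using assms
proof (induction n arbitrary: f)
  case 0
  have "isCont f x" if "x \<in> S" for x
    using 0[OF that] by (auto simp: continuous_on_eq_continuous_at)
  then show ?case by (simp add: continuous_at_imp_continuous_on)
next
  case (Suc n)
  have "f differentiable (at x)" if "x \<in> S" for x using Suc.prems[OF that] by auto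
  moreover have "ck_on n (\<lambda>x. frechet_derivative f (at x) v) S" for v
    by (rule Suc.IH) (use Suc.prems in fastforce)
  ultimately show ?case by simp
qed

lemma ck_on_const: "ck_on n (\<lambda>x. c) S"
  by (induction n arbitrary: c) auto

lemma ck_on_bounded_linear_comp:
  assumes "open S" "bounded_linear L" "ck_on n f S"
  shows "ck_on n (\<lambda>x. L (f x)) S"
  using assms(3)
proof (induction n arbitrary: f)
  case 0
  then show ?case using assms(2) by (simp add: bounded_linear.continuous_on)
next
  case (Suc n)
  show ?case
  proof (rule ck_on_SucI[OF assms(1)])
    show "((\<lambda>x. L (f x)) has_derivative (\<lambda>v. L (frechet_derivative f (at x) v))) (at x)" if "x \<in> S" for x
      using bounded_linear.has_derivative[OF assms(2) ck_on_SucD_has_derivative[OF Suc.prems that]] .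
    show "ck_on n (\<lambda>x. L (frechet_derivative f (at x) v)) S" for v
      using Suc by simp
  qed
qed

lemma ck_on_add:
  assumes "open S" "ck_on n f S" "ck_on n g S"
  shows "ck_on n (\<lambda>x. f x + g x) S"
  using assms(2,3)
proof (induction n arbitrary: f g)
  case 0
  then show ?case by (simp add: continuous_on_add)
next
  case (Suc n)
  show ?case
  proof (rule ck_on_SucI[OF assms(1)])
    show "((\<lambda>x. f x + g x) has_derivative
        (\<lambda>v. frechet_derivative f (at x) v + frechet_derivative g (at x) v)) (at x)" if "x \<in> S" for x
      by (intro has_derivative_add Suc.prems[THEN ck_on_SucD_has_derivative] that)
  qed (use Suc in simp)
qed

lemma ck_on_scaleR:
  assumes "open S" "ck_on n f S" "ck_on n g S"
  shows "ck_on n (\<lambda>x. f x *\<^sub>R g x) S"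
  using assms(2,3)
proof (induction n arbitrary: f g)
  case 0
  then show ?case by (simp add: continuous_on_scaleR)
next
  case (Suc n)
  note cn = Suc.prems[THEN ck_on_SucD]
  show ?case
  proof (rule ck_on_SucI[OF assms(1)])
    show "((\<lambda>x. f x *\<^sub>R g x) has_derivative
        (\<lambda>v. f x *\<^sub>R frechet_derivative g (at x) v + frechet_derivative f (at x) v *\<^sub>R g x)) (at x)"
      if "x \<in> S" for x
      by (intro has_derivative_scaleR Suc.prems[THEN ck_on_SucD_has_derivative] that)
    show "ck_on n (\<lambda>x. f x *\<^sub>R frechet_derivative g (at x) v + frechet_derivative f (at x) v *\<^sub>R g x) S" for v
      using Suc.prems cn by (intro ck_on_add[OF assms(1)] Suc.IH) simp_all
  qed
qed

lemma ck_on_sum: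
  assumes "open S" "\<And>i. i \<in> I \<Longrightarrow> ck_on n (f i) S"
  shows "ck_on n (\<lambda>x. \<Sum>i\<in>I. f i x) S"
  using assms(2)
  by (induction I rule: infinite_finite_induct) (auto intro: ck_on_add[OF assms(1)] ck_on_const)

lemma ck_on_ident: "open S \<Longrightarrow> ck_on n (\<lambda>x. x) S"
  by (cases n) (auto intro!: ck_on_const continuous_on_id)

lemma ck_on_bounded_linear:
  "open S \<Longrightarrow> bounded_linear L \<Longrightarrow> ck_on n L S"
  using ck_on_bounded_linear_comp[of S L n "\<lambda>x. x"] ck_on_ident by blast

lemma ck_on_Pair:
  assumes "open S" "ck_on n f S" "ck_on n g S"
  shows "ck_on n (\<lambda>x. (f x, g x)) S"
proof -
  have l: "bounded_linear (\<lambda>v. (v, 0))" "bounded_linear (\<lambda>v. (0, v))"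
    by (auto intro!: bounded_linear_Pair bounded_linear_ident bounded_linear_zero)
  show ?thesis
    using ck_on_add[OF assms(1) ck_on_bounded_linear_comp[OF assms(1) l(1) assms(2)]
        ck_on_bounded_linear_comp[OF assms(1) l(2) assms(3)]] by simp
qed

lemma linear_coordinate_sum:
  assumes "linear W" "\<And>v. (\<Sum>c\<in>C. k c v *\<^sub>R c) = v"
  shows "W v = (\<Sum>c\<in>C. k c v *\<^sub>R W c)"
proof -
  have "W v = W (\<Sum>c\<in>C. k c v *\<^sub>R c)" by (simp only: assms(2))
  also have "\<dots> = (\<Sum>c\<in>C. k c v *\<^sub>R W c)"
    using assms(1) by (simp add: linear_sum linear_cmul)
  finally show ?thesis .
qed

text \<open>
Pointwise application of a family of linear maps is smooth as soon as the family is smooth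
at each fixed vector: expanding the argument in coordinates leaves finitely many
products. The chain rule, the smoothness of \<open>\<omega>(X, Y)\<close> and the product rule below are
all of this shape.
\<close>

lemma ck_on_linear_family:
  fixes W :: "'c::real_normed_vector \<Rightarrow> 'a::real_inner \<Rightarrow> 'b::real_normed_vector"
  assumes "fin_dim TYPE('a)" "open S"
    and "\<And>y. y \<in> S \<Longrightarrow> linear (W y)"
    and "\<And>v. ck_on n (\<lambda>y. W y v) S"
    and "ck_on n N S"
  shows "ck_on n (\<lambda>y. W y (N y)) S"
proof -
  obtain C and k :: "'a \<Rightarrow> 'a \<Rightarrow> real"
    where C: "finite C" "\<And>c. bounded_linear (k c)" "\<And>v. (\<Sum>c\<in>C. k c v *\<^sub>R c) = v"
    by (rule fin_dim_coordinates[OF assms(1)]) (rule that)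
  have "ck_on n (\<lambda>y. \<Sum>c\<in>C. k c (N y) *\<^sub>R W y c) S"
    by (rule ck_on_sum[OF assms(2) ck_on_scaleR[OF assms(2) ck_on_bounded_linear_comp[OF assms(2) C(2) assms(5)] assms(4)]])
  then show ?thesis
    by (rule ck_on_cong[OF assms(2), rotated]) (rule linear_coordinate_sum[OF assms(3) C(3), symmetric])
qed

text \<open>
The derivative of the composition in a fixed direction applies the linear maps
\<open>Dg(f x)\<close> to \<open>Df(x) v\<close>, which is again a composition followed by an application of a
linear family; so the induction closes.
\<close>

lemma ck_on_compose:
  fixes f :: "'c::real_normed_vector \<Rightarrow> 'a::real_inner" and g :: "'a \<Rightarrow> 'b::real_normed_vector"
  assumes "fin_dim TYPE('a)" "open S" "f ` S \<subseteq> T"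
    and "ck_on n g T" "ck_on n f S"
  shows "ck_on n (\<lambda>x. g (f x)) S"
  using assms(4,5)
proof (induction n arbitrary: g)
  case 0
  then show ?case using continuous_on_compose2[of T g S f] assms(3) by simp
next
  case (Suc n)
  have T: "f x \<in> T" if "x \<in> S" for x using that assms(3) by blast
  show ?case
  proof (rule ck_on_SucI[OF assms(2)])
    show "((\<lambda>x. g (f x)) has_derivative
      (\<lambda>v. frechet_derivative g (at (f x)) (frechet_derivative f (at x) v))) (at x)" if "x \<in> S" for x
      using has_derivative_compose[OF ck_on_SucD_has_derivative[OF Suc.prems(2) that]
          ck_on_SucD_has_derivative[OF Suc.prems(1) T[OF that]]] .
    show "ck_on n (\<lambda>x. frechet_derivative g (at (f x)) (frechet_derivative f (at x) v)) S" for v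
    proof (rule ck_on_linear_family[OF assms(1,2)])
      show "linear (frechet_derivative g (at (f y)))" if "y \<in> S" for y
        using Suc.prems(1) T[OF that] by (simp add: linear_frechet_derivative)
      show "ck_on n (\<lambda>y. frechet_derivative g (at (f y)) v) S" for v
        using Suc.IH[of "\<lambda>y. frechet_derivative g (at y) v"] Suc.prems(1) ck_on_SucD[OF Suc.prems(2)] by simp
      show "ck_on n (\<lambda>x. frechet_derivative f (at x) v) S" using Suc.prems(2) by simp
    qed
  qed
qed

text \<open>
The product rule for the application of a linear map to a vector, both depending on a
point. Differentiability of the family is only required at each fixed vector.
\<close>

lemma has_derivative_linear_family:
  fixes W :: "'c::real_normed_vector \<Rightarrow> 'a::real_inner \<Rightarrow> 'b::real_normed_vector"
  assumes "fin_dim TYPE('a)" "open S" "x \<in> S"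
    and lin: "\<And>y. y \<in> S \<Longrightarrow> linear (W y)"
    and W: "\<And>v. ((\<lambda>y. W y v) has_derivative (\<lambda>w. W' w v)) (at x)"
    and N: "(N has_derivative N') (at x)"
  shows "((\<lambda>y. W y (N y)) has_derivative (\<lambda>w. W' w (N x) + W x (N' w))) (at x)"
proof -
  obtain C and k :: "'a \<Rightarrow> 'a \<Rightarrow> real"
    where C: "finite C" "\<And>c. bounded_linear (k c)" "\<And>v. (\<Sum>c\<in>C. k c v *\<^sub>R c) = v"
    by (rule fin_dim_coordinates[OF assms(1)]) (rule that)
  have W_sum: "W y v = (\<Sum>c\<in>C. k c v *\<^sub>R W y c)" if "y \<in> S" for y v
    using linear_coordinate_sum[of "W y" k C v] lin[OF that] C(3) by simp
  have "((\<lambda>y. \<Sum>c\<in>C. k c v *\<^sub>R W y c) has_derivative (\<lambda>w. \<Sum>c\<in>C. k c v *\<^sub>R W' w c)) (at x)" for v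
    by (rule has_derivative_sum[OF has_derivative_scaleR_right[OF W]])
  then have "((\<lambda>y. W y v) has_derivative (\<lambda>w. \<Sum>c\<in>C. k c v *\<^sub>R W' w c)) (at x)" for v
    by (rule has_derivative_transform_within_open[OF _ assms(2,3)]) (rule W_sum[symmetric])
  then have W'_sum: "(\<Sum>c\<in>C. k c v *\<^sub>R W' w c) = W' w v" for w v
    by (rule fun_cong[OF has_derivative_unique[OF _ W]])
  have "((\<lambda>y. \<Sum>c\<in>C. k c (N y) *\<^sub>R W y c) has_derivative
      (\<lambda>w. \<Sum>c\<in>C. k c (N x) *\<^sub>R W' w c + k c (N' w) *\<^sub>R W x c)) (at x)"
    by (rule has_derivative_sum[OF has_derivative_scaleR[OF bounded_linear.has_derivative[OF C(2) N] W]])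
  then have "((\<lambda>y. W y (N y)) has_derivative
      (\<lambda>w. \<Sum>c\<in>C. k c (N x) *\<^sub>R W' w c + k c (N' w) *\<^sub>R W x c)) (at x)"
    by (rule has_derivative_transform_within_open[OF _ assms(2,3)]) (rule W_sum[symmetric])
  also have "(\<lambda>w. \<Sum>c\<in>C. k c (N x) *\<^sub>R W' w c + k c (N' w) *\<^sub>R W x c) =
      (\<lambda>w. W' w (N x) + W x (N' w))"
    by (simp only: sum.distrib W'_sum W_sum[OF assms(3), symmetric])
  finally show ?thesis .
qed

section \<open>Second derivatives\<close>

definition second_derivative ::
  "('a::real_normed_vector \<Rightarrow> 'b::real_normed_vector) \<Rightarrow> 'a \<Rightarrow> 'a \<Rightarrow> 'a \<Rightarrow> 'b" where
  "second_derivative f x u v = frechet_derivative (\<lambda>y. frechet_derivative f (at y) v) (at x) u"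

lemma has_derivative_first_derivative:
  assumes "ck_on (Suc (Suc n)) f S" "x \<in> S"
  shows "((\<lambda>y. frechet_derivative f (at y) v) has_derivative (\<lambda>u. second_derivative f x u v)) (at x)"
  unfolding second_derivative_def using assms by (simp add: frechet_derivative_works)

lemma has_derivative_along_line:
  assumes "(f has_derivative f') (at (x + r *\<^sub>R u))"
  shows "((\<lambda>s. f (x + s *\<^sub>R u)) has_vector_derivative f' u) (at r)"
proof -
  have "((\<lambda>s. x + s *\<^sub>R u) has_derivative (\<lambda>s. s *\<^sub>R u)) (at r)"
    by (auto intro!: derivative_eq_intros)
  from has_derivative_compose[OF this assms] show ?thesis
    using has_derivative_linear[OF assms] by (simp add: has_vector_derivative_def linear_cmul)
qed

lemma isCont_eventually_dist:
  assumes "isCont f x" "e > 0"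
  shows "\<forall>\<^sub>F y in nhds x. dist (f y) (f x) < e"
proof -
  have "(f \<longlongrightarrow> f x) (nhds x)"
    using assms(1) tendsto_at_iff_tendsto_nhds by (auto simp: isCont_def)
  from tendstoD[OF this assms(2)] show ?thesis .
qed

text \<open>
The second difference of \<open>f\<close> over the parallelogram spanned by \<open>h u\<close> and \<open>h v\<close>, which is
symmetric in \<open>u\<close> and \<open>v\<close>, equals \<open>h * h\<close> times a second derivative at some point of the
parallelogram. This is the mean value theorem applied once in each direction.
\<close>

lemma second_difference_mvt:
  fixes f :: "'a::real_normed_vector \<Rightarrow> real"
  assumes f: "ck_on 2 f S" and h: "h > 0"
    and S: "\<And>s t. s \<in> {0..h} \<Longrightarrow> t \<in> {0..h} \<Longrightarrow> x + s *\<^sub>R u + t *\<^sub>R v \<in> S"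
  shows "\<exists>s\<in>{0..h}. \<exists>t\<in>{0..h}.
    f (x + h *\<^sub>R u + h *\<^sub>R v) - f (x + h *\<^sub>R u) - f (x + h *\<^sub>R v) + f x
      = h * h * second_derivative f (x + s *\<^sub>R u + t *\<^sub>R v) v u"
proof -
  have f2: "ck_on (Suc (Suc 0)) f S" using f by (simp add: numeral_2_eq_2)
  define D where "D y = frechet_derivative f (at y)" for y
  have D: "(f has_derivative D y) (at y)" if "y \<in> S" for y
    unfolding D_def using f2 that by (rule ck_on_SucD_has_derivative)
  define a where "a s = f (x + s *\<^sub>R u + h *\<^sub>R v) - f (x + s *\<^sub>R u)" for s
  have "(a has_real_derivative D (x + s *\<^sub>R u + h *\<^sub>R v) u - D (x + s *\<^sub>R u) u) (at s)"
    if "0 \<le> s" "s \<le> h" for s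
  proof -
    have "x + h *\<^sub>R v + s *\<^sub>R u \<in> S" "x + s *\<^sub>R u \<in> S"
      using S[of s h] S[of s 0] that h by (simp_all add: algebra_simps)
    from this[THEN D, THEN has_derivative_along_line]
    show ?thesis
      unfolding a_def has_real_derivative_iff_has_vector_derivative
      by (auto intro!: has_vector_derivative_diff simp: algebra_simps)
  qed
  from MVT2[OF h this] obtain s where s: "0 < s" "s < h"
    "a h - a 0 = h * (D (x + s *\<^sub>R u + h *\<^sub>R v) u - D (x + s *\<^sub>R u) u)" by auto
  have "((\<lambda>t. D (x + s *\<^sub>R u + t *\<^sub>R v) u) has_real_derivative second_derivative f (x + s *\<^sub>R u + t *\<^sub>R v) v u) (at t)"
    if "0 \<le> t" "t \<le> h" for t
  proof -
    have "x + s *\<^sub>R u + t *\<^sub>R v \<in> S" using S s that by simp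
    from has_derivative_along_line[OF has_derivative_first_derivative[OF f2 this]]
    show ?thesis unfolding D_def has_real_derivative_iff_has_vector_derivative .
  qed
  from MVT2[OF h this] obtain t where t: "0 < t" "t < h"
    "D (x + s *\<^sub>R u + h *\<^sub>R v) u - D (x + s *\<^sub>R u) u = h * second_derivative f (x + s *\<^sub>R u + t *\<^sub>R v) v u" by auto
  show ?thesis
    using s t by (intro bexI[of _ s] bexI[of _ t]) (auto simp: a_def)
qed

text \<open>
If the two mixed derivatives differed at \<open>x\<close>, then by continuity they would take disjoint
sets of values on a small parallelogram at \<open>x\<close>; but the second difference over that
parallelogram is a multiple of a value of each.
\<close>

lemma second_derivative_symmetric_real:
  fixes f :: "'a::real_normed_vector \<Rightarrow> real"
  assumes f: "ck_on 2 f S" and S: "open S" "x \<in> S"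
  shows "second_derivative f x u v = second_derivative f x v u"
proof (rule ccontr)
  assume neq: "second_derivative f x u v \<noteq> second_derivative f x v u"
  define e where "e = \<bar>second_derivative f x u v - second_derivative f x v u\<bar> / 2"
  have e: "e > 0" using neq by (simp add: e_def)
  have cont: "isCont (\<lambda>y. second_derivative f y a b) x" for a b
  proof -
    have "continuous_on S (\<lambda>y. second_derivative f y a b)"
      using f by (simp add: numeral_2_eq_2 second_derivative_def)
    then show ?thesis using S by (simp add: continuous_on_eq_continuous_at)
  qed
  have "\<forall>\<^sub>F y in nhds x. y \<in> S \<and> dist (second_derivative f y u v) (second_derivative f x u v) < e
      \<and> dist (second_derivative f y v u) (second_derivative f x v u) < e"
  proof (intro eventually_conj)
    show "\<forall>\<^sub>F y in nhds x. y \<in> S" using eventually_nhds_in_open[OF S] .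
    show "\<forall>\<^sub>F y in nhds x. dist (second_derivative f y u v) (second_derivative f x u v) < e"
      "\<forall>\<^sub>F y in nhds x. dist (second_derivative f y v u) (second_derivative f x v u) < e"
      by (rule isCont_eventually_dist[OF cont e])+
  qed
  then obtain d where d: "d > 0" "\<And>y. dist y x < d \<Longrightarrow> y \<in> S \<and> dist (second_derivative f y u v) (second_derivative f x u v) < e
      \<and> dist (second_derivative f y v u) (second_derivative f x v u) < e"
    unfolding eventually_nhds_metric by blast
  \<comment> \<open>The parallelogram with sides \<open>h u\<close>, \<open>h v\<close> then lies within distance \<open>d / 2\<close> of \<open>x\<close>.\<close>
  define h where "h = d / (2 * (norm u + norm v + 1))"
  have h: "h > 0" using d by (simp add: h_def add_nonneg_pos)
  have near: "dist (x + s *\<^sub>R u + t *\<^sub>R v) x < d" if "s \<in> {0..h}" "t \<in> {0..h}" for s t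
  proof -
    have "dist (x + s *\<^sub>R u + t *\<^sub>R v) x = norm (s *\<^sub>R u + t *\<^sub>R v)" by (simp add: dist_norm)
    also have "\<dots> \<le> norm (s *\<^sub>R u) + norm (t *\<^sub>R v)" by (rule norm_triangle_ineq)
    also have "\<dots> \<le> h * norm u + h * norm v"
      using that by (auto intro!: add_mono mult_right_mono)
    also have "\<dots> \<le> h * (norm u + norm v + 1)" using h by (simp add: algebra_simps)
    also have "\<dots> = d / 2"
    proof -
      define p where "p = norm u + norm v + 1"
      have "p > 0" by (simp add: p_def add_nonneg_pos)
      then show ?thesis unfolding h_def p_def[symmetric] by simp
    qed
    also have "\<dots> < d" using d by simp
    finally show ?thesis .
  qed
  have near': "dist (x + s *\<^sub>R v + t *\<^sub>R u) x < d" if "s \<in> {0..h}" "t \<in> {0..h}" for s t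
    using near[OF that(2,1)] by (simp add: algebra_simps)
  have "\<exists>s\<in>{0..h}. \<exists>t\<in>{0..h}.
    f (x + h *\<^sub>R u + h *\<^sub>R v) - f (x + h *\<^sub>R u) - f (x + h *\<^sub>R v) + f x
      = h * h * second_derivative f (x + s *\<^sub>R u + t *\<^sub>R v) v u"
    by (rule second_difference_mvt[OF f h]) (use near d in blast)
  moreover have "\<exists>s\<in>{0..h}. \<exists>t\<in>{0..h}.
    f (x + h *\<^sub>R v + h *\<^sub>R u) - f (x + h *\<^sub>R v) - f (x + h *\<^sub>R u) + f x
      = h * h * second_derivative f (x + s *\<^sub>R v + t *\<^sub>R u) u v"
    by (rule second_difference_mvt[OF f h]) (use near' d in blast)
  moreover have "f (x + h *\<^sub>R v + h *\<^sub>R u) - f (x + h *\<^sub>R v) - f (x + h *\<^sub>R u) + f x =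
      f (x + h *\<^sub>R u + h *\<^sub>R v) - f (x + h *\<^sub>R u) - f (x + h *\<^sub>R v) + f x"
    by (simp add: algebra_simps)
  ultimately obtain s t s' t' where st: "s \<in> {0..h}" "t \<in> {0..h}" "s' \<in> {0..h}" "t' \<in> {0..h}"
    "h * h * second_derivative f (x + s *\<^sub>R u + t *\<^sub>R v) v u = h * h * second_derivative f (x + s' *\<^sub>R v + t' *\<^sub>R u) u v"
    by metis
  then have "second_derivative f (x + s *\<^sub>R u + t *\<^sub>R v) v u = second_derivative f (x + s' *\<^sub>R v + t' *\<^sub>R u) u v"
    using h by simp
  moreover have "x + s' *\<^sub>R v + t' *\<^sub>R u = x + t' *\<^sub>R u + s' *\<^sub>R v" by (simp add: algebra_simps)
  ultimately have eq: "second_derivative f (x + s *\<^sub>R u + t *\<^sub>R v) v u = second_derivative f (x + t' *\<^sub>R u + s' *\<^sub>R v) u v"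
    by simp
  have "dist (second_derivative f (x + s *\<^sub>R u + t *\<^sub>R v) v u) (second_derivative f x v u) < e"
    "dist (second_derivative f (x + t' *\<^sub>R u + s' *\<^sub>R v) u v) (second_derivative f x u v) < e"
    using d near st by blast+
  then show False using eq unfolding e_def dist_real_def by (simp add: abs_if split: if_splits)
qed

text \<open>
The scalar case applies to every component \<open>f \<bullet> w\<close>.
\<close>

lemma second_derivative_symmetric:
  fixes f :: "'a::real_normed_vector \<Rightarrow> 'b::real_inner"
  assumes f: "ck_on 2 f S" and S: "open S" "x \<in> S"
  shows "second_derivative f x u v = second_derivative f x v u"
proof -
  have f2: "ck_on (Suc (Suc 0)) f S" using f by (simp add: numeral_2_eq_2)
  have "second_derivative f x u v \<bullet> w = second_derivative f x v u \<bullet> w" for w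
  proof -
    have fw: "ck_on 2 (\<lambda>y. f y \<bullet> w) S"
      by (rule ck_on_bounded_linear_comp[OF S(1) bounded_linear_inner_left f])
    have D1: "frechet_derivative f (at y) a \<bullet> w = frechet_derivative (\<lambda>y. f y \<bullet> w) (at y) a" if "y \<in> S" for y a
      using frechet_derivative_at[OF bounded_linear.has_derivative[OF bounded_linear_inner_left ck_on_SucD_has_derivative[OF f2 that]], of w]
      by metis
    have "second_derivative (\<lambda>y. f y \<bullet> w) x a b = second_derivative f x a b \<bullet> w" for a b
    proof -
      have "((\<lambda>y. frechet_derivative f (at y) b \<bullet> w) has_derivative (\<lambda>u. second_derivative f x u b \<bullet> w)) (at x)"
        by (intro bounded_linear.has_derivative[OF bounded_linear_inner_left] has_derivative_first_derivative[OF f2 S(2)])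
      then have "((\<lambda>y. frechet_derivative (\<lambda>y. f y \<bullet> w) (at y) b) has_derivative (\<lambda>u. second_derivative f x u b \<bullet> w)) (at x)"
        by (rule has_derivative_transform_within_open[OF _ S]) (simp add: D1)
      from frechet_derivative_at[OF this] show ?thesis unfolding second_derivative_def by metis
    qed
    then show ?thesis using second_derivative_symmetric_real[OF fw S] by metis
  qed
  then show ?thesis using vector_eq_ldot inner_commute by metis
qed

section \<open>Ordinary differential equations\<close>

text \<open>
In coordinates the operator norm of the derivative is controlled by its values on finitely
many vectors, and these are bounded near \<open>x\<close> by continuity.
\<close>

lemma locally_lipschitz_of_c1:
  fixes f :: "'a::real_inner \<Rightarrow> 'b::real_normed_vector"
  assumes "fin_dim TYPE('a)" "open S" "ck_on 1 f S" "x \<in> S"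
  obtains r L where "r > 0" "L \<ge> 0" "cball x r \<subseteq> S"
    "\<And>y z. y \<in> cball x r \<Longrightarrow> z \<in> cball x r \<Longrightarrow> norm (f y - f z) \<le> L * norm (y - z)"
proof -
  obtain C and k :: "'a \<Rightarrow> 'a \<Rightarrow> real"
    where C: "finite C" "\<And>c. bounded_linear (k c)" "\<And>v. (\<Sum>c\<in>C. k c v *\<^sub>R c) = v"
    by (rule fin_dim_coordinates[OF assms(1)]) (rule that)
  have f1: "ck_on (Suc 0) f S" using assms(3) by simp
  define D where "D y = frechet_derivative f (at y)" for y
  have D: "(f has_derivative D y) (at y)" if "y \<in> S" for y
    unfolding D_def using f1 that by (rule ck_on_SucD_has_derivative)
  have cont: "isCont (\<lambda>y. D y c) x" for c
    using f1 assms(2,4) unfolding D_def by (simp add: continuous_on_eq_continuous_at)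
  have "\<forall>\<^sub>F y in nhds x. dist (D y c) (D x c) < 1" for c
    using isCont_eventually_dist[OF cont zero_less_one] .
  then have "\<forall>\<^sub>F y in nhds x. y \<in> S \<and> (\<forall>c\<in>C. dist (D y c) (D x c) < 1)"
    by (intro eventually_conj eventually_nhds_in_open assms eventually_ball_finite C) auto
  then obtain d where d: "d > 0" "\<And>y. dist y x < d \<Longrightarrow> y \<in> S \<and> (\<forall>c\<in>C. dist (D y c) (D x c) < 1)"
    unfolding eventually_nhds_metric by blast
  define r where "r = d / 2"
  define L where "L = (\<Sum>c\<in>C. onorm (k c) * (norm (D x c) + 1))"
  have r: "r > 0" using d by (simp add: r_def)
  have L: "L \<ge> 0" unfolding L_def
    by (intro sum_nonneg mult_nonneg_nonneg onorm_pos_le C) simp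
  have near: "dist y x < d" if "y \<in> cball x r" for y
    using that d(1) by (simp add: r_def dist_commute)
  have D_le: "onorm (D y) \<le> L" if y: "y \<in> cball x r" for y
  proof (rule onorm_bound[OF L])
    fix v
    have "linear (D y)" using D d(2)[OF near[OF y]] has_derivative_linear by blast
    then have "D y v = (\<Sum>c\<in>C. k c v *\<^sub>R D y c)" using C(3) by (rule linear_coordinate_sum)
    then have "norm (D y v) \<le> (\<Sum>c\<in>C. norm (k c v) * norm (D y c))"
      using norm_sum[of "\<lambda>c. k c v *\<^sub>R D y c" C] by simp
    also have "\<dots> \<le> (\<Sum>c\<in>C. (onorm (k c) * norm v) * (norm (D x c) + 1))"
    proof (intro sum_mono mult_mono)
      fix c assume c: "c \<in> C"
      show "norm (k c v) \<le> onorm (k c) * norm v" by (rule onorm[OF C(2)])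
      have "norm (D y c) \<le> norm (D x c) + norm (D y c - D x c)"
        by (metis norm_triangle_sub)
      also have "norm (D y c - D x c) < 1" using d(2)[OF near[OF y]] c by (simp add: dist_norm)
      finally show "norm (D y c) \<le> norm (D x c) + 1" by simp
      show "0 \<le> onorm (k c) * norm v" using onorm_pos_le[OF C(2)] by simp
    qed simp
    also have "\<dots> = L * norm v" by (simp add: L_def sum_distrib_right sum_distrib_left mult_ac)
    finally show "norm (D y v) \<le> L * norm v" .
  qed
  have "norm (f y - f z) \<le> L * norm (y - z)" if "y \<in> cball x r" "z \<in> cball x r" for y z
    by (rule differentiable_bound[OF convex_cball _ D_le that])
      (use D d(2) near in \<open>blast intro: has_derivative_at_withinI\<close>)
  moreover have "cball x r \<subseteq> S" using d(2) near by blast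
  ultimately show ?thesis using that r L by blast
qed

lemma norm_integral_diff_le:
  fixes g :: "real \<Rightarrow> 'a::banach"
  assumes g: "continuous_on {p..q} g" and B: "\<And>t. t \<in> {p..q} \<Longrightarrow> norm (g t) \<le> B"
    and "a \<in> {p..q}" "b \<in> {p..q}"
  shows "norm (integral {p..a} g - integral {p..b} g) \<le> B * \<bar>a - b\<bar>"
proof -
  have *: "norm (integral {p..a} g - integral {p..b} g) \<le> B * (a - b)"
    if "b \<le> a" "a \<in> {p..q}" "b \<in> {p..q}" for a b
  proof -
    have "integral {p..b} g + integral {b..a} g = integral {p..a} g"
      using that g by (intro Henstock_Kurzweil_Integration.integral_combine integrable_continuous_interval)
        (auto intro: continuous_on_subset)
    then have "integral {p..a} g - integral {p..b} g = integral {b..a} g" by (simp add: algebra_simps)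
    moreover have "norm (integral {b..a} g) \<le> B * (a - b)"
      using that g B by (intro integral_bound) (auto intro: continuous_on_subset)
    ultimately show ?thesis by simp
  qed
  show ?thesis
  proof (cases "b \<le> a")
    case True
    then show ?thesis using * assms(3,4) by simp
  next
    case False
    then show ?thesis using *[of a b] assms(3,4) by (simp add: norm_minus_commute)
  qed
qed

text \<open>
The integral operator \<open>u \<mapsto> (t \<mapsto> x + integral {0..t} (F \<circ> u))\<close> is a contraction on the bounded
continuous functions with values in the ball. To have functions on the whole line, time is
clamped to \<open>[-e, e]\<close>. For times of either sign the integral from \<open>0\<close> is written as a difference of integrals
starting at \<open>-e\<close>.
\<close>

lemma picard_lindelof:
  fixes F :: "'a::banach \<Rightarrow> 'a"
  assumes r: "r > 0" and L: "L \<ge> 0"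
    and lip: "\<And>y z. y \<in> cball x r \<Longrightarrow> z \<in> cball x r \<Longrightarrow> norm (F y - F z) \<le> L * norm (y - z)"
  obtains e u where "e > 0" "u 0 = x"
    "\<And>t. t \<in> {-e<..<e} \<Longrightarrow> u t \<in> cball x r \<and> (u has_vector_derivative F (u t)) (at t)"
proof -
  define K where "K = norm (F x) + L * r + 1"
  have K: "K > 0" using r L by (simp add: K_def add_nonneg_pos)
  \<comment> \<open>The first bound keeps solutions in the ball, where \<open>K\<close> bounds \<open>F\<close>; the second makes the operator contract by 1/2.\<close>
  define e where "e = min (r / K) (1 / (2 * (L + 1)))"
  have e: "e > 0" "e * K \<le> r" "L * e \<le> 1 / 2"
  proof -
    show "e > 0" using r K L by (simp add: e_def)
    have "e \<le> r / K" by (simp add: e_def)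
    then show "e * K \<le> r" using K by (simp add: field_simps)
    have "e \<le> 1 / (2 * (L + 1))" by (simp add: e_def)
    then have "(L + 1) * e \<le> 1 / 2" using L by (simp add: field_simps)
    then show "L * e \<le> 1 / 2" using \<open>e > 0\<close> by (simp add: algebra_simps)
  qed
  have F_cont: "continuous_on (cball x r) F"
  proof (rule lipschitz_on_continuous_on)
    show "L-lipschitz_on (cball x r) F"
      using L lip by (intro lipschitz_onI) (auto simp: dist_norm)
  qed
  have F_bound: "norm (F y) \<le> K" if "y \<in> cball x r" for y
  proof -
    have "norm (F y) \<le> norm (F x) + norm (F y - F x)" by (metis norm_triangle_sub)
    also have "norm (F y - F x) \<le> L * norm (y - x)" using lip that r by simp
    also have "\<dots> \<le> L * r" using that L by (intro mult_left_mono) (auto simp: dist_norm norm_minus_commute)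
    finally show ?thesis by (simp add: K_def)
  qed
  define c where "c t = max (- e) (min e t)" for t
  have c_mem: "c t \<in> {-e..e}" and c_abs: "\<bar>c t\<bar> \<le> e" for t using e by (auto simp: c_def)
  have zero_mem: "0 \<in> {-e..e}" using e by simp
  define J where "J g t = integral {-e..t} g - integral {-e..0} g" for g :: "real \<Rightarrow> 'a" and t
  define X :: "(real \<Rightarrow>\<^sub>C 'a) set" where "X = PiC UNIV (\<lambda>_. cball x r)"
  have X: "apply_bcontfun u t \<in> cball x r" if "u \<in> X" for u t
    using that by (auto simp: X_def mem_PiC_iff)
  have Fu_cont: "continuous_on S (\<lambda>t. F (apply_bcontfun u t))" if "u \<in> X" for u S
    using X[OF that] by (intro continuous_on_compose2[OF F_cont]) auto
  define T where "T u = Bcontfun (\<lambda>t. x + J (\<lambda>t. F (apply_bcontfun u t)) (c t))" for u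
  have T_ball: "x + J (\<lambda>t. F (apply_bcontfun u t)) (c t) \<in> cball x r" if "u \<in> X" for u t
  proof -
    have "norm (J (\<lambda>t. F (apply_bcontfun u t)) (c t)) \<le> K * \<bar>c t - 0\<bar>"
      unfolding J_def
      by (rule norm_integral_diff_le[OF Fu_cont[OF that] F_bound[OF X[OF that]] c_mem zero_mem])
    also have "\<dots> \<le> K * e" using c_abs K by simp
    also have "\<dots> \<le> r" using e by (simp add: mult.commute)
    finally show ?thesis by (simp add: dist_norm)
  qed
  have T_apply: "apply_bcontfun (T u) = (\<lambda>t. x + J (\<lambda>t. F (apply_bcontfun u t)) (c t))" if u: "u \<in> X" for u
  proof -
    have "continuous_on {-e..e} (\<lambda>t. integral {-e..t} (\<lambda>t. F (apply_bcontfun u t)))"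
      by (intro indefinite_integral_continuous_1 integrable_continuous_interval Fu_cont u)
    moreover have "continuous_on UNIV c" unfolding c_def by (intro continuous_intros)
    ultimately have "continuous_on UNIV (\<lambda>t. integral {-e..c t} (\<lambda>t. F (apply_bcontfun u t)))"
      by (rule continuous_on_compose2) (use c_mem in auto)
    then have "continuous_on UNIV (\<lambda>t. x + J (\<lambda>t. F (apply_bcontfun u t)) (c t))"
      unfolding J_def by (intro continuous_intros)
    moreover have "bounded (range (\<lambda>t. x + J (\<lambda>t. F (apply_bcontfun u t)) (c t)))"
      by (rule bounded_subset[OF bounded_cball]) (use T_ball[OF u] in blast)
    ultimately show ?thesis unfolding T_def by (intro Bcontfun_inverse) (simp add: bcontfun_def)
  qed
  have "\<exists>!u. u \<in> X \<and> T u = u"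
  proof (rule Banach_fix)
    show "complete X" unfolding X_def complete_eq_closed by (rule closed_PiC) simp
    have "const_bcontfun x \<in> X" using r by (simp add: X_def mem_PiC_iff const_bcontfun.rep_eq)
    then show "X \<noteq> {}" by blast
    show "T ` X \<subseteq> X"
    proof
      fix w assume "w \<in> T ` X"
      then obtain u where u: "u \<in> X" "w = T u" by blast
      show "w \<in> X" unfolding u(2) X_def mem_PiC_iff T_apply[OF u(1)]
        using T_ball[OF u(1)] by blast
    qed
    show "dist (T u) (T v) \<le> (1 / 2) * dist u v" if uv: "u \<in> X" "v \<in> X" for u v
    proof (rule dist_bound)
      fix t
      let ?f = "\<lambda>t. F (apply_bcontfun u t)" and ?g = "\<lambda>t. F (apply_bcontfun v t)"
      have "(\<lambda>t. F (apply_bcontfun w t)) integrable_on {-e..a}" if "w \<in> X" for w a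
        by (intro integrable_continuous_interval Fu_cont that)
      note int = this[OF uv(1)] this[OF uv(2)]
      have "J ?f (c t) - J ?g (c t) =
          integral {-e..c t} (\<lambda>t. ?f t - ?g t) - integral {-e..0} (\<lambda>t. ?f t - ?g t)"
        unfolding J_def using int by (simp add: Henstock_Kurzweil_Integration.integral_diff)
      also have "norm \<dots> \<le> (L * dist u v) * \<bar>c t - 0\<bar>"
      proof (rule norm_integral_diff_le[OF _ _ c_mem zero_mem])
        show "continuous_on {-e..e} (\<lambda>t. ?f t - ?g t)"
          by (intro continuous_on_diff Fu_cont uv)
        fix t
        have "norm (?f t - ?g t) \<le> L * norm (apply_bcontfun u t - apply_bcontfun v t)"
          by (rule lip[OF X[OF uv(1)] X[OF uv(2)]])
        also have "\<dots> \<le> L * dist u v"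
          using L dist_bounded[of u t v] by (intro mult_left_mono) (simp_all add: dist_norm)
        finally show "norm (?f t - ?g t) \<le> L * dist u v" .
      qed
      also have "\<dots> \<le> (L * dist u v) * e" using c_abs L by (intro mult_left_mono) auto
      also have "\<dots> = (L * e) * dist u v" by simp
      also have "\<dots> \<le> (1 / 2) * dist u v" using e(3) by (intro mult_right_mono) auto
      finally show "dist (apply_bcontfun (T u) t) (apply_bcontfun (T v) t) \<le> (1 / 2) * dist u v"
        unfolding T_apply[OF uv(1)] T_apply[OF uv(2)] by (simp add: dist_norm)
    qed
  qed auto
  then obtain u where u: "u \<in> X" "T u = u" by blast
  let ?u = "apply_bcontfun u"
  have u_eq: "?u t = x + J (\<lambda>t. F (?u t)) (c t)" for t
    using fun_cong[OF T_apply[OF u(1)], of t] unfolding u(2) .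
  show ?thesis
  proof (rule that[of e ?u])
    show "e > 0" by (fact e)
    show "?u 0 = x" using u_eq[of 0] e by (simp add: c_def J_def)
    fix t assume t: "t \<in> {-e<..<e}"
    have "((\<lambda>s. integral {-e..s} (\<lambda>t. F (?u t))) has_vector_derivative F (?u t)) (at t within {-e..e})"
      using t by (intro integral_has_vector_derivative Fu_cont u) auto
    then have "((\<lambda>s. integral {-e..s} (\<lambda>t. F (?u t))) has_vector_derivative F (?u t)) (at t)"
      using t by (simp add: at_within_Icc_at)
    then have "((\<lambda>s. x + J (\<lambda>t. F (?u t)) s) has_vector_derivative F (?u t)) (at t)"
      unfolding J_def by (auto intro!: derivative_eq_intros)
    then have "(?u has_vector_derivative F (?u t)) (at t)"
    proof (rule has_vector_derivative_transform_within_open)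
      show "x + J (\<lambda>t. F (?u t)) s = ?u s" if "s \<in> {-e<..<e}" for s
        using u_eq[of s] that by (simp add: c_def)
    qed (use t in auto)
    then show "?u t \<in> cball x r \<and> (?u has_vector_derivative F (?u t)) (at t)"
      using X[OF u(1)] by blast
  qed
qed

text \<open>
Bootstrapping: if \<open>u\<close> is of class C^n then so is its derivative \<open>F \<circ> u\<close>.
\<close>

lemma smooth_ode_local_solution:
  fixes F :: "'a::{real_inner,banach} \<Rightarrow> 'a"
  assumes fin: "fin_dim TYPE('a)" and S: "open S" "x \<in> S" and F: "smooth_on F S"
  obtains e u where "e > 0" "u 0 = x" "smooth_on u {-e<..<e}"
    "\<And>t. t \<in> {-e<..<e} \<Longrightarrow> u t \<in> S \<and> (u has_vector_derivative F (u t)) (at t)"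
proof -
  obtain r L where rL: "r > 0" "L \<ge> 0" "cball x r \<subseteq> S"
    "\<And>y z. y \<in> cball x r \<Longrightarrow> z \<in> cball x r \<Longrightarrow> norm (F y - F z) \<le> L * norm (y - z)"
    by (rule locally_lipschitz_of_c1[OF fin S(1) _ S(2), of F]) (use F in \<open>auto simp: smooth_on_def\<close>)
  obtain e u where eu: "e > 0" "u 0 = x"
    "\<And>t. t \<in> {-e<..<e} \<Longrightarrow> u t \<in> cball x r \<and> (u has_vector_derivative F (u t)) (at t)"
    by (rule picard_lindelof[OF rL(1,2,4)]) (assumption | rule that)+
  let ?I = "{-e<..<e}"
  have uS: "u ` ?I \<subseteq> S" using eu(3) rL(3) by blast
  have "ck_on n u ?I" for n
  proof (induction n)
    case 0
    have "isCont u t" if "t \<in> ?I" for t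
      using eu(3)[OF that] has_vector_derivative_continuous by blast
    then show ?case by (simp add: continuous_at_imp_continuous_on)
  next
    case (Suc n)
    have Fu: "ck_on n (\<lambda>t. F (u t)) ?I"
      by (rule ck_on_compose[OF fin _ uS]) (use F Suc in \<open>auto simp: smooth_on_def\<close>)
    show ?case
    proof (rule ck_on_SucI)
      show "(u has_derivative (\<lambda>v. v *\<^sub>R F (u t))) (at t)" if "t \<in> ?I" for t
        using eu(3)[OF that] by (simp add: has_vector_derivative_def)
      show "ck_on n (\<lambda>t. v *\<^sub>R F (u t)) ?I" for v :: real
        by (rule ck_on_scaleR[OF _ ck_on_const Fu]) simp
    qed simp
  qed
  then show ?thesis
    using that[of e u] eu rL(3) unfolding smooth_on_def by blast
qed

section \<open>Charts and tangent vectors\<close>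

lemma smooth_on_has_derivative:
  "smooth_on f S \<Longrightarrow> x \<in> S \<Longrightarrow> (f has_derivative frechet_derivative f (at x)) (at x)"
  unfolding smooth_on_def by (meson ck_on_SucD_has_derivative)

lemma vector_derivative_chain:
  assumes "(g has_vector_derivative g') (at t)" "(f has_derivative f') (at (g t))"
  shows "((\<lambda>s. f (g s)) has_vector_derivative f' g') (at t)"
  using vector_derivative_diff_chain_within[of g g' t UNIV f f'] assms
  by (simp add: o_def has_derivative_at_withinI)

lemma has_vector_derivative_eventually_eq:
  assumes "(f has_vector_derivative f') (at t)" "\<forall>\<^sub>F s in nhds t. f s = g s"
  shows "(g has_vector_derivative f') (at t)"
proof -
  have "(f has_vector_derivative f') (at t within UNIV) = (g has_vector_derivative f') (at t within UNIV)"
    by (rule has_vector_derivative_cong_ev)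
      (use assms(2) eventually_nhds_x_imp_x[OF assms(2)] in simp_all)
  then show ?thesis using assms(1) by simp
qed

lemma isCont_eventually_mem:
  assumes "isCont k t" "open U" "k t \<in> U"
  shows "\<forall>\<^sub>F s in nhds t. k s \<in> U"
proof -
  have "(k \<longlongrightarrow> k t) (nhds t)"
    using assms(1) tendsto_at_iff_tendsto_nhds by (auto simp: isCont_def)
  from topological_tendstoD[OF this assms(2,3)] show ?thesis .
qed

lemma tangent_space_transition:
  assumes "v \<in> tangent_space A p" "c \<in> charts_at A p" "d \<in> charts_at A p"
  shows "v d = frechet_derivative (chart_map d \<circ> chart_inv c) (at (chart_map c p)) (v c)"
  using assms(1)[unfolded tangent_space_def mem_Collect_eq, THEN conjunct1, THEN bspec, OF assms(2), THEN bspec, OF assms(3)] .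

lemma tangent_space_outside:
  assumes "v \<in> tangent_space A p" "c \<notin> charts_at A p"
  shows "v c = 0"
  using assms(1)[unfolded tangent_space_def mem_Collect_eq, THEN conjunct2, THEN spec, THEN mp, OF assms(2)] .

lemma tangent_spaceI:
  assumes "\<And>c d. c \<in> charts_at A p \<Longrightarrow> d \<in> charts_at A p \<Longrightarrow>
      v d = frechet_derivative (chart_map d \<circ> chart_inv c) (at (chart_map c p)) (v c)"
    and "\<And>c. c \<notin> charts_at A p \<Longrightarrow> v c = 0"
  shows "v \<in> tangent_space A p"
  unfolding tangent_space_def mem_Collect_eq by (intro conjI ballI allI impI assms)

context smooth_manifold
begin

lemma fin_dim_model: "fin_dim TYPE('e)"
  unfolding fin_dim_def by (rule finite_dim)

lemma chart_inv_map: "c \<in> A \<Longrightarrow> p \<in> chart_dom c \<Longrightarrow> chart_inv c (chart_map c p) = p"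
  using chart_homeomorphism unfolding homeomorphism_def by blast

lemma chart_map_inv: "c \<in> A \<Longrightarrow> y \<in> chart_image c \<Longrightarrow> chart_map c (chart_inv c y) = y"
  using chart_homeomorphism unfolding homeomorphism_def by blast

lemma chart_inv_mem: "c \<in> A \<Longrightarrow> y \<in> chart_image c \<Longrightarrow> chart_inv c y \<in> chart_dom c"
  using chart_homeomorphism unfolding homeomorphism_def by blast

lemma chart_map_mem: "p \<in> chart_dom c \<Longrightarrow> chart_map c p \<in> chart_image c"
  unfolding chart_image_def by blast

lemma open_chart_dom: "c \<in> A \<Longrightarrow> open (chart_dom c)"
  and open_chart_image: "c \<in> A \<Longrightarrow> open (chart_image c)"
  using chart_open by blast+

lemma isCont_chart_map: "c \<in> A \<Longrightarrow> p \<in> chart_dom c \<Longrightarrow> isCont (chart_map c) p"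
  using chart_homeomorphism open_chart_dom unfolding homeomorphism_def
  by (metis continuous_on_eq_continuous_at)

lemma isCont_chart_inv: "c \<in> A \<Longrightarrow> y \<in> chart_image c \<Longrightarrow> isCont (chart_inv c) y"
  using chart_homeomorphism open_chart_image unfolding homeomorphism_def
  by (metis continuous_on_eq_continuous_at)

lemma continuous_on_chart_inv: "c \<in> A \<Longrightarrow> continuous_on (chart_image c) (chart_inv c)"
  using chart_homeomorphism unfolding homeomorphism_def by blast

lemma chart_image_Int:
  assumes "c \<in> A"
  shows "chart_map c ` (chart_dom c \<inter> U) = {y \<in> chart_image c. chart_inv c y \<in> U}"
proof (intro equalityI subsetI)
  fix y assume "y \<in> chart_map c ` (chart_dom c \<inter> U)"
  then show "y \<in> {y \<in> chart_image c. chart_inv c y \<in> U}"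
    using chart_inv_map[OF assms] chart_map_mem[of _ c] by auto
next
  fix y assume "y \<in> {y \<in> chart_image c. chart_inv c y \<in> U}"
  then show "y \<in> chart_map c ` (chart_dom c \<inter> U)"
    using chart_map_inv[OF assms] chart_inv_mem[OF assms] by (intro image_eqI[of _ _ "chart_inv c y"]) auto
qed

lemma open_chart_image_Int:
  assumes "c \<in> A" "open U"
  shows "open {y \<in> chart_image c. chart_inv c y \<in> U}"
proof -
  have "open (chart_image c \<inter> chart_inv c -` U)"
    by (rule continuous_open_preimage[OF continuous_on_chart_inv open_chart_image]) (use assms in auto)
  then show ?thesis by (simp add: vimage_def Int_def)
qed

lemma charts_atD: "c \<in> charts_at A p \<Longrightarrow> c \<in> A" "c \<in> charts_at A p \<Longrightarrow> p \<in> chart_dom c"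
  by (auto simp: charts_at_def)

lemma charts_atI: "c \<in> A \<Longrightarrow> p \<in> chart_dom c \<Longrightarrow> c \<in> charts_at A p"
  by (auto simp: charts_at_def)

lemma chart_at_mem: "chart_at A p \<in> charts_at A p"
  unfolding chart_at_def by (rule someI_ex) (use charts_cover[of p] in \<open>simp add: charts_at_def Bex_def\<close>)

lemma transition_smooth:
  assumes "c \<in> A" "d \<in> A"
  shows "open {y \<in> chart_image c. chart_inv c y \<in> chart_dom d}"
    and "smooth_on (chart_map d \<circ> chart_inv c) {y \<in> chart_image c. chart_inv c y \<in> chart_dom d}"
  using open_chart_image_Int[OF assms(1) open_chart_dom[OF assms(2)]] charts_compatible[OF assms]
    chart_image_Int[OF assms(1)] by simp_all

lemma transition_has_derivative:
  assumes "c \<in> charts_at A p" "d \<in> charts_at A p"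
  shows "((chart_map d \<circ> chart_inv c) has_derivative
    frechet_derivative (chart_map d \<circ> chart_inv c) (at (chart_map c p))) (at (chart_map c p))"
  by (rule smooth_on_has_derivative[OF transition_smooth(2)])
    (use assms in \<open>auto simp: charts_at_def chart_inv_map chart_map_mem\<close>)

lemma eventually_chart_inv_map:
  assumes "c \<in> charts_at A (k t)" "isCont k t"
  shows "\<forall>\<^sub>F s in nhds t. k s \<in> chart_dom c \<and> chart_inv c (chart_map c (k s)) = k s"
proof -
  have c: "c \<in> A" "k t \<in> chart_dom c" using assms(1) by (simp_all add: charts_at_def)
  have "\<forall>\<^sub>F s in nhds t. k s \<in> chart_dom c"
    by (rule isCont_eventually_mem[OF assms(2) open_chart_dom[OF c(1)] c(2)])
  then show ?thesis
    by eventually_elim (simp add: chart_inv_map c)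
qed

lemma tangent_space_lincomb:
  assumes "v \<in> tangent_space A p" "w \<in> tangent_space A p"
  shows "tvec_add (tvec_scale r v) (tvec_scale s w) \<in> tangent_space A p"
proof -
  have "r *\<^sub>R v d + s *\<^sub>R w d =
      frechet_derivative (chart_map d \<circ> chart_inv c) (at (chart_map c p)) (r *\<^sub>R v c + s *\<^sub>R w c)"
    if c: "c \<in> charts_at A p" and d: "d \<in> charts_at A p" for c d
  proof -
    have lin: "linear (frechet_derivative (chart_map d \<circ> chart_inv c) (at (chart_map c p)))"
      by (rule has_derivative_linear[OF transition_has_derivative[OF c d]])
    have "v d = frechet_derivative (chart_map d \<circ> chart_inv c) (at (chart_map c p)) (v c)"
      "w d = frechet_derivative (chart_map d \<circ> chart_inv c) (at (chart_map c p)) (w c)"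
      by (rule tangent_space_transition[OF assms(1) c d] tangent_space_transition[OF assms(2) c d])+
    then show ?thesis by (simp only: linear_add[OF lin] linear_cmul[OF lin])
  qed
  moreover have "r *\<^sub>R v c + s *\<^sub>R w c = 0" if "c \<notin> charts_at A p" for c
  proof -
    show ?thesis by (simp add: tangent_space_outside[OF assms(1) that] tangent_space_outside[OF assms(2) that])
  qed
  ultimately show ?thesis unfolding tvec_add_def tvec_scale_def by (rule tangent_spaceI)
qed

lemma frechet_derivative_transition_self:
  assumes "c \<in> charts_at A p"
  shows "frechet_derivative (chart_map c \<circ> chart_inv c) (at (chart_map c p)) = id"
proof -
  have "(id has_derivative id) (at (chart_map c p))" by simp
  then have "((chart_map c \<circ> chart_inv c) has_derivative id) (at (chart_map c p))"
    by (rule has_derivative_transform_within_open[OF _ open_chart_image])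
      (use assms in \<open>auto simp: charts_at_def chart_map_inv chart_map_mem\<close>)
  from frechet_derivative_at[OF this] show ?thesis ..
qed

lemma coord_vec_self: "c \<in> charts_at A p \<Longrightarrow> coord_vec A c p u c = u"
  by (simp add: coord_vec_def frechet_derivative_transition_self)

lemma coord_vec_component:
  assumes "c \<in> charts_at A p" "v \<in> tangent_space A p"
  shows "coord_vec A c p (v c) = v"
proof
  fix d
  show "coord_vec A c p (v c) d = v d"
  proof (cases "d \<in> charts_at A p")
    case True
    show ?thesis unfolding coord_vec_def tangent_space_transition[OF assms(2,1) True] by (simp only: True if_True)
  next
    case False
    show ?thesis unfolding coord_vec_def tangent_space_outside[OF assms(2) False] by (simp only: False if_False)
  qed
qed

text \<open>
A tangent vector is determined by its components in a single chart. This is how equations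
between tangent vectors are reduced to computations in one chart.
\<close>

lemma tangent_space_eqI:
  assumes "c \<in> charts_at A p" "v \<in> tangent_space A p" "w \<in> tangent_space A p" "v c = w c"
  shows "v = w"
proof -
  have "v = coord_vec A c p (v c)" by (rule coord_vec_component[OF assms(1,2), symmetric])
  also have "\<dots> = w" unfolding assms(4) by (rule coord_vec_component[OF assms(1,3)])
  finally show ?thesis .
qed

lemma coord_vec_mem_tangent_space:
  assumes c: "c \<in> charts_at A p"
  shows "coord_vec A c p u \<in> tangent_space A p"
proof -
  have "frechet_derivative (chart_map d' \<circ> chart_inv d) (at (chart_map d p))
      (frechet_derivative (chart_map d \<circ> chart_inv c) (at (chart_map c p)) u)
    = frechet_derivative (chart_map d' \<circ> chart_inv c) (at (chart_map c p)) u"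
    if d: "d \<in> charts_at A p" and d': "d' \<in> charts_at A p" for d d'
  proof -
    let ?y = "chart_map c p"
    have y: "chart_inv c ?y = p" using c by (auto simp: charts_at_def chart_inv_map)
    have "((chart_map d' \<circ> chart_inv d) \<circ> (chart_map d \<circ> chart_inv c) has_derivative
      frechet_derivative (chart_map d' \<circ> chart_inv d) (at (chart_map d p)) \<circ>
      frechet_derivative (chart_map d \<circ> chart_inv c) (at ?y)) (at ?y)"
      using transition_has_derivative[OF d d'] transition_has_derivative[OF c d] y
      by (intro diff_chain_at) simp_all
    then have "((chart_map d' \<circ> chart_inv c) has_derivative
      frechet_derivative (chart_map d' \<circ> chart_inv d) (at (chart_map d p)) \<circ>
      frechet_derivative (chart_map d \<circ> chart_inv c) (at ?y)) (at ?y)"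
    proof (rule has_derivative_transform_within_open)
      show "open {y \<in> chart_image c. chart_inv c y \<in> chart_dom d}"
        using c d by (intro transition_smooth) (auto simp: charts_at_def)
      show "?y \<in> {y \<in> chart_image c. chart_inv c y \<in> chart_dom d}"
        using c d y by (simp add: charts_at_def chart_map_mem)
      show "((chart_map d' \<circ> chart_inv d) \<circ> (chart_map d \<circ> chart_inv c)) z = (chart_map d' \<circ> chart_inv c) z"
        if "z \<in> {y \<in> chart_image c. chart_inv c y \<in> chart_dom d}" for z
        using that d by (simp add: charts_at_def chart_inv_map)
    qed
    from fun_cong[OF frechet_derivative_at[OF this], of u] show ?thesis unfolding comp_apply .
  qed
  then show ?thesis
    by (intro tangent_spaceI) (simp_all only: coord_vec_def if_True if_False)
qed

lemma coord_vec_linear: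
  assumes c: "c \<in> charts_at A p"
  shows "coord_vec A c p (r *\<^sub>R u + s *\<^sub>R v) =
    tvec_add (tvec_scale r (coord_vec A c p u)) (tvec_scale s (coord_vec A c p v))"
proof (rule tangent_space_eqI[OF c])
  show "coord_vec A c p (r *\<^sub>R u + s *\<^sub>R v) c =
      tvec_add (tvec_scale r (coord_vec A c p u)) (tvec_scale s (coord_vec A c p v)) c"
    by (simp add: coord_vec_self[OF c] tvec_add_def tvec_scale_def)
qed (intro coord_vec_mem_tangent_space tangent_space_lincomb c)+

end

section \<open>Velocities of curves\<close>

text \<open>
Unlike \<open>velocity\<close>, whose value is meaningful only if the curve is differentiable, this
relation asserts the differentiability as well. Curves serve as the main tool for tangent
maps: functoriality and product rules are read off from their velocities.
\<close>

definition has_velocity ::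
  "('m::topological_space, 'e::real_normed_vector) chart set \<Rightarrow> (real \<Rightarrow> 'm) \<Rightarrow> real \<Rightarrow> ('m, 'e) tvec \<Rightarrow> bool" where
  "has_velocity A k t v \<longleftrightarrow> v \<in> tangent_space A (k t) \<and> isCont k t \<and>
    (\<forall>c\<in>charts_at A (k t). ((\<lambda>s. chart_map c (k s)) has_vector_derivative v c) (at t))"

context smooth_manifold
begin

text \<open>
The components of a velocity automatically transform by the Jacobians of the coordinate
changes, by the chain rule.
\<close>

lemma has_velocityI:
  assumes "isCont k t"
    and "\<And>c. c \<in> charts_at A (k t) \<Longrightarrow> ((\<lambda>s. chart_map c (k s)) has_vector_derivative v c) (at t)"
    and "\<And>c. c \<notin> charts_at A (k t) \<Longrightarrow> v c = 0"
  shows "has_velocity A k t v"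
proof -
  have "v d = frechet_derivative (chart_map d \<circ> chart_inv c) (at (chart_map c (k t))) (v c)"
    if c: "c \<in> charts_at A (k t)" and d: "d \<in> charts_at A (k t)" for c d
  proof -
    have "((\<lambda>s. (chart_map d \<circ> chart_inv c) (chart_map c (k s))) has_vector_derivative
      frechet_derivative (chart_map d \<circ> chart_inv c) (at (chart_map c (k t))) (v c)) (at t)"
      by (rule vector_derivative_chain[OF assms(2)[OF c] transition_has_derivative[OF c d]])
    moreover have "\<forall>\<^sub>F s in nhds t. (chart_map d \<circ> chart_inv c) (chart_map c (k s)) = chart_map d (k s)"
      using eventually_chart_inv_map[of c k t, OF c assms(1)] by eventually_elim simp
    ultimately have "((\<lambda>s. chart_map d (k s)) has_vector_derivative
      frechet_derivative (chart_map d \<circ> chart_inv c) (at (chart_map c (k t))) (v c)) (at t)"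
      by (rule has_vector_derivative_eventually_eq)
    then show ?thesis using assms(2)[OF d] vector_derivative_unique_at by blast
  qed
  then have "v \<in> tangent_space A (k t)" using assms(3) by (rule tangent_spaceI)
  then show ?thesis using assms(1,2) by (simp add: has_velocity_def)
qed

lemma has_velocity_chartI:
  assumes "c \<in> charts_at A (k t)" "isCont k t"
    and "((\<lambda>s. chart_map c (k s)) has_vector_derivative u) (at t)"
  shows "has_velocity A k t (coord_vec A c (k t) u)"
proof (rule has_velocityI[OF assms(2)])
  fix d assume d: "d \<in> charts_at A (k t)"
  have "((\<lambda>s. (chart_map d \<circ> chart_inv c) (chart_map c (k s))) has_vector_derivative
    frechet_derivative (chart_map d \<circ> chart_inv c) (at (chart_map c (k t))) u) (at t)"
    by (rule vector_derivative_chain[OF assms(3) transition_has_derivative[OF assms(1) d]])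
  moreover have "\<forall>\<^sub>F s in nhds t. (chart_map d \<circ> chart_inv c) (chart_map c (k s)) = chart_map d (k s)"
    using eventually_chart_inv_map[of c k t, OF assms(1,2)] by eventually_elim simp
  ultimately have "((\<lambda>s. chart_map d (k s)) has_vector_derivative
    frechet_derivative (chart_map d \<circ> chart_inv c) (at (chart_map c (k t))) u) (at t)"
    by (rule has_vector_derivative_eventually_eq)
  then show "((\<lambda>s. chart_map d (k s)) has_vector_derivative coord_vec A c (k t) u d) (at t)"
    using d by (simp add: coord_vec_def)
qed (simp add: coord_vec_def)

lemma has_velocity_component:
  "has_velocity A k t v \<Longrightarrow> c \<in> charts_at A (k t) \<Longrightarrow>
    ((\<lambda>s. chart_map c (k s)) has_vector_derivative v c) (at t)"
  by (simp add: has_velocity_def)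

lemma velocity_eq: "has_velocity A k t v \<Longrightarrow> velocity A k t = v"
  by (auto simp: has_velocity_def velocity_def fun_eq_iff o_def vector_derivative_at tangent_space_outside)

lemma has_velocity_unique: "has_velocity A k t v \<Longrightarrow> has_velocity A k t w \<Longrightarrow> v = w"
  using velocity_eq by blast

lemma has_velocity_const: "has_velocity A (\<lambda>_. p) t tvec_zero"
  by (rule has_velocityI) (auto simp: tvec_zero_def)

lemma has_velocity_cong:
  assumes "has_velocity A k t v" "\<forall>\<^sub>F s in nhds t. k s = l s"
  shows "has_velocity A l t v"
proof -
  have eq: "k t = l t" using assms(2) by (rule eventually_nhds_x_imp_x)
  have "isCont l t" using assms isCont_cong by (auto simp: has_velocity_def)
  moreover have "((\<lambda>s. chart_map c (l s)) has_vector_derivative v c) (at t)" if "c \<in> charts_at A (l t)" for c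
  proof -
    have "\<forall>\<^sub>F s in nhds t. chart_map c (k s) = chart_map c (l s)"
      using assms(2) by eventually_elim simp
    moreover have "((\<lambda>s. chart_map c (k s)) has_vector_derivative v c) (at t)"
      using has_velocity_component[OF assms(1)] that eq by simp
    ultimately show ?thesis by (metis has_vector_derivative_eventually_eq)
  qed
  ultimately show ?thesis using assms(1) eq unfolding has_velocity_def by simp
qed

lemma has_velocity_affine:
  assumes "has_velocity A k (r * t + q) v"
  shows "has_velocity A (\<lambda>s. k (r * s + q)) t (tvec_scale r v)"
proof (rule has_velocityI)
  have "isCont (\<lambda>s. r * s + q) t" by (intro continuous_intros)
  moreover have "isCont k (r * t + q)" using assms by (simp add: has_velocity_def)
  ultimately show "isCont (\<lambda>s. k (r * s + q)) t" by (rule isCont_o2)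
  fix c assume "c \<in> charts_at A (k (r * t + q))"
  from has_velocity_component[OF assms this]
  have k: "((\<lambda>s. chart_map c (k s)) has_derivative (\<lambda>x. x *\<^sub>R v c)) (at (r * t + q))"
    by (simp add: has_vector_derivative_def)
  have "((\<lambda>s. r * s + q) has_vector_derivative r) (at t)"
    by (auto intro!: derivative_eq_intros)
  from vector_derivative_chain[OF this k]
  show "((\<lambda>s. chart_map c (k (r * s + q))) has_vector_derivative tvec_scale r v c) (at t)"
    unfolding tvec_scale_def .
next
  fix c assume c: "c \<notin> charts_at A (k (r * t + q))"
  have "v \<in> tangent_space A (k (r * t + q))" using assms by (simp add: has_velocity_def)
  from tangent_space_outside[OF this c] show "tvec_scale r v c = 0" by (simp add: tvec_scale_def)
qed

lemma exists_curve_with_velocity: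
  assumes "v \<in> tangent_space A p"
  obtains k where "k 0 = p" "has_velocity A k 0 v"
proof -
  define c where "c = chart_at A p"
  have c: "c \<in> charts_at A p" unfolding c_def by (rule chart_at_mem)
  define k where "k s = chart_inv c (chart_map c p + s *\<^sub>R v c)" for s
  have k0: "k 0 = p" using c by (simp add: k_def chart_inv_map charts_atD)
  have line: "isCont (\<lambda>s. chart_map c p + s *\<^sub>R v c) 0" by (intro continuous_intros)
  have "isCont k 0" unfolding k_def
    by (rule isCont_o2[OF line]) (use c in \<open>simp add: isCont_chart_inv charts_atD chart_map_mem\<close>)
  moreover have "((\<lambda>s. chart_map c (k s)) has_vector_derivative v c) (at 0)"
  proof -
    have "((\<lambda>s. chart_map c p + s *\<^sub>R v c) has_vector_derivative v c) (at 0)"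
      by (auto intro!: derivative_eq_intros)
    moreover have "\<forall>\<^sub>F s in nhds 0. chart_map c p + s *\<^sub>R v c \<in> chart_image c"
      by (rule isCont_eventually_mem[OF line]) (use c in \<open>simp_all add: open_chart_image charts_atD chart_map_mem\<close>)
    then have "\<forall>\<^sub>F s in nhds 0. chart_map c p + s *\<^sub>R v c = chart_map c (k s)"
      unfolding k_def by eventually_elim (use c in \<open>simp add: chart_map_inv charts_atD\<close>)
    ultimately show ?thesis
      by (rule has_vector_derivative_eventually_eq)
  qed
  ultimately have "has_velocity A k 0 (coord_vec A c (k 0) (v c))"
    by (intro has_velocity_chartI) (simp_all add: k0 c)
  then show ?thesis using that[of k] k0 coord_vec_component[OF c assms] by simp
qed

end

section \<open>Tangent maps\<close>

lemma frechet_derivative_eq: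
  "(f has_derivative f') (at x) \<Longrightarrow> frechet_derivative f (at x) = f'"
  by (rule frechet_derivative_at[symmetric])

lemma smooth_map_coords:
  assumes A: "smooth_manifold A" and B: "smooth_manifold B"
    and F: "smooth_map A B F" and c: "c \<in> A" and d: "d \<in> B"
  shows "open {y \<in> chart_image c. F (chart_inv c y) \<in> chart_dom d}"
    and "smooth_on (\<lambda>y. chart_map d (F (chart_inv c y))) {y \<in> chart_image c. F (chart_inv c y) \<in> chart_dom d}"
proof -
  have "open (F -` chart_dom d)"
    using F smooth_manifold.open_chart_dom[OF B d]
    by (intro open_vimage) (simp_all add: smooth_map_def)
  from smooth_manifold.open_chart_image_Int[OF A c this]
  show "open {y \<in> chart_image c. F (chart_inv c y) \<in> chart_dom d}" by (simp add: vimage_def)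
  have "smooth_on (chart_map d \<circ> F \<circ> chart_inv c) (chart_map c ` (chart_dom c \<inter> F -` chart_dom d))"
    using F c d unfolding smooth_map_def by blast
  then show "smooth_on (\<lambda>y. chart_map d (F (chart_inv c y))) {y \<in> chart_image c. F (chart_inv c y) \<in> chart_dom d}"
    unfolding smooth_manifold.chart_image_Int[OF A c] by (simp add: o_def vimage_def)
qed

text \<open>
The coordinate representation of a map on a product manifold with respect to charts of the
two factors and of the target, and the set on which it is defined.
\<close>

definition prod_rep ::
  "('m, 'e) chart \<Rightarrow> ('n, 'f) chart \<Rightarrow> ('l, 'k) chart \<Rightarrow> ('m \<times> 'n \<Rightarrow> 'l) \<Rightarrow> 'e \<times> 'f \<Rightarrow> 'k" where
  "prod_rep c c' d F = (\<lambda>p. chart_map d (F (chart_inv c (fst p), chart_inv c' (snd p))))"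

definition prod_rep_dom ::
  "('m, 'e) chart \<Rightarrow> ('n, 'f) chart \<Rightarrow> ('l, 'k) chart \<Rightarrow> ('m \<times> 'n \<Rightarrow> 'l) \<Rightarrow> ('e \<times> 'f) set" where
  "prod_rep_dom c c' d F = {p. fst p \<in> chart_image c \<and> snd p \<in> chart_image c' \<and>
     F (chart_inv c (fst p), chart_inv c' (snd p)) \<in> chart_dom d}"

text \<open>
A product chart has the product of the two inverse charts as its inverse, but only on its
image: elsewhere both inverses are unspecified.
\<close>

lemma prod_rep_open_smooth:
  assumes A: "smooth_manifold A" and B: "smooth_manifold B" and C: "smooth_manifold C"
    and F: "smooth_map (prod_atlas A B) C F" and c: "c \<in> A" "c' \<in> B" "d \<in> C"
  shows "open (prod_rep_dom c c' d F)"
    and "smooth_on (prod_rep c c' d F) (prod_rep_dom c c' d F)"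
proof -
  interpret A: smooth_manifold A by fact
  interpret B: smooth_manifold B by fact
  interpret C: smooth_manifold C by fact
  define i where "i p = (chart_inv c (fst p), chart_inv c' (snd p))" for p
  define e where "e = (chart_dom c \<times> chart_dom c', map_prod (chart_map c) (chart_map c'))"
  let ?S = "prod_rep_dom c c' d F"
  have "open (F -` chart_dom d)"
    using F C.open_chart_dom[OF c(3)] by (intro open_vimage) (simp_all add: smooth_map_def)
  moreover have "continuous_on (chart_image c \<times> chart_image c') i"
    unfolding i_def
    by (intro continuous_on_Pair continuous_on_compose2[OF A.continuous_on_chart_inv[OF c(1)]]
        continuous_on_compose2[OF B.continuous_on_chart_inv[OF c(2)]] continuous_intros) auto
  moreover have "open (chart_image c \<times> chart_image c')"
    using c by (intro open_Times A.open_chart_image B.open_chart_image)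
  ultimately have "open ((chart_image c \<times> chart_image c') \<inter> i -` (F -` chart_dom d))"
    by (intro continuous_open_preimage)
  moreover have S_eq: "(chart_image c \<times> chart_image c') \<inter> i -` (F -` chart_dom d) = ?S"
    by (auto simp: prod_rep_dom_def i_def)
  ultimately show S: "open ?S" by simp
  have e_inv: "chart_inv e (map_prod (chart_map c) (chart_map c') q) = q" if "q \<in> chart_dom c \<times> chart_dom c'" for q
  proof -
    have "inj_on (chart_map c) (chart_dom c)" "inj_on (chart_map c') (chart_dom c')"
      using A.chart_inv_map[OF c(1)] B.chart_inv_map[OF c(2)] by (metis inj_onI)+
    then have "inj_on (map_prod (chart_map c) (chart_map c')) (chart_dom c \<times> chart_dom c')"
      by (rule map_prod_inj_on)
    from inv_into_f_f[OF this that] show ?thesis by (simp add: chart_inv_def e_def)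
  qed
  have i_dom: "i p \<in> chart_dom c \<times> chart_dom c'" and i_inv: "map_prod (chart_map c) (chart_map c') (i p) = p"
    if "p \<in> ?S" for p
    using that c by (auto simp: prod_rep_dom_def i_def A.chart_inv_mem B.chart_inv_mem A.chart_map_inv B.chart_map_inv)
  have e_i: "chart_inv e p = i p" if "p \<in> ?S" for p
    using e_inv[OF i_dom[OF that]] i_inv[OF that] by simp
  have image: "chart_map e ` (chart_dom e \<inter> F -` chart_dom d) = ?S"
  proof (intro equalityI subsetI)
    fix p assume "p \<in> chart_map e ` (chart_dom e \<inter> F -` chart_dom d)"
    then obtain x y where "x \<in> chart_dom c" "y \<in> chart_dom c'" "F (x, y) \<in> chart_dom d" "p = (chart_map c x, chart_map c' y)"
      by (auto simp: e_def)
    then show "p \<in> ?S"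
      by (simp add: prod_rep_dom_def A.chart_inv_map B.chart_inv_map c A.chart_map_mem B.chart_map_mem)
  next
    fix p assume p: "p \<in> ?S"
    have "i p \<in> F -` chart_dom d" using p by (simp add: prod_rep_dom_def i_def)
    then show "p \<in> chart_map e ` (chart_dom e \<inter> F -` chart_dom d)"
      using i_dom[OF p] i_inv[OF p] by (intro image_eqI[of _ _ "i p"]) (auto simp: e_def)
  qed
  have "e \<in> prod_atlas A B" using c unfolding e_def prod_atlas_def by blast
  then have sm: "smooth_on (chart_map d \<circ> F \<circ> chart_inv e) ?S"
    using F c(3) unfolding smooth_map_def image[symmetric] by blast
  have eq: "(chart_map d \<circ> F \<circ> chart_inv e) p = prod_rep c c' d F p" if "p \<in> ?S" for p
    using e_i[OF that] by (simp add: prod_rep_def i_def)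
  show "smooth_on (prod_rep c c' d F) ?S"
    unfolding smooth_on_def
  proof
    fix n
    show "ck_on n (prod_rep c c' d F) ?S"
      by (rule ck_on_cong[OF S eq]) (use sm in \<open>simp_all only: smooth_on_def\<close>)
  qed
qed

lemma has_velocity_map:
  assumes A: "smooth_manifold A" and B: "smooth_manifold B" and F: "smooth_map A B F"
    and k: "has_velocity A k t v"
  shows "has_velocity B (\<lambda>s. F (k s)) t (tangent_map A B F (k t) v)"
proof (rule smooth_manifold.has_velocityI[OF B])
  interpret A: smooth_manifold A by fact
  interpret B: smooth_manifold B by fact
  have kc: "isCont k t" using k by (simp add: has_velocity_def)
  have "continuous_on UNIV F" using F by (simp add: smooth_map_def)
  then have "isCont F (k t)" by (simp add: continuous_on_eq_continuous_at)
  with kc show "isCont (\<lambda>s. F (k s)) t" by (rule isCont_o2)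
  fix d assume d: "d \<in> charts_at B (F (k t))"
  define c where "c = chart_at A (k t)"
  have c: "c \<in> charts_at A (k t)" unfolding c_def by (rule A.chart_at_mem)
  note sm = smooth_map_coords[OF A B F A.charts_atD(1)[OF c] B.charts_atD(1)[OF d]]
  have kt: "chart_inv c (chart_map c (k t)) = k t" using c by (simp add: A.chart_inv_map A.charts_atD)
  have "chart_map c (k t) \<in> {y \<in> chart_image c. F (chart_inv c y) \<in> chart_dom d}"
    using c d by (simp add: kt A.chart_map_mem A.charts_atD B.charts_atD)
  from vector_derivative_chain[OF A.has_velocity_component[OF k c] smooth_on_has_derivative[OF sm(2) this]]
  have "((\<lambda>s. chart_map d (F (chart_inv c (chart_map c (k s))))) has_vector_derivative
     frechet_derivative (\<lambda>y. chart_map d (F (chart_inv c y))) (at (chart_map c (k t))) (v c)) (at t)" .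
  moreover have "\<forall>\<^sub>F s in nhds t. chart_map d (F (chart_inv c (chart_map c (k s)))) = chart_map d (F (k s))"
    using A.eventually_chart_inv_map[of c k t, OF c kc] by eventually_elim simp
  ultimately have "((\<lambda>s. chart_map d (F (k s))) has_vector_derivative
     frechet_derivative (\<lambda>y. chart_map d (F (chart_inv c y))) (at (chart_map c (k t))) (v c)) (at t)"
    by (rule has_vector_derivative_eventually_eq)
  then show "((\<lambda>s. chart_map d (F (k s))) has_vector_derivative tangent_map A B F (k t) v d) (at t)"
    using d by (simp add: tangent_map_def c_def o_def)
qed (simp add: tangent_map_def)

lemma prod_rep_has_derivative:
  assumes A: "smooth_manifold A" and B: "smooth_manifold B" and C: "smooth_manifold C"
    and F: "smooth_map (prod_atlas A B) C F"
    and c: "c \<in> charts_at A p" "c' \<in> charts_at B q" "d \<in> charts_at C (F (p, q))"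
  shows "(chart_map c p, chart_map c' q) \<in> prod_rep_dom c c' d F"
    and "(prod_rep c c' d F has_derivative
      frechet_derivative (prod_rep c c' d F) (at (chart_map c p, chart_map c' q))) (at (chart_map c p, chart_map c' q))"
proof -
  interpret A: smooth_manifold A by fact
  interpret B: smooth_manifold B by fact
  interpret C: smooth_manifold C by fact
  note cD = A.charts_atD[OF c(1)] B.charts_atD[OF c(2)] C.charts_atD[OF c(3)]
  show *: "(chart_map c p, chart_map c' q) \<in> prod_rep_dom c c' d F"
    using cD by (simp add: prod_rep_dom_def A.chart_map_mem B.chart_map_mem A.chart_inv_map B.chart_inv_map)
  show "(prod_rep c c' d F has_derivative
      frechet_derivative (prod_rep c c' d F) (at (chart_map c p, chart_map c' q))) (at (chart_map c p, chart_map c' q))"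
    by (rule smooth_on_has_derivative[OF prod_rep_open_smooth(2)[OF A B C F cD(1,3,5)] *])
qed

text \<open>
Tangent maps of partial maps are partial derivatives of the representation in a product
chart. The charts of the varying factor are those that \<open>tangent_map\<close> selects; the chart
of the other factor is arbitrary.
\<close>

lemma tangent_map_slices:
  assumes A: "smooth_manifold A" and B: "smooth_manifold B" and C: "smooth_manifold C"
    and F: "smooth_map (prod_atlas A B) C F"
    and d: "d \<in> charts_at C (F (p, q))"
  shows "c' \<in> charts_at B q \<Longrightarrow> tangent_map A C (\<lambda>x. F (x, q)) p v d =
      frechet_derivative (prod_rep (chart_at A p) c' d F) (at (chart_map (chart_at A p) p, chart_map c' q)) (v (chart_at A p), 0)"
    and "c \<in> charts_at A p \<Longrightarrow> tangent_map B C (\<lambda>y. F (p, y)) q w d =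
      frechet_derivative (prod_rep c (chart_at B q) d F) (at (chart_map c p, chart_map (chart_at B q) q)) (0, w (chart_at B q))"
proof -
  interpret A: smooth_manifold A by fact
  interpret B: smooth_manifold B by fact
  interpret C: smooth_manifold C by fact
  {
    assume c': "c' \<in> charts_at B q"
    define c where "c = chart_at A p"
    have c: "c \<in> charts_at A p" unfolding c_def by (rule A.chart_at_mem)
    have "((\<lambda>y. (y, chart_map c' q)) has_derivative (\<lambda>u. (u, 0))) (at (chart_map c p))"
      by (auto intro!: derivative_eq_intros)
    from has_derivative_compose[OF this prod_rep_has_derivative(2)[OF A B C F c c' d]]
    have "((\<lambda>y. chart_map d (F (chart_inv c y, q))) has_derivative
      (\<lambda>u. frechet_derivative (prod_rep c c' d F) (at (chart_map c p, chart_map c' q)) (u, 0))) (at (chart_map c p))"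
      using c' by (simp add: prod_rep_def B.chart_inv_map B.charts_atD)
    from frechet_derivative_eq[OF this]
    show "tangent_map A C (\<lambda>x. F (x, q)) p v d =
      frechet_derivative (prod_rep (chart_at A p) c' d F) (at (chart_map (chart_at A p) p, chart_map c' q)) (v (chart_at A p), 0)"
      using d by (simp add: tangent_map_def o_def c_def)
  next
    assume c: "c \<in> charts_at A p"
    define c' where "c' = chart_at B q"
    have c': "c' \<in> charts_at B q" unfolding c'_def by (rule B.chart_at_mem)
    have "((\<lambda>y. (chart_map c p, y)) has_derivative (\<lambda>u. (0, u))) (at (chart_map c' q))"
      by (auto intro!: derivative_eq_intros)
    from has_derivative_compose[OF this prod_rep_has_derivative(2)[OF A B C F c c' d]]
    have "((\<lambda>y. chart_map d (F (p, chart_inv c' y))) has_derivative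
      (\<lambda>u. frechet_derivative (prod_rep c c' d F) (at (chart_map c p, chart_map c' q)) (0, u))) (at (chart_map c' q))"
      using c by (simp add: prod_rep_def A.chart_inv_map A.charts_atD)
    from frechet_derivative_eq[OF this]
    show "tangent_map B C (\<lambda>y. F (p, y)) q w d =
      frechet_derivative (prod_rep c (chart_at B q) d F) (at (chart_map c p, chart_map (chart_at B q) q)) (0, w (chart_at B q))"
      using d by (simp add: tangent_map_def o_def c'_def)
  }
qed

text \<open>
The total derivative in a product chart splits, by linearity, into the partial derivatives.
\<close>

lemma has_velocity_map2:
  assumes A: "smooth_manifold A" and B: "smooth_manifold B" and C: "smooth_manifold C"
    and F: "smooth_map (prod_atlas A B) C F"
    and k: "has_velocity A k t v" and l: "has_velocity B l t w"
  shows "has_velocity C (\<lambda>s. F (k s, l s)) t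
    (tvec_add (tangent_map A C (\<lambda>x. F (x, l t)) (k t) v) (tangent_map B C (\<lambda>y. F (k t, y)) (l t) w))"
proof (rule smooth_manifold.has_velocityI[OF C])
  interpret A: smooth_manifold A by fact
  interpret B: smooth_manifold B by fact
  interpret C: smooth_manifold C by fact
  have cont: "isCont k t" "isCont l t" using k l by (simp_all add: has_velocity_def)
  have "continuous_on UNIV F" using F by (simp add: smooth_map_def)
  then have "isCont F (k t, l t)" by (simp add: continuous_on_eq_continuous_at)
  with isCont_Pair[OF cont] show "isCont (\<lambda>s. F (k s, l s)) t" by (rule isCont_o2)
  fix d assume d: "d \<in> charts_at C (F (k t, l t))"
  define c where "c = chart_at A (k t)"
  define c' where "c' = chart_at B (l t)"
  have c: "c \<in> charts_at A (k t)" unfolding c_def by (rule A.chart_at_mem)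
  have c': "c' \<in> charts_at B (l t)" unfolding c'_def by (rule B.chart_at_mem)
  let ?D = "frechet_derivative (prod_rep c c' d F) (at (chart_map c (k t), chart_map c' (l t)))"
  note D = prod_rep_has_derivative(2)[OF A B C F c c' d]
  have "((\<lambda>s. (chart_map c (k s), chart_map c' (l s))) has_vector_derivative (v c, w c')) (at t)"
    by (intro has_vector_derivative_Pair A.has_velocity_component[OF k c] B.has_velocity_component[OF l c'])
  from vector_derivative_chain[OF this D]
  have "((\<lambda>s. prod_rep c c' d F (chart_map c (k s), chart_map c' (l s))) has_vector_derivative ?D (v c, w c')) (at t)" .
  moreover have "\<forall>\<^sub>F s in nhds t. prod_rep c c' d F (chart_map c (k s), chart_map c' (l s)) = chart_map d (F (k s, l s))"
    using A.eventually_chart_inv_map[of c k t, OF c cont(1)] B.eventually_chart_inv_map[of c' l t, OF c' cont(2)]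
    by eventually_elim (simp add: prod_rep_def)
  ultimately have *: "((\<lambda>s. chart_map d (F (k s, l s))) has_vector_derivative ?D (v c, w c')) (at t)"
    by (rule has_vector_derivative_eventually_eq)
  have "?D (v c, w c') = ?D ((v c, 0) + (0, w c'))" by simp
  also have "\<dots> = ?D (v c, 0) + ?D (0, w c')" by (rule linear_add[OF has_derivative_linear[OF D]])
  also have "\<dots> = tvec_add (tangent_map A C (\<lambda>x. F (x, l t)) (k t) v) (tangent_map B C (\<lambda>y. F (k t, y)) (l t) w) d"
    unfolding tvec_add_def tangent_map_slices(1)[OF A B C F d c'] tangent_map_slices(2)[OF A B C F d c]
      c_def[symmetric] c'_def[symmetric] ..
  finally show "((\<lambda>s. chart_map d (F (k s, l s))) has_vector_derivative
      tvec_add (tangent_map A C (\<lambda>x. F (x, l t)) (k t) v) (tangent_map B C (\<lambda>y. F (k t, y)) (l t) w) d) (at t)"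
    using * by simp
qed (simp add: tangent_map_def tvec_add_def)

section \<open>Integral curves of left-invariant fields\<close>

lemma smooth_on_directional_derivative:
  "smooth_on f U \<Longrightarrow> smooth_on (\<lambda>p. frechet_derivative f (at p) w) U"
  unfolding smooth_on_def by (metis ck_on.simps(2))

lemma smooth_on_compose:
  fixes f :: "'c::real_normed_vector \<Rightarrow> 'a::real_inner"
  assumes "fin_dim TYPE('a)" "open S" "f ` S \<subseteq> T" "smooth_on g T" "smooth_on f S"
  shows "smooth_on (\<lambda>x. g (f x)) S"
  using ck_on_compose[OF assms(1-3)] assms(4,5) unfolding smooth_on_def by blast

lemma smooth_on_Pair:
  "open S \<Longrightarrow> smooth_on f S \<Longrightarrow> smooth_on g S \<Longrightarrow> smooth_on (\<lambda>x. (f x, g x)) S"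
  unfolding smooth_on_def by (blast intro: ck_on_Pair)

lemma smooth_on_const: "smooth_on (\<lambda>x. c) S"
  and smooth_on_ident: "open S \<Longrightarrow> smooth_on (\<lambda>x. x) S"
  unfolding smooth_on_def by (blast intro: ck_on_const ck_on_ident)+

lemma smooth_on_local:
  assumes "\<And>x. x \<in> S \<Longrightarrow> \<exists>T. open T \<and> x \<in> T \<and> smooth_on f T"
  shows "smooth_on f S"
  using ck_on_local[of S _ f] assms unfolding smooth_on_def by meson

lemma smooth_on_cong:
  assumes "open S" "\<And>x. x \<in> S \<Longrightarrow> f x = g x" "smooth_on f S"
  shows "smooth_on g S"
  using ck_on_cong[of S f g, OF assms(1,2)] assms(3) unfolding smooth_on_def by blast

lemma tangent_map_slice_lincomb:
  assumes A: "smooth_manifold A" and B: "smooth_manifold B" and C: "smooth_manifold C"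
    and F: "smooth_map (prod_atlas A B) C F"
  shows "tangent_map A C (\<lambda>x. F (x, q)) p (tvec_add (tvec_scale r v) (tvec_scale s w)) =
      tvec_add (tvec_scale r (tangent_map A C (\<lambda>x. F (x, q)) p v)) (tvec_scale s (tangent_map A C (\<lambda>x. F (x, q)) p w))" (is "?L = ?R")
    and "tangent_map A C (\<lambda>x. F (x, q)) p tvec_zero = tvec_zero"
    and "tangent_map B C (\<lambda>y. F (p, y)) q tvec_zero = tvec_zero"
proof -
  interpret A: smooth_manifold A by fact
  interpret B: smooth_manifold B by fact
  interpret C: smooth_manifold C by fact
  note c = A.chart_at_mem[of p] and c' = B.chart_at_mem[of q]
  show "?L = ?R"
  proof
    fix d
    show "?L d = ?R d"
    proof (cases "d \<in> charts_at C (F (p, q))")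
      case True
      let ?D = "frechet_derivative (prod_rep (chart_at A p) (chart_at B q) d F) (at (chart_map (chart_at A p) p, chart_map (chart_at B q) q))"
      have lin: "linear ?D" by (rule has_derivative_linear[OF prod_rep_has_derivative(2)[OF A B C F c c' True]])
      have "?D (r *\<^sub>R v (chart_at A p) + s *\<^sub>R w (chart_at A p), 0) =
          ?D (r *\<^sub>R (v (chart_at A p), 0) + s *\<^sub>R (w (chart_at A p), 0))" by simp
      also have "\<dots> = r *\<^sub>R ?D (v (chart_at A p), 0) + s *\<^sub>R ?D (w (chart_at A p), 0)"
        by (simp only: linear_add[OF lin] linear_cmul[OF lin])
      finally show ?thesis
        unfolding tvec_add_def tvec_scale_def tangent_map_slices(1)[OF A B C F True c'] .
    next
      case False
      then show ?thesis by (simp add: tangent_map_def tvec_add_def tvec_scale_def)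
    qed
  qed
  show "tangent_map A C (\<lambda>x. F (x, q)) p tvec_zero = tvec_zero"
  proof
    fix d
    show "tangent_map A C (\<lambda>x. F (x, q)) p tvec_zero d = tvec_zero d"
    proof (cases "d \<in> charts_at C (F (p, q))")
      case True
      show ?thesis unfolding tangent_map_slices(1)[OF A B C F True c'] tvec_zero_def
        using linear_0[OF has_derivative_linear[OF prod_rep_has_derivative(2)[OF A B C F c c' True]]]
        by (simp add: zero_prod_def)
    qed (simp add: tangent_map_def tvec_zero_def)
  qed
  show "tangent_map B C (\<lambda>y. F (p, y)) q tvec_zero = tvec_zero"
  proof
    fix d
    show "tangent_map B C (\<lambda>y. F (p, y)) q tvec_zero d = tvec_zero d"
    proof (cases "d \<in> charts_at C (F (p, q))")
      case True
      show ?thesis unfolding tangent_map_slices(2)[OF A B C F True c] tvec_zero_def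
        using linear_0[OF has_derivative_linear[OF prod_rep_has_derivative(2)[OF A B C F c c' True]]]
        by (simp add: zero_prod_def)
    qed (simp add: tangent_map_def tvec_zero_def)
  qed
qed

text \<open>
In a chart the derivative vanishes, so the curve is locally constant.
\<close>

lemma (in smooth_manifold) constant_of_zero_velocity:
  assumes J: "open J" "connected J" and k: "\<And>t. t \<in> J \<Longrightarrow> has_velocity A k t tvec_zero"
    and st: "s \<in> J" "t \<in> J"
  shows "k s = k t"
proof (rule connected_local_const[OF J(2) st], rule ballI)
  fix t assume t: "t \<in> J"
  define c where "c = chart_at A (k t)"
  have c: "c \<in> A" "k t \<in> chart_dom c"
    using chart_at_mem[of "k t"] by (simp_all add: c_def charts_at_def)
  have "isCont k t" using k[OF t] by (simp add: has_velocity_def)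
  then have "\<forall>\<^sub>F s in nhds t. s \<in> J \<and> k s \<in> chart_dom c"
    by (intro eventually_conj eventually_nhds_in_open J t isCont_eventually_mem open_chart_dom c)
  then obtain e where e: "e > 0" "\<And>s. dist s t < e \<Longrightarrow> s \<in> J \<and> k s \<in> chart_dom c"
    unfolding eventually_nhds_metric by blast
  have "((\<lambda>s. chart_map c (k s)) has_vector_derivative 0) (at s within ball t e)" if "s \<in> ball t e" for s
  proof -
    have s: "s \<in> J" "k s \<in> chart_dom c" using e(2)[of s] that by (simp_all add: dist_commute)
    have "((\<lambda>s. chart_map c (k s)) has_vector_derivative tvec_zero c) (at s)"
      by (rule has_velocity_component[OF k[OF s(1)]]) (simp add: charts_at_def c s)
    then show ?thesis by (simp add: tvec_zero_def has_vector_derivative_at_within)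
  qed
  from has_vector_derivative_zero_constant[OF convex_ball this]
  obtain y where y: "\<And>s. s \<in> ball t e \<Longrightarrow> chart_map c (k s) = y" by blast
  have "k t = k s" if "dist s t < e" for s
  proof -
    have "chart_map c (k s) = chart_map c (k t)" using y that e(1) by (simp add: dist_commute)
    then show ?thesis using chart_inv_map[OF c] chart_inv_map[OF c(1), of "k s"] e(2)[OF that] by metis
  qed
  then have "\<forall>\<^sub>F s in nhds t. k t = k s" unfolding eventually_nhds_metric using e(1) by blast
  then show "\<forall>\<^sub>F s in at t within J. k t = k s"
    by (auto simp: eventually_at_filter elim: eventually_mono)
qed

context lie_group
begin

lemma group_manifold: "smooth_manifold B" by (rule smooth_manifold_axioms)

lemma one_mul: "gmul gone g = g"
  by (rule group_left_neutral)

lemma has_velocity_mult: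
  assumes "has_velocity B k t v" "has_velocity B l t w"
  shows "has_velocity B (\<lambda>s. gmul (k s) (l s)) t
    (tvec_add (tangent_map B B (\<lambda>x. gmul x (l t)) (k t) v) (tangent_map B B (gmul (k t)) (l t) w))"
  using has_velocity_map2[OF group_manifold group_manifold group_manifold smooth_mult assms] by simp

lemma has_velocity_left_mult:
  assumes "has_velocity B l t w"
  shows "has_velocity B (\<lambda>s. gmul g (l s)) t (tangent_map B B (gmul g) (l t) w)"
  using has_velocity_mult[OF has_velocity_const assms, of g]
    tangent_map_slice_lincomb(2)[OF group_manifold group_manifold group_manifold smooth_mult, of "l t" g]
  by (simp add: tvec_add_def tvec_zero_def)

lemma has_velocity_right_mult:
  assumes "has_velocity B l t w"
  shows "has_velocity B (\<lambda>s. gmul (l s) g) t (tangent_map B B (\<lambda>x. gmul x g) (l t) w)"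
  using has_velocity_mult[OF assms has_velocity_const, of g]
    tangent_map_slice_lincomb(3)[OF group_manifold group_manifold group_manifold smooth_mult, of "l t" g]
  by (simp add: tvec_add_def tvec_zero_def)

lemma tangent_map_left_mult_mem:
  assumes "w \<in> tangent_space B h"
  shows "tangent_map B B (gmul g) h w \<in> tangent_space B (gmul g h)"
proof -
  obtain k where "k 0 = h" "has_velocity B k 0 w" by (rule exists_curve_with_velocity[OF assms])
  then show ?thesis using has_velocity_left_mult[of k 0 w g] by (simp add: has_velocity_def)
qed

lemma tangent_map_left_mult_inverse:
  assumes a: "a \<in> tangent_space B gone"
  shows "tangent_map B B (gmul (ginv g)) g (tangent_map B B (gmul g) gone a) = a"
proof -
  obtain k where k: "k 0 = gone" "has_velocity B k 0 a" by (rule exists_curve_with_velocity[OF a])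
  have "has_velocity B (\<lambda>s. gmul (ginv g) (gmul g (k s))) 0
     (tangent_map B B (gmul (ginv g)) (gmul g (k 0)) (tangent_map B B (gmul g) (k 0) a))"
    by (intro has_velocity_left_mult k)
  moreover have "gmul (ginv g) (gmul g h) = h" for h
    by (simp flip: assoc add: one_mul)
  ultimately have "has_velocity B k 0 (tangent_map B B (gmul (ginv g)) g (tangent_map B B (gmul g) gone a))"
    by (simp add: k(1))
  from has_velocity_unique[OF this k(2)] show ?thesis .
qed

text \<open>
The tangent map of the multiplication at the pair of identities is addition.
\<close>

lemma has_velocity_mult_at_one:
  assumes k: "has_velocity B k t v" "k t = gone" and l: "has_velocity B l t w" "l t = gone"
  shows "has_velocity B (\<lambda>s. gmul (k s) (l s)) t (tvec_add v w)"
proof -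
  have "has_velocity B k t (tangent_map B B (\<lambda>x. gmul x gone) gone v)"
    using has_velocity_right_mult[OF k(1), of gone] k(2) by simp
  then have 1: "tangent_map B B (\<lambda>x. gmul x gone) gone v = v"
    using has_velocity_unique k(1) by blast
  have "has_velocity B l t (tangent_map B B (gmul gone) gone w)"
    using has_velocity_left_mult[OF l(1), of gone] l(2) by (simp add: one_mul)
  then have 2: "tangent_map B B (gmul gone) gone w = w"
    using has_velocity_unique l(1) by blast
  show ?thesis using has_velocity_mult[OF k(1) l(1)] by (simp only: k(2) l(2) 1 2)
qed

text \<open>
Let \<open>b\<close> be the velocity of \<open>l\<inverse>\<close>. Since \<open>l l\<inverse>\<close> is constant, \<open>a + b = 0\<close>; and \<open>a + b\<close> is
also the velocity of \<open>k l\<inverse>\<close>.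
\<close>

lemma has_velocity_quotient_zero:
  assumes k: "has_velocity B k t a" "k t = gone" and l: "has_velocity B l t a" "l t = gone"
  shows "has_velocity B (\<lambda>s. gmul (k s) (ginv (l s))) t tvec_zero"
proof -
  have inv_one: "ginv gone = gone" using right_inverse[of gone] by (simp add: one_mul)
  define b where "b = tangent_map B B ginv (l t) a"
  have b: "has_velocity B (\<lambda>s. ginv (l s)) t b"
    unfolding b_def by (rule has_velocity_map[OF group_manifold group_manifold smooth_inv l(1)])
  have "has_velocity B (\<lambda>s. gmul (l s) (ginv (l s))) t (tvec_add a b)"
    by (rule has_velocity_mult_at_one[OF l b]) (simp add: l(2) inv_one)
  then have "has_velocity B (\<lambda>s. gone) t (tvec_add a b)" by simp
  then have ab: "tvec_add a b = tvec_zero" using has_velocity_unique has_velocity_const by blast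
  have "has_velocity B (\<lambda>s. gmul (k s) (ginv (l s))) t (tvec_add a b)"
    by (rule has_velocity_mult_at_one[OF k b]) (simp add: l(2) inv_one)
  then show ?thesis by (simp only: ab)
qed

text \<open>
The integral curves of the left-invariant field of \<open>a\<close>, with the condition translated to
the identity. In this form it is evidently stable under left translations and time
shifts, and a one-parameter subgroup with initial velocity \<open>a\<close> satisfies it at every time
because it does at time \<open>0\<close>.
\<close>

definition left_integral_curve :: "('g, 'h) tvec \<Rightarrow> (real \<Rightarrow> 'g) \<Rightarrow> real set \<Rightarrow> bool" where
  "left_integral_curve a k J \<longleftrightarrow> (\<forall>t\<in>J. has_velocity B (\<lambda>s. gmul (ginv (k t)) (k (t + s))) 0 a)"

text \<open>
With \<open>h = k l\<inverse>\<close> one has \<open>h(t + s) = k(t) q(s) l(t)\<inverse>\<close>, where \<open>q\<close> is the quotient of two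
curves through the identity with the same velocity \<open>a\<close>. So \<open>h\<close> has velocity zero
everywhere, and equals the identity at \<open>t0\<close>.
\<close>

lemma left_integral_curve_unique:
  assumes J: "open J" "connected J"
    and k: "left_integral_curve a k J" and l: "left_integral_curve a l J"
    and t0: "t0 \<in> J" "k t0 = l t0" and t: "t \<in> J"
  shows "k t = l t"
proof -
  define h where "h t = gmul (k t) (ginv (l t))" for t
  have cancel: "gmul (ginv g) (gmul g x) = x" "gmul g (gmul (ginv g) x) = x" for g x
    by (simp_all flip: assoc add: one_mul)
  have "has_velocity B h t tvec_zero" if t: "t \<in> J" for t
  proof -
    define q where "q s = gmul (gmul (ginv (k t)) (k (t + s))) (ginv (gmul (ginv (l t)) (l (t + s))))" for s
    have "has_velocity B q 0 tvec_zero" unfolding q_def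
      by (rule has_velocity_quotient_zero[where a = a]) (use k l t in \<open>simp_all add: left_integral_curve_def\<close>)
    from has_velocity_left_mult[OF has_velocity_right_mult[OF this], of "k t" "ginv (l t)"]
    have "has_velocity B (\<lambda>s. gmul (k t) (gmul (q s) (ginv (l t)))) 0 tvec_zero"
      using tangent_map_slice_lincomb(2,3)[OF group_manifold group_manifold group_manifold smooth_mult] by simp
    moreover have "gmul (k t) (gmul (q s) (ginv (l t))) = h (t + s)" for s
      by (simp add: q_def h_def inverse_distrib_swap assoc cancel)
    ultimately have "has_velocity B (\<lambda>s. h (t + s)) (1 * t + (- t)) tvec_zero" by simp
    from has_velocity_affine[OF this] show ?thesis by (simp add: tvec_scale_def tvec_zero_def)
  qed
  then have "h t = h t0" by (rule constant_of_zero_velocity[OF J _ t t0(1)])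
  also have "\<dots> = gone" by (simp add: h_def t0)
  finally have "gmul (h t) (l t) = l t" by (simp add: one_mul)
  then show ?thesis by (simp add: h_def assoc)
qed

end

section \<open>One-parameter subgroups and the exponential map\<close>

text \<open>
Homomorphisms from the interval \<open>(-e, e)\<close>: the law is required whenever both arguments and
their sum lie in the interval.
\<close>

definition local_hom :: "('g \<Rightarrow> 'g \<Rightarrow> 'g) \<Rightarrow> (real \<Rightarrow> 'g) \<Rightarrow> real \<Rightarrow> bool" where
  "local_hom m k e \<longleftrightarrow> (\<forall>s t. \<bar>s\<bar> < e \<longrightarrow> \<bar>t\<bar> < e \<longrightarrow> \<bar>s + t\<bar> < e \<longrightarrow> k (s + t) = m (k s) (k t))"

lemma local_homD: "local_hom m k e \<Longrightarrow> \<bar>s\<bar> < e \<Longrightarrow> \<bar>t\<bar> < e \<Longrightarrow> \<bar>s + t\<bar> < e \<Longrightarrow> k (s + t) = m (k s) (k t)"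
  by (simp add: local_hom_def)

text \<open>
The values \<open>k (s / 2)\<close> and \<open>k (t / 2)\<close> commute, since both of their products equal
\<open>k ((s + t) / 2)\<close>. Hence squaring at half the time is again a homomorphism.
\<close>

lemma (in semigroup) local_hom_doubling:
  assumes k: "local_hom f k e"
  shows "local_hom f (\<lambda>t. f (k (t / 2)) (k (t / 2))) (2 * e)"
    and "\<bar>t\<bar> < e \<Longrightarrow> f (k (t / 2)) (k (t / 2)) = k t"
proof -
  show "f (k (t / 2)) (k (t / 2)) = k t" if "\<bar>t\<bar> < e"
    using local_homD[OF k, of "t / 2" "t / 2"] that by simp
  show "local_hom f (\<lambda>t. f (k (t / 2)) (k (t / 2))) (2 * e)"
    unfolding local_hom_def
  proof (intro allI impI)
    fix s t assume st: "\<bar>s\<bar> < 2 * e" "\<bar>t\<bar> < 2 * e" "\<bar>s + t\<bar> < 2 * e"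
    let ?a = "k (s / 2)" and ?b = "k (t / 2)"
    have ab: "k ((s + t) / 2) = f ?a ?b"
      using local_homD[OF k, of "s / 2" "t / 2"] st by (simp add: add_divide_distrib)
    have "k ((t + s) / 2) = f ?b ?a"
      using local_homD[OF k, of "t / 2" "s / 2"] st by (simp add: add_divide_distrib)
    then have ba: "f ?b ?a = f ?a ?b" using ab by (simp add: add.commute)
    have "f (f ?a ?b) (f ?a ?b) = f ?a (f (f ?b ?a) ?b)" by (simp only: assoc)
    also have "\<dots> = f (f ?a ?a) (f ?b ?b)" unfolding ba by (simp only: assoc)
    finally show "f (k ((s + t) / 2)) (k ((s + t) / 2)) = f (f ?a ?a) (f ?b ?b)" unfolding ab .
  qed
qed

text \<open>
The successive doublings agree where both are homomorphisms, and their intervals exhaust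
the line.
\<close>

lemma (in semigroup) local_hom_extension:
  assumes e: "e > 0" and k: "local_hom f k e"
  obtains K where "\<And>s t. K (s + t) = f (K s) (K t)" "\<And>t. \<bar>t\<bar> < e \<Longrightarrow> K t = k t"
proof -
  define D where "D n = ((\<lambda>k t. f (k (t / 2)) (k (t / 2))) ^^ n) k" for n
  have D_Suc: "D (Suc n) = (\<lambda>t. f (D n (t / 2)) (D n (t / 2)))" for n by (simp add: D_def)
  have hom: "local_hom f (D n) (2 ^ n * e)" for n
  proof (induction n)
    case 0
    then show ?case using k by (simp add: D_def)
  next
    case (Suc n)
    then show ?case using local_hom_doubling(1)[OF Suc] by (simp add: D_Suc mult.assoc)
  qed
  have agree: "D (n + m) t = D n t" if t: "\<bar>t\<bar> < 2 ^ n * e" for n m t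
  proof (induction m)
    case (Suc m)
    have "2 ^ n * e \<le> 2 ^ (n + m) * e" using e by simp
    with t have "\<bar>t\<bar> < 2 ^ (n + m) * e" by linarith
    from local_hom_doubling(2)[OF hom this] have "D (Suc (n + m)) t = D (n + m) t" by (simp only: D_Suc)
    then show ?case using Suc by simp
  qed simp
  \<comment> \<open>Enough doublings to reach \<open>t\<close>, since \<open>n < 2 ^ n\<close>.\<close>
  define N where "N t = nat \<lceil>\<bar>t\<bar> / e\<rceil>" for t
  have N: "\<bar>t\<bar> < 2 ^ N t * e" for t
  proof -
    have "\<bar>t\<bar> / e \<le> of_nat (N t)" unfolding N_def by (rule real_nat_ceiling_ge)
    also have "of_nat (N t) < (2::real) ^ N t" by (rule of_nat_less_two_power)
    finally show ?thesis using e by (simp add: field_simps)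
  qed
  define K where "K t = D (N t) t" for t
  have K: "K t = D n t" if "\<bar>t\<bar> < 2 ^ n * e" for n t
    using agree[OF that, of "N t"] agree[OF N, of t n] by (simp add: K_def add.commute)
  show ?thesis
  proof (rule that[of K])
    show "K t = k t" if "\<bar>t\<bar> < e" for t using K[of t 0] that by (simp add: D_def)
    fix s t
    define n where "n = N s + (N t + N (s + t))"
    have n: "\<bar>x\<bar> < 2 ^ n * e" if "N x \<le> n" for x
    proof -
      have "2 ^ N x * e \<le> 2 ^ n * e" using e that by simp
      then show ?thesis using N[of x] by linarith
    qed
    have le: "N s \<le> n" "N t \<le> n" "N (s + t) \<le> n" by (simp_all add: n_def)
    show "K (s + t) = f (K s) (K t)"
      using local_homD[OF hom n[OF le(1)] n[OF le(2)] n[OF le(3)]]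
      by (simp only: K[OF n[OF le(1)]] K[OF n[OF le(2)]] K[OF n[OF le(3)]])
  qed
qed

lemma chart_inv_std [simp]: "chart_inv (UNIV, id) = id"
  by (simp add: chart_inv_def)

lemma smooth_map_from_real_iff:
  "smooth_map std_atlas B k \<longleftrightarrow>
    continuous_on UNIV k \<and> (\<forall>d\<in>B. smooth_on (\<lambda>t::real. chart_map d (k t)) (k -` chart_dom d))"
proof -
  have "(chart_map d \<circ> k) \<circ> chart_inv (UNIV, id) = (\<lambda>t. chart_map d (k t))" for d :: "('a, 'b) chart"
    by (simp add: fun_eq_iff)
  then show ?thesis unfolding smooth_map_def std_atlas_def by simp
qed

lemma (in smooth_manifold) smooth_curve_has_velocity:
  assumes "smooth_map std_atlas A k"
  shows "has_velocity A k t (velocity A k t)"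
proof (rule has_velocityI)
  show "isCont k t"
    using assms by (simp add: smooth_map_from_real_iff continuous_on_eq_continuous_at)
  fix c assume c: "c \<in> charts_at A (k t)"
  have "smooth_on (\<lambda>t. chart_map c (k t)) (k -` chart_dom c)"
    using assms c by (simp add: smooth_map_from_real_iff charts_at_def)
  from smooth_on_has_derivative[OF this]
  have "(\<lambda>t. chart_map c (k t)) differentiable (at t)"
    using c by (auto simp: charts_at_def differentiable_def)
  then show "((\<lambda>s. chart_map c (k s)) has_vector_derivative velocity A k t c) (at t)"
    using c by (simp add: velocity_def o_def vector_derivative_works)
qed (simp add: velocity_def)

lemma smooth_map_from_real_scale:
  fixes k :: "real \<Rightarrow> 'n::{t2_space, second_countable_topology}"
  assumes B: "smooth_manifold B" and "smooth_map std_atlas B k"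
  shows "smooth_map std_atlas B (\<lambda>s. k (r * s))"
  unfolding smooth_map_from_real_iff
proof (intro conjI ballI)
  have kc: "continuous_on UNIV k" using assms by (simp add: smooth_map_from_real_iff)
  show c: "continuous_on UNIV (\<lambda>s. k (r * s))"
    by (rule continuous_on_compose2[OF kc]) (auto intro: continuous_intros)
  fix d assume d: "d \<in> B"
  have k: "smooth_on (\<lambda>t. chart_map d (k t)) (k -` chart_dom d)"
    using assms d by (simp add: smooth_map_from_real_iff)
  have "open (chart_dom d)" by (rule smooth_manifold.open_chart_dom[OF B d])
  then have op: "open ((\<lambda>s. k (r * s)) -` chart_dom d)" using c by (rule open_vimage)
  have "smooth_on (\<lambda>s. r * s) ((\<lambda>s. k (r * s)) -` chart_dom d)"
    unfolding smooth_on_def by (intro allI ck_on_bounded_linear[OF op bounded_linear_mult_right])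
  with k show "smooth_on (\<lambda>t. chart_map d (k (r * t))) ((\<lambda>s. k (r * s)) -` chart_dom d)"
    by (rule smooth_on_compose[OF fin_dim_real op, rotated]) auto
qed

context lie_group
begin

text \<open>
In the chart at the identity the left-invariant field of \<open>a\<close> is the partial derivative
\<open>F(y) = D\<^sub>2 m(y, z\<^sub>0) a\<close> of the multiplication, where \<open>z\<^sub>0\<close> represents the identity. The coordinate
curve \<open>u\<close> is kept in the conclusion because its smoothness yields that of the curve.
\<close>

lemma exists_left_integral_curve:
  assumes a: "a \<in> tangent_space B gone"
  obtains e k u where "e > 0" "k 0 = gone"
    "\<And>t. \<bar>t\<bar> < e \<Longrightarrow> k t = chart_inv (chart_at B gone) (u t) \<and> u t \<in> chart_image (chart_at B gone)"
    "smooth_on u {-e<..<e}" "left_integral_curve a k {-e<..<e}"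
proof -
  define c where "c = chart_at B gone"
  have c: "c \<in> charts_at B gone" unfolding c_def by (rule chart_at_mem)
  note cD = charts_atD[OF c]
  define m where "m = (\<lambda>(g, h). gmul g h)"
  note sm = smooth_mult[folded m_def]
  let ?U = "prod_rep_dom c c c m" and ?P = "prod_rep c c c m"
  define F where "F y = frechet_derivative ?P (at (y, chart_map c gone)) (0, a c)" for y
  have U: "open ?U" "smooth_on ?P ?U" by (rule prod_rep_open_smooth[OF group_manifold group_manifold group_manifold sm cD(1) cD(1) cD(1)])+
  have F: "smooth_on F (chart_image c)" unfolding F_def
  proof (rule smooth_on_compose[OF fin_dim_prod[OF fin_dim_model fin_dim_model], where T = ?U])
    show "open (chart_image c)" by (rule open_chart_image[OF cD(1)])
    show "(\<lambda>y. (y, chart_map c gone)) ` chart_image c \<subseteq> ?U"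
      by (auto simp: prod_rep_dom_def chart_map_mem[OF cD(2)] chart_inv_map[OF cD] m_def chart_inv_mem[OF cD(1)])
    show "smooth_on (\<lambda>p. frechet_derivative ?P (at p) (0, a c)) ?U"
      by (rule smooth_on_directional_derivative[OF U(2)])
    show "smooth_on (\<lambda>y. (y, chart_map c gone)) (chart_image c)"
      by (intro smooth_on_Pair smooth_on_ident smooth_on_const open_chart_image cD)
  qed
  obtain e u where e: "e > 0" and u: "u 0 = chart_map c gone" "smooth_on u {-e<..<e}"
    "\<And>t. t \<in> {-e<..<e} \<Longrightarrow> u t \<in> chart_image c \<and> (u has_vector_derivative F (u t)) (at t)"
    by (rule smooth_ode_local_solution[OF fin_dim_model open_chart_image[OF cD(1)] chart_map_mem[OF cD(2)] F])
      (assumption | rule that)+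
  define k where "k t = chart_inv c (u t)" for t
  have "left_integral_curve a k {-e<..<e}"
    unfolding left_integral_curve_def
  proof
    fix t assume t: "t \<in> {-e<..<e}"
    have kt: "k t \<in> chart_dom c" "chart_map c (k t) = u t"
      unfolding k_def using u(3)[OF t] chart_inv_mem[OF cD(1)] chart_map_inv[OF cD(1)] by auto
    have ct: "c \<in> charts_at B (k t)" by (rule charts_atI[OF cD(1) kt(1)])
    have uc: "isCont u t" using u(3)[OF t] has_vector_derivative_continuous by blast
    have kc: "isCont k t" unfolding k_def
      by (rule isCont_o2[OF uc isCont_chart_inv[OF cD(1)]]) (use u(3)[OF t] in simp)
    have ev: "\<forall>\<^sub>F s in nhds t. s \<in> {-e<..<e}" by (rule eventually_nhds_in_open) (use t in auto)
    have "\<forall>\<^sub>F s in nhds t. u s = chart_map c (k s)"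
      using ev by eventually_elim (use u(3) chart_map_inv[OF cD(1)] in \<open>simp add: k_def\<close>)
    from has_vector_derivative_eventually_eq[OF conjunct2[OF u(3)[OF t]] this]
    have "has_velocity B k t (coord_vec B c (k t) (F (u t)))"
      by (rule has_velocity_chartI[OF ct kc])
    also have "coord_vec B c (k t) (F (u t)) = tangent_map B B (gmul (k t)) gone a"
    proof (rule tangent_space_eqI[OF ct coord_vec_mem_tangent_space[OF ct]])
      show "tangent_map B B (gmul (k t)) gone a \<in> tangent_space B (k t)"
        using tangent_map_left_mult_mem[OF a, of "k t"] by simp
      have "c \<in> charts_at B (m (k t, gone))" using ct by (simp add: m_def)
      from tangent_map_slices(2)[OF group_manifold group_manifold group_manifold sm this ct, of a]
      show "coord_vec B c (k t) (F (u t)) c = tangent_map B B (gmul (k t)) gone a c"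
        unfolding coord_vec_self[OF ct] F_def kt(2) c_def[symmetric] by (simp add: m_def)
    qed
    finally have "has_velocity B k t (tangent_map B B (gmul (k t)) gone a)" .
    from has_velocity_left_mult[OF this, of "ginv (k t)"]
    have "has_velocity B (\<lambda>s. gmul (ginv (k t)) (k s)) (1 * 0 + t) a"
      by (simp add: tangent_map_left_mult_inverse[OF a])
    from has_velocity_affine[OF this] show "has_velocity B (\<lambda>s. gmul (ginv (k t)) (k (t + s))) 0 a"
      by (simp add: tvec_scale_def add.commute)
  qed
  moreover have "k 0 = gone" using u(1) chart_inv_map[OF cD] by (simp add: k_def)
  ultimately show ?thesis
    using that[of e k u] e u unfolding k_def c_def by (simp add: abs_less_iff)
qed

lemma inv_one: "ginv gone = gone"
  using right_inverse[of gone] by (simp add: one_mul)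

text \<open>
For fixed \<open>s\<close> both \<open>t \<mapsto> k(s + t)\<close> and \<open>t \<mapsto> k(s) k(t)\<close> are integral curves starting at
\<open>k(s)\<close>.
\<close>

lemma local_hom_of_left_integral_curve:
  assumes e: "e > 0" and k: "k 0 = gone" "left_integral_curve a k {-e<..<e}"
  shows "local_hom gmul k e"
  unfolding local_hom_def
proof (intro allI impI)
  fix s t assume st: "\<bar>s\<bar> < e" "\<bar>t\<bar> < e" "\<bar>s + t\<bar> < e"
  have kD: "has_velocity B (\<lambda>x. gmul (ginv (k t)) (k (t + x))) 0 a" if "\<bar>t\<bar> < e" for t
  proof -
    have "t \<in> {-e<..<e}" using that by auto
    with k(2) show ?thesis unfolding left_integral_curve_def by (rule bspec)
  qed
  \<comment> \<open>The times \<open>t\<close> at which both curves are defined; an interval, hence connected.\<close>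
  define J where "J = {max (- e) (- e - s)<..<min e (e - s)}"
  have J: "t \<in> J \<longleftrightarrow> \<bar>t\<bar> < e \<and> \<bar>s + t\<bar> < e" for t by (auto simp: J_def)
  show "k (s + t) = gmul (k s) (k t)"
  proof (rule left_integral_curve_unique[of J a "\<lambda>t. k (s + t)" "\<lambda>t. gmul (k s) (k t)" 0])
    show "open J" "connected J" by (simp_all add: J_def)
    show "left_integral_curve a (\<lambda>t. k (s + t)) J"
      unfolding left_integral_curve_def
    proof
      fix t assume "t \<in> J"
      then show "has_velocity B (\<lambda>x. gmul (ginv (k (s + t))) (k (s + (t + x)))) 0 a"
        using kD[of "s + t"] by (simp add: J add.assoc)
    qed
    have "gmul (ginv (gmul g h)) (gmul g x) = gmul (ginv h) x" for g h x
    proof -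
      have "gmul (ginv g) (gmul g x) = x" by (simp flip: assoc add: one_mul)
      then show ?thesis by (simp add: inverse_distrib_swap assoc)
    qed
    then show "left_integral_curve a (\<lambda>t. gmul (k s) (k t)) J"
      unfolding left_integral_curve_def using kD by (simp add: J)
    show "0 \<in> J" "t \<in> J" using st e by (simp_all add: J)
    show "k (s + 0) = gmul (k s) (k 0)" by (simp add: k(1))
  qed
qed

text \<open>
The extended homomorphism \<open>K\<close> agrees near \<open>0\<close> with the smooth curve \<open>k\<close>. Near \<open>t\<^sub>0\<close> it equals
\<open>K(t\<^sub>0) k(t - t\<^sub>0)\<close>, so it is smooth everywhere.
\<close>

lemma exists_one_parameter_subgroup:
  assumes a: "a \<in> tangent_space B gone"
  obtains K where "one_parameter_subgroup B gmul K" "has_velocity B K 0 a"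
proof -
  define c where "c = chart_at B gone"
  have c: "c \<in> charts_at B gone" unfolding c_def by (rule chart_at_mem)
  obtain e k u where e: "e > 0" and k: "k 0 = gone" "left_integral_curve a k {-e<..<e}"
    and u: "\<And>t. \<bar>t\<bar> < e \<Longrightarrow> k t = chart_inv c (u t) \<and> u t \<in> chart_image c" "smooth_on u {-e<..<e}"
    by (rule exists_left_integral_curve[OF a, folded c_def]) (rule that, assumption+)
  obtain K where K: "\<And>s t. K (s + t) = gmul (K s) (K t)" "\<And>t. \<bar>t\<bar> < e \<Longrightarrow> K t = k t"
    by (rule local_hom_extension[OF e local_hom_of_left_integral_curve[OF e k]]) (rule that)
  have "0 \<in> {-e<..<e}" using e by simp
  with k(2) have "has_velocity B (\<lambda>s. gmul (ginv (k 0)) (k (0 + s))) 0 a"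
    unfolding left_integral_curve_def by (rule bspec)
  then have k_vel: "has_velocity B k 0 a" by (simp add: k(1) inv_one one_mul)
  have "\<forall>\<^sub>F s in nhds 0. s \<in> {-e<..<e}" by (rule eventually_nhds_in_open) (use e in auto)
  then have "\<forall>\<^sub>F s in nhds 0. k s = K s" by eventually_elim (simp add: K(2) abs_less_iff)
  from has_velocity_cong[OF k_vel this] have K_vel: "has_velocity B K 0 a" .
  have K_cont: "isCont K t" for t
  proof -
    have "has_velocity B (\<lambda>s. K (t + s)) (1 * t + (- t)) (tangent_map B B (gmul (K t)) (K 0) a)"
      using has_velocity_left_mult[OF K_vel, of "K t"] by (simp add: K(1))
    from has_velocity_affine[OF this] show ?thesis by (simp add: has_velocity_def)
  qed
  have "smooth_on (\<lambda>t. chart_map d (K t)) (K -` chart_dom d)" if d: "d \<in> B" for d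
  proof (rule smooth_on_local)
    fix t0 assume "t0 \<in> K -` chart_dom d"
    then have t0: "d \<in> charts_at B (K t0)" using d by (simp add: charts_at_def)
    define m where "m = (\<lambda>(g, h). gmul g h)"
    note sm = prod_rep_open_smooth[OF group_manifold group_manifold group_manifold smooth_mult[folded m_def] d charts_atD(1)[OF c] d]
    define f where "f t = (chart_map d (K t0), u (t - t0))" for t
    let ?I = "ball t0 e"
    have ne: "\<bar>t - t0\<bar> < e" if "t \<in> ?I" for t using that by (simp add: dist_real_def abs_minus_commute)
    have f: "smooth_on f ?I" unfolding f_def
    proof (intro smooth_on_Pair smooth_on_const)
      have "smooth_on (\<lambda>t. t + (- t0)) ?I"
        unfolding smooth_on_def by (intro allI ck_on_add ck_on_ident ck_on_const) simp_all
      moreover have "(\<lambda>t. t - t0) ` ?I \<subseteq> {-e<..<e}"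
        by (auto simp: dist_real_def)
      ultimately show "smooth_on (\<lambda>t. u (t - t0)) ?I"
        by (intro smooth_on_compose[OF fin_dim_real _ _ u(2), where f = "\<lambda>t. t - t0"]) simp_all
    qed simp
    define T where "T = ?I \<inter> f -` prod_rep_dom d c d m"
    have "continuous_on ?I f" using f unfolding smooth_on_def by (metis ck_on.simps(1))
    then have T: "open T" unfolding T_def by (intro continuous_open_preimage sm) simp_all
    have Kt0: "chart_inv d (chart_map d (K t0)) = K t0" using chart_inv_map charts_atD[OF t0] by blast
    have "u 0 \<in> chart_image c" "chart_inv c (u 0) = gone" using u(1)[of 0] e k(1) by simp_all
    moreover have "gmul (K t0) gone = K t0" by simp
    ultimately have "t0 \<in> T" using e t0
      by (simp add: T_def f_def prod_rep_dom_def m_def Kt0 charts_at_def chart_map_mem)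
    moreover have "smooth_on (\<lambda>t. chart_map d (K t)) T"
    proof (rule smooth_on_cong[OF T])
      show "smooth_on (\<lambda>t. prod_rep d c d m (f t)) T"
      proof (rule smooth_on_compose[OF fin_dim_prod[OF fin_dim_model fin_dim_model] T _ sm(2)])
        show "smooth_on f T" using f unfolding smooth_on_def T_def by (blast intro: ck_on_subset)
      qed (auto simp: T_def)
      fix t assume t: "t \<in> T"
      have lt: "\<bar>t - t0\<bar> < e" using t ne by (simp add: T_def)
      then have "gmul (K t0) (chart_inv c (u (t - t0))) = gmul (K t0) (K (t - t0))"
        using u(1) K(2) by simp
      also have "\<dots> = K t" using K(1)[of t0 "t - t0"] by simp
      finally show "prod_rep d c d m (f t) = chart_map d (K t)"
        by (simp add: prod_rep_def f_def m_def Kt0)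
    qed
    ultimately show "\<exists>T. open T \<and> t0 \<in> T \<and> smooth_on (\<lambda>t. chart_map d (K t)) T" using T by blast
  qed
  then have "smooth_map std_atlas B K"
    using K_cont by (simp add: smooth_map_from_real_iff continuous_on_eq_continuous_at)
  then show ?thesis using that[of K] K(1) K_vel by (simp add: one_parameter_subgroup_def)
qed

lemma one_parameter_subgroup_zero:
  assumes "one_parameter_subgroup B gmul K"
  shows "K 0 = gone"
proof -
  have "gmul (K 0) (K 0) = gmul (K 0) gone"
    using assms unfolding one_parameter_subgroup_def by (metis add.right_neutral right_neutral)
  then show ?thesis by (simp only: left_cancel)
qed

lemma one_parameter_subgroup_unique:
  assumes K: "one_parameter_subgroup B gmul K" "velocity B K 0 = a"
    and L: "one_parameter_subgroup B gmul L" "velocity B L 0 = a"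
  shows "K = L"
proof
  fix t
  have int: "left_integral_curve a K UNIV" if K: "one_parameter_subgroup B gmul K" "velocity B K 0 = a" for K
    unfolding left_integral_curve_def
  proof
    fix t
    have "gmul (ginv (K t)) (K (t + s)) = K s" for s
      using K(1) by (simp add: one_parameter_subgroup_def one_mul flip: assoc)
    moreover have "has_velocity B K 0 a"
      using smooth_curve_has_velocity[of K 0] K by (simp add: one_parameter_subgroup_def)
    ultimately show "has_velocity B (\<lambda>s. gmul (ginv (K t)) (K (t + s))) 0 a" by simp
  qed
  show "K t = L t"
    by (rule left_integral_curve_unique[OF _ _ int[OF K] int[OF L], of 0])
      (simp_all add: one_parameter_subgroup_zero K L)
qed

text \<open>
Running the subgroup of \<open>a\<close> at speed \<open>t\<close> gives the subgroup of \<open>t a\<close>, so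
\<open>exp (t a) = K(t)\<close>. Hence \<open>t \<mapsto> exp (t a)\<close> has velocity \<open>a\<close> at \<open>0\<close>.
\<close>

lemma lie_exp_scale:
  assumes K: "one_parameter_subgroup B gmul K" "has_velocity B K 0 a"
  shows "lie_exp B gmul (tvec_scale t a) = K t"
proof -
  define L where "L = (\<lambda>s. K (t * s))"
  have "one_parameter_subgroup B gmul L"
    using K(1) smooth_map_from_real_scale[OF group_manifold, of K t]
    by (simp add: one_parameter_subgroup_def L_def distrib_left)
  moreover have "velocity B L 0 = tvec_scale t a"
    using has_velocity_affine[of K t 0 0 a] K(2) unfolding L_def by (intro velocity_eq) simp
  ultimately have "(THE \<gamma>. one_parameter_subgroup B gmul \<gamma> \<and> velocity B \<gamma> 0 = tvec_scale t a) = L"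
    using one_parameter_subgroup_unique by (intro the_equality) blast+
  then show ?thesis by (simp add: lie_exp_def L_def)
qed

end

section \<open>Second-order expansion of a local action\<close>

lemma has_derivative_eventually_eq:
  assumes "(f has_derivative f') (at x)" "\<forall>\<^sub>F y in nhds x. f y = g y"
  shows "(g has_derivative f') (at x)"
proof (rule has_derivative_transform_eventually[OF assms(1)])
  show "\<forall>\<^sub>F y in at x. f y = g y" using assms(2) by (simp add: eventually_nhds_conv_at)
  show "f x = g x" by (rule eventually_nhds_x_imp_x[OF assms(2)])
qed simp

text \<open>
Here \<open>\<Phi>\<close> and \<open>m\<close> are an action and a multiplication in coordinates, with identity \<open>z0\<close>, and
\<open>X\<^sub>a(x) = D\<^sub>1 \<Phi>(z0, x) a\<close> is the generator. The derivative in \<open>w\<close> of the action law at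
\<open>w = z0\<close> in direction \<open>b\<close> is
\<open>D\<^sub>1 \<Phi>(z, y) (N z) = D\<^sub>2 \<Phi>(z, y) (X\<^sub>b y)\<close> with \<open>N z = D\<^sub>2 m(z, z0) b\<close>. The derivative of this
in \<open>z\<close> in direction \<open>a\<close> has on its right-hand side a mixed second derivative of \<open>\<Phi>\<close>; by
symmetry it is the derivative of \<open>X\<^sub>a\<close> in direction \<open>X\<^sub>b(y)\<close>. The action law is required
only at the fixed point \<open>y\<close>, and for \<open>w\<close> in a neighbourhood that may depend on \<open>z\<close>.
\<close>

lemma local_action_second_order:
  fixes \<Phi> :: "'h::real_inner \<times> 'e::real_inner \<Rightarrow> 'e" and m :: "'h \<times> 'h \<Rightarrow> 'h"
  assumes fin: "fin_dim TYPE('h)" "fin_dim TYPE('e)"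
    and U: "open U" "smooth_on \<Phi> U" "(z0, y) \<in> U"
    and V: "open V" "smooth_on m V" "(z0, z0) \<in> V"
    and m_right: "\<forall>\<^sub>F z in nhds z0. m (z, z0) = z" and m_left: "\<forall>\<^sub>F w in nhds z0. m (z0, w) = w"
    and \<Phi>_one: "\<Phi> (z0, y) = y"
    and action: "\<forall>\<^sub>F z in nhds z0. \<forall>\<^sub>F w in nhds z0. \<Phi> (m (z, w), y) = \<Phi> (z, \<Phi> (w, y))"
  shows "second_derivative \<Phi> (z0, y) (a, 0) (b, 0) +
      frechet_derivative \<Phi> (at (z0, y)) (frechet_derivative (\<lambda>z. frechet_derivative m (at (z, z0)) (0, b)) (at z0) a, 0) =
    frechet_derivative (\<lambda>x. frechet_derivative \<Phi> (at (z0, x)) (a, 0)) (at y)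
      (frechet_derivative \<Phi> (at (z0, y)) (b, 0))"
proof -
  let ?D = "\<lambda>p. frechet_derivative \<Phi> (at p)"
  define N where "N z = frechet_derivative m (at (z, z0)) (0, b)" for z
  define X where "X = ?D (z0, y) (b, 0)"
  have U2: "ck_on (Suc (Suc 0)) \<Phi> U" and V2: "ck_on (Suc (Suc 0)) m V"
    using U(2) V(2) unfolding smooth_on_def by blast+
  have D: "(\<Phi> has_derivative ?D p) (at p)" if "p \<in> U" for p
    by (rule ck_on_SucD_has_derivative[OF U2 that])
  have Dm: "(m has_derivative frechet_derivative m (at p)) (at p)" if "p \<in> V" for p
    by (rule ck_on_SucD_has_derivative[OF V2 that])
  have pair_left: "((\<lambda>z. (z, q)) has_derivative (\<lambda>u. (u, 0))) (at z)"
    for z :: 'h and q :: "'c::real_normed_vector"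
    by (auto intro!: derivative_eq_intros)
  have pair_right: "((\<lambda>w. (q, w)) has_derivative (\<lambda>u. (0, u))) (at z)"
    for z :: "'b::real_normed_vector" and q :: 'h
    by (auto intro!: derivative_eq_intros)
  have N_o: "N z0 = b"
  proof -
    have "((\<lambda>w. m (z0, w)) has_derivative (\<lambda>u. frechet_derivative m (at (z0, z0)) (0, u))) (at z0)"
      by (rule has_derivative_compose[OF pair_right Dm[OF V(3)]])
    moreover have "((\<lambda>w. m (z0, w)) has_derivative (\<lambda>u. u)) (at z0)"
      by (rule has_derivative_eventually_eq[OF has_derivative_ident])
        (use m_left in \<open>eventually_elim, simp\<close>)
    ultimately have "(\<lambda>u. frechet_derivative m (at (z0, z0)) (0, u)) = (\<lambda>u. u)" by (rule has_derivative_unique)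
    from fun_cong[OF this, of b] show ?thesis by (simp add: N_def)
  qed
  have in_U: "\<forall>\<^sub>F z in nhds z0. (z, y) \<in> U"
    by (rule isCont_eventually_mem[OF has_derivative_continuous[OF pair_left] U(1,3)])
  have in_V: "\<forall>\<^sub>F z in nhds z0. (z, z0) \<in> V"
    by (rule isCont_eventually_mem[OF has_derivative_continuous[OF pair_left] V(1,3)])
  have ev: "\<forall>\<^sub>F z in nhds z0. ?D (z, y) (N z, 0) = ?D (z, y) (0, X)"
    using in_U in_V m_right action
  proof eventually_elim
    case (elim z)
    have "((\<lambda>w. m (z, w)) has_derivative (\<lambda>u. frechet_derivative m (at (z, z0)) (0, u))) (at z0)"
      by (rule has_derivative_compose[OF pair_right Dm[OF elim(2)]])
    from has_derivative_compose[OF this pair_left]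
    have "((\<lambda>w. (m (z, w), y)) has_derivative (\<lambda>u. (frechet_derivative m (at (z, z0)) (0, u), 0))) (at z0)" .
    from has_derivative_compose[OF this, of \<Phi>] D[OF elim(1)] elim(3)
    have 1: "((\<lambda>w. \<Phi> (m (z, w), y)) has_derivative (\<lambda>u. ?D (z, y) (frechet_derivative m (at (z, z0)) (0, u), 0))) (at z0)"
      by simp
    have "((\<lambda>w. \<Phi> (w, y)) has_derivative (\<lambda>u. ?D (z0, y) (u, 0))) (at z0)"
      by (rule has_derivative_compose[OF pair_left D[OF U(3)]])
    from has_derivative_compose[OF this pair_right]
    have "((\<lambda>w. (z, \<Phi> (w, y))) has_derivative (\<lambda>u. (0, ?D (z0, y) (u, 0)))) (at z0)" .
    from has_derivative_compose[OF this, of \<Phi>] D[OF elim(1)]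
    have "((\<lambda>w. \<Phi> (z, \<Phi> (w, y))) has_derivative (\<lambda>u. ?D (z, y) (0, ?D (z0, y) (u, 0)))) (at z0)"
      by (simp add: \<Phi>_one)
    moreover have "\<forall>\<^sub>F w in nhds z0. \<Phi> (z, \<Phi> (w, y)) = \<Phi> (m (z, w), y)"
      using elim(4) by eventually_elim simp
    ultimately have "((\<lambda>w. \<Phi> (m (z, w), y)) has_derivative (\<lambda>u. ?D (z, y) (0, ?D (z0, y) (u, 0)))) (at z0)"
      by (rule has_derivative_eventually_eq)
    from fun_cong[OF has_derivative_unique[OF 1 this], of b] show ?case by (simp add: N_def X_def)
  qed
  have deriv_left: "((\<lambda>z. ?D (z, y) (N z, 0)) has_derivative
      (\<lambda>u. second_derivative \<Phi> (z0, y) (u, 0) (N z0, 0) + ?D (z0, y) (frechet_derivative N (at z0) u, 0))) (at z0)"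
  proof (rule has_derivative_linear_family[where S = "(\<lambda>z. (z, y)) -` U" and W = "\<lambda>z. ?D (z, y)"
        and N = "\<lambda>z. (N z, 0)" and W' = "\<lambda>u. second_derivative \<Phi> (z0, y) (u, 0)"
        and N' = "\<lambda>u. (frechet_derivative N (at z0) u, 0)"])
    show "fin_dim TYPE('h \<times> 'e)" by (rule fin_dim_prod[OF fin])
    show "open ((\<lambda>z. (z, y)) -` U)" by (rule open_vimage[OF U(1)]) (intro continuous_intros)
    show "z0 \<in> (\<lambda>z. (z, y)) -` U" using U(3) by simp
    show "linear (?D (z, y))" if "z \<in> (\<lambda>z. (z, y)) -` U" for z
      by (rule has_derivative_linear[OF D]) (use that in simp)
    show "((\<lambda>z. ?D (z, y) v) has_derivative (\<lambda>u. second_derivative \<Phi> (z0, y) (u, 0) v)) (at z0)" for v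
      by (rule has_derivative_compose[OF pair_left has_derivative_first_derivative[OF U2 U(3)]])
    have "(N has_derivative (\<lambda>u. second_derivative m (z0, z0) (u, 0) (0, b))) (at z0)"
      unfolding N_def by (rule has_derivative_compose[OF pair_left has_derivative_first_derivative[OF V2 V(3)]])
    then have "(N has_derivative frechet_derivative N (at z0)) (at z0)"
      using frechet_derivative_eq by metis
    from has_derivative_compose[OF this pair_left]
    show "((\<lambda>z. (N z, 0)) has_derivative (\<lambda>u. (frechet_derivative N (at z0) u, 0))) (at z0)" .
  qed
  have deriv_right: "((\<lambda>z. ?D (z, y) (0, X)) has_derivative (\<lambda>u. second_derivative \<Phi> (z0, y) (u, 0) (0, X))) (at z0)"
    by (rule has_derivative_compose[OF pair_left has_derivative_first_derivative[OF U2 U(3)]])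
  have "(\<lambda>u. second_derivative \<Phi> (z0, y) (u, 0) (N z0, 0) + ?D (z0, y) (frechet_derivative N (at z0) u, 0)) =
      (\<lambda>u. second_derivative \<Phi> (z0, y) (u, 0) (0, X))"
    by (rule has_derivative_unique[OF has_derivative_eventually_eq[OF deriv_left ev] deriv_right])
  from fun_cong[OF this, of a]
  have "second_derivative \<Phi> (z0, y) (a, 0) (b, 0) + ?D (z0, y) (frechet_derivative N (at z0) a, 0) =
      second_derivative \<Phi> (z0, y) (a, 0) (0, X)"
    by (simp only: N_o)
  also have "\<dots> = second_derivative \<Phi> (z0, y) (0, X) (a, 0)"
    by (rule second_derivative_symmetric[OF _ U(1,3)]) (use U2 in \<open>simp only: numeral_2_eq_2\<close>)
  also have "\<dots> = frechet_derivative (\<lambda>x. ?D (z0, x) (a, 0)) (at y) X"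
  proof -
    have "((\<lambda>x. ?D (z0, x) (a, 0)) has_derivative (\<lambda>u. second_derivative \<Phi> (z0, y) (0, u) (a, 0))) (at y)"
      by (rule has_derivative_compose[OF pair_right has_derivative_first_derivative[OF U2 U(3)]])
    from frechet_derivative_eq[OF this] show ?thesis by simp
  qed
  finally show ?thesis unfolding N_def X_def .
qed

section \<open>Brackets of vector fields and the Lie bracket\<close>

text \<open>
Differentiating the transformation law of a vector field under a coordinate change \<open>f\<close>
produces, besides the expected term, the second derivative of \<open>f\<close> at the two fields. It
is symmetric, so it cancels in the bracket.
\<close>

lemma (in smooth_manifold) vector_field_bracket_mem_tangent_space:
  assumes X: "\<And>q. X q \<in> tangent_space A q" and Y: "\<And>q. Y q \<in> tangent_space A q"
    and X_diff: "\<And>c. c \<in> charts_at A p \<Longrightarrow> (\<lambda>y. X (chart_inv c y) c) differentiable (at (chart_map c p))"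
    and Y_diff: "\<And>c. c \<in> charts_at A p \<Longrightarrow> (\<lambda>y. Y (chart_inv c y) c) differentiable (at (chart_map c p))"
  shows "vector_field_bracket A X Y p \<in> tangent_space A p"
proof (rule tangent_spaceI)
  fix c d assume c: "c \<in> charts_at A p" and d: "d \<in> charts_at A p"
  note cD = charts_atD[OF c] and dD = charts_atD[OF d]
  define y0 where "y0 = chart_map c p"
  define f where "f = chart_map d \<circ> chart_inv c"
  let ?D = "\<lambda>y. frechet_derivative f (at y)"
  define S where "S = {y \<in> chart_image c. chart_inv c y \<in> chart_dom d}"
  have S: "open S" "smooth_on f S" unfolding S_def f_def by (rule transition_smooth[OF cD(1) dD(1)])+
  have y0: "y0 \<in> S" "chart_inv c y0 = p" using c d
    by (simp_all add: S_def y0_def chart_map_mem cD chart_inv_map dD)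
  have fy0: "f y0 = chart_map d p" by (simp add: f_def y0)
  have f2: "ck_on (Suc (Suc 0)) f S" using S(2) unfolding smooth_on_def by blast
  have D: "(f has_derivative ?D y) (at y)" if "y \<in> S" for y by (rule ck_on_SucD_has_derivative[OF f2 that])
  have *: "frechet_derivative (\<lambda>z. Z (chart_inv d z) d) (at (chart_map d p)) (?D y0 w) =
      second_derivative f y0 w (Z p c) + ?D y0 (frechet_derivative (\<lambda>z. Z (chart_inv c z) c) (at y0) w)"
    if Z: "\<And>q. Z q \<in> tangent_space A q"
      and Z_diff: "\<And>c. c \<in> charts_at A p \<Longrightarrow> (\<lambda>y. Z (chart_inv c y) c) differentiable (at (chart_map c p))"
    for Z w
  proof -
    have eq: "Z (chart_inv d (f z)) d = ?D z (Z (chart_inv c z) c)" if "z \<in> S" for z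
    proof -
      have "c \<in> charts_at A (chart_inv c z)" "d \<in> charts_at A (chart_inv c z)"
        using that cD dD by (simp_all add: S_def charts_at_def chart_inv_mem)
      from tangent_space_transition[OF Z this] that
      show ?thesis by (simp add: f_def S_def chart_inv_map[OF dD(1)] chart_map_inv[OF cD(1)])
    qed
    have Zc: "((\<lambda>z. Z (chart_inv c z) c) has_derivative frechet_derivative (\<lambda>z. Z (chart_inv c z) c) (at y0)) (at y0)"
      using Z_diff[OF c] by (simp add: frechet_derivative_works y0_def)
    have Zd: "((\<lambda>z. Z (chart_inv d z) d) has_derivative frechet_derivative (\<lambda>z. Z (chart_inv d z) d) (at (chart_map d p))) (at (f y0))"
      using Z_diff[OF d] by (simp add: frechet_derivative_works fy0)
    have "((\<lambda>z. ?D z (Z (chart_inv c z) c)) has_derivative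
        (\<lambda>w. second_derivative f y0 w (Z (chart_inv c y0) c) + ?D y0 (frechet_derivative (\<lambda>z. Z (chart_inv c z) c) (at y0) w))) (at y0)"
      by (rule has_derivative_linear_family[OF fin_dim_model S(1) y0(1) has_derivative_linear[OF D]
            has_derivative_first_derivative[OF f2 y0(1)] Zc])
    moreover have "((\<lambda>z. ?D z (Z (chart_inv c z) c)) has_derivative
        (\<lambda>w. frechet_derivative (\<lambda>z. Z (chart_inv d z) d) (at (chart_map d p)) (?D y0 w))) (at y0)"
      by (rule has_derivative_transform_within_open[OF has_derivative_compose[OF D[OF y0(1)] Zd] S(1) y0(1) eq])
    ultimately have "(\<lambda>w. second_derivative f y0 w (Z (chart_inv c y0) c) + ?D y0 (frechet_derivative (\<lambda>z. Z (chart_inv c z) c) (at y0) w)) =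
        (\<lambda>w. frechet_derivative (\<lambda>z. Z (chart_inv d z) d) (at (chart_map d p)) (?D y0 w))"
      by (rule has_derivative_unique)
    from fun_cong[OF this, of w] show ?thesis by (simp add: y0(2))
  qed
  have Xd: "X p d = ?D y0 (X p c)" and Yd: "Y p d = ?D y0 (Y p c)"
    unfolding f_def y0_def by (rule tangent_space_transition[OF X c d] tangent_space_transition[OF Y c d])+
  have sym: "second_derivative f y0 (X p c) (Y p c) = second_derivative f y0 (Y p c) (X p c)"
    by (rule second_derivative_symmetric[OF _ S(1) y0(1)]) (use f2 in \<open>simp only: numeral_2_eq_2\<close>)
  have "vector_field_bracket A X Y p d =
      frechet_derivative (\<lambda>z. Y (chart_inv d z) d) (at (chart_map d p)) (?D y0 (X p c)) -
      frechet_derivative (\<lambda>z. X (chart_inv d z) d) (at (chart_map d p)) (?D y0 (Y p c))"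
    by (simp only: vector_field_bracket_def if_P[OF d] Xd Yd)
  also have "\<dots> = ?D y0 (frechet_derivative (\<lambda>z. Y (chart_inv c z) c) (at y0) (X p c)) -
      ?D y0 (frechet_derivative (\<lambda>z. X (chart_inv c z) c) (at y0) (Y p c))"
    using *[of Y "X p c", OF Y Y_diff] *[of X "Y p c", OF X X_diff] sym by simp
  also have "\<dots> = ?D y0 (vector_field_bracket A X Y p c)"
    by (simp only: vector_field_bracket_def if_P[OF c] y0_def[symmetric]
        linear_diff[OF has_derivative_linear[OF D[OF y0(1)]]])
  finally show "vector_field_bracket A X Y p d =
      frechet_derivative (chart_map d \<circ> chart_inv c) (at (chart_map c p)) (vector_field_bracket A X Y p c)"
    unfolding f_def y0_def .
qed (simp add: vector_field_bracket_def)

context lie_group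
begin

lemma left_invariant_field_mem:
  "a \<in> tangent_space B gone \<Longrightarrow> left_invariant_field B gmul gone a g \<in> tangent_space B g"
  unfolding left_invariant_field_def using tangent_map_left_mult_mem[of a gone g] by simp

lemma left_invariant_field_component:
  fixes m :: "'g \<times> 'g \<Rightarrow> 'g"
  defines "m \<equiv> \<lambda>(g, h). gmul g h"
  assumes c: "c \<in> charts_at B g"
  shows "left_invariant_field B gmul gone a g c =
    frechet_derivative (prod_rep c (chart_at B gone) c m) (at (chart_map c g, chart_map (chart_at B gone) gone)) (0, a (chart_at B gone))"
proof -
  have "c \<in> charts_at B (m (g, gone))" using c by (simp add: m_def)
  from tangent_map_slices(2)[OF group_manifold group_manifold group_manifold smooth_mult[folded m_def] this c, of a]
  show ?thesis by (simp add: left_invariant_field_def m_def)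
qed

lemma left_invariant_field_differentiable:
  assumes c: "c \<in> charts_at B g"
  shows "(\<lambda>y. left_invariant_field B gmul gone a (chart_inv c y) c) differentiable (at (chart_map c g))"
proof -
  define m where "m = (\<lambda>(g, h). gmul g h)"
  define c' where "c' = chart_at B gone"
  have c': "c' \<in> charts_at B gone" unfolding c'_def by (rule chart_at_mem)
  note cD = charts_atD[OF c] and c'D = charts_atD[OF c']
  let ?U = "prod_rep_dom c c' c m" and ?f = "prod_rep c c' c m"
  note sm = prod_rep_open_smooth[OF group_manifold group_manifold group_manifold smooth_mult[folded m_def] cD(1) c'D(1) cD(1)]
  have f2: "ck_on (Suc (Suc 0)) ?f ?U" using sm(2) unfolding smooth_on_def by blast
  have "(chart_map c g, chart_map c' gone) \<in> ?U"
    using cD c'D by (simp add: prod_rep_dom_def chart_map_mem chart_inv_map m_def)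
  note D = has_derivative_first_derivative[OF f2 this]
  have "((\<lambda>y. (y, chart_map c' gone)) has_derivative (\<lambda>u. (u, 0))) (at (chart_map c g))"
    by (auto intro!: derivative_eq_intros)
  from has_derivative_compose[OF this D[of "(0, a c')"]]
  have "((\<lambda>y. frechet_derivative ?f (at (y, chart_map c' gone)) (0, a c')) has_derivative
     (\<lambda>u. second_derivative ?f (chart_map c g, chart_map c' gone) (u, 0) (0, a c'))) (at (chart_map c g))" .
  moreover have "frechet_derivative ?f (at (y, chart_map c' gone)) (0, a c') =
      left_invariant_field B gmul gone a (chart_inv c y) c" if "y \<in> chart_image c" for y
  proof -
    have "c \<in> charts_at B (chart_inv c y)" using that cD(1) by (simp add: charts_at_def chart_inv_mem)
    from left_invariant_field_component[OF this, of a] show ?thesis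
      using that cD(1) by (simp add: m_def c'_def chart_map_inv)
  qed
  ultimately have "((\<lambda>y. left_invariant_field B gmul gone a (chart_inv c y) c) has_derivative
     (\<lambda>u. second_derivative ?f (chart_map c g, chart_map c' gone) (u, 0) (0, a c'))) (at (chart_map c g))"
    by (rule has_derivative_transform_within_open[OF _ open_chart_image[OF cD(1)] chart_map_mem[OF cD(2)]])
  then show ?thesis by (auto simp: differentiable_def)
qed

lemma lie_bracket_mem:
  assumes "a \<in> tangent_space B gone" "b \<in> tangent_space B gone"
  shows "lie_bracket B gmul gone a b \<in> tangent_space B gone"
  unfolding lie_bracket_def
  by (rule vector_field_bracket_mem_tangent_space)
    (intro left_invariant_field_mem left_invariant_field_differentiable assms | assumption)+

lemma left_invariant_field_one:
  assumes "a \<in> tangent_space B gone"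
  shows "left_invariant_field B gmul gone a gone = a"
proof -
  obtain k where k: "k 0 = gone" "has_velocity B k 0 a" by (rule exists_curve_with_velocity[OF assms])
  have "has_velocity B k 0 (tangent_map B B (gmul gone) gone a)"
    using has_velocity_left_mult[OF k(2), of gone] by (simp add: one_mul k(1))
  from has_velocity_unique[OF this k(2)] show ?thesis by (simp add: left_invariant_field_def)
qed

text \<open>
In the chart at the identity the Lie bracket is the antisymmetrised mixed second
derivative of the multiplication.
\<close>

lemma lie_bracket_component:
  fixes m :: "'g \<times> 'g \<Rightarrow> 'g" and c
  defines "m \<equiv> \<lambda>(g, h). gmul g h" and "c \<equiv> chart_at B gone"
  assumes a: "a \<in> tangent_space B gone" and b: "b \<in> tangent_space B gone"
  shows "lie_bracket B gmul gone a b c =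
    frechet_derivative (\<lambda>z. frechet_derivative (prod_rep c c c m) (at (z, chart_map c gone)) (0, b c)) (at (chart_map c gone)) (a c) -
    frechet_derivative (\<lambda>z. frechet_derivative (prod_rep c c c m) (at (z, chart_map c gone)) (0, a c)) (at (chart_map c gone)) (b c)"
proof -
  have c: "c \<in> charts_at B gone" unfolding c_def by (rule chart_at_mem)
  note cD = charts_atD[OF c]
  have "frechet_derivative (\<lambda>y. left_invariant_field B gmul gone v (chart_inv c y) c) (at (chart_map c gone)) =
    frechet_derivative (\<lambda>z. frechet_derivative (prod_rep c c c m) (at (z, chart_map c gone)) (0, v c)) (at (chart_map c gone))" for v
  proof (rule frechet_derivative_transform_within_open)
    show "(\<lambda>y. left_invariant_field B gmul gone v (chart_inv c y) c) differentiable (at (chart_map c gone))"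
      by (rule left_invariant_field_differentiable[OF c])
    show "open (chart_image c)" "chart_map c gone \<in> chart_image c"
      by (rule open_chart_image[OF cD(1)], rule chart_map_mem[OF cD(2)])
    fix y assume y: "y \<in> chart_image c"
    have "c \<in> charts_at B (chart_inv c y)" using y cD(1) by (simp add: charts_at_def chart_inv_mem)
    from left_invariant_field_component[OF this, of v]
    show "left_invariant_field B gmul gone v (chart_inv c y) c =
        frechet_derivative (prod_rep c c c m) (at (y, chart_map c gone)) (0, v c)"
      using y cD(1) by (simp add: m_def c_def[symmetric] chart_map_inv)
  qed
  then show ?thesis
    unfolding lie_bracket_def vector_field_bracket_def if_P[OF c]
      left_invariant_field_one[OF a] left_invariant_field_one[OF b] by simp
qed

end

section \<open>Infinitesimal generators\<close>

context smooth_left_action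
begin

abbreviation generator :: "('g, 'h) tvec \<Rightarrow> 'm \<Rightarrow> ('m, 'e) tvec" where
  "generator \<equiv> infinitesimal_generator B gmul A act"

abbreviation action_map :: "'g \<times> 'm \<Rightarrow> 'm" where
  "action_map \<equiv> \<lambda>(g, x). act g x"

lemma manifold: "smooth_manifold A" by (rule M.smooth_manifold_axioms)

text \<open>
Along the one-parameter subgroup \<open>K\<close> of \<open>a\<close> the orbit curve \<open>t \<mapsto> exp (t a) x = K(t) x\<close> is the image
of \<open>K\<close> under \<open>g \<mapsto> g x\<close>.
\<close>

lemma generator_eq_tangent_map:
  assumes a: "a \<in> tangent_space B gone"
  shows "generator a x = tangent_map B A (\<lambda>g. act g x) gone a" and "generator a x \<in> tangent_space A x"
proof -
  obtain K where K: "one_parameter_subgroup B gmul K" "has_velocity B K 0 a"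
    by (rule G.exists_one_parameter_subgroup[OF a])
  have K0: "K 0 = gone" by (rule G.one_parameter_subgroup_zero[OF K(1)])
  have "has_velocity A (\<lambda>s. act (K s) x) 0
      (tvec_add (tangent_map B A (\<lambda>g. act g x) (K 0) a) (tangent_map A A (\<lambda>y. act (K 0) y) x tvec_zero))"
    using has_velocity_map2[OF G.group_manifold manifold manifold smooth_act K(2) M.has_velocity_const[of x]] by simp
  then have vel: "has_velocity A (\<lambda>s. act (K s) x) 0 (tangent_map B A (\<lambda>g. act g x) gone a)"
    using tangent_map_slice_lincomb(3)[OF G.group_manifold manifold manifold smooth_act, of gone x]
    by (simp add: K0 tvec_add_def tvec_zero_def)
  show "generator a x = tangent_map B A (\<lambda>g. act g x) gone a"
    unfolding infinitesimal_generator_def G.lie_exp_scale[OF K] by (rule M.velocity_eq[OF vel])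
  then show "generator a x \<in> tangent_space A x" using vel by (simp add: has_velocity_def K0 act_one)
qed

lemma generator_lincomb:
  assumes a: "a \<in> tangent_space B gone" and b: "b \<in> tangent_space B gone"
  shows "generator (tvec_add (tvec_scale r a) (tvec_scale s b)) x =
    tvec_add (tvec_scale r (generator a x)) (tvec_scale s (generator b x))"
  using tangent_map_slice_lincomb(1)[OF G.group_manifold manifold manifold smooth_act, of x gone r a s b]
  by (simp add: generator_eq_tangent_map(1) a b G.tangent_space_lincomb)

lemma generator_component:
  assumes a: "a \<in> tangent_space B gone" and d: "d \<in> charts_at A x"
  shows "generator a x d = frechet_derivative (prod_rep (chart_at B gone) d d action_map)
    (at (chart_map (chart_at B gone) gone, chart_map d x)) (a (chart_at B gone), 0)"
proof -
  have "d \<in> charts_at A (action_map (gone, x))" using d by (simp add: act_one)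
  from tangent_map_slices(1)[OF G.group_manifold manifold manifold smooth_act this d, of a]
  show ?thesis by (simp add: generator_eq_tangent_map(1)[OF a])
qed

lemma action_rep_dom:
  assumes c: "c \<in> charts_at B gone" and d: "d \<in> A" and y: "y \<in> chart_image d"
  shows "(chart_map c gone, y) \<in> prod_rep_dom c d d action_map"
  using G.charts_atD[OF c] M.chart_inv_mem[OF d y] y
  by (simp add: prod_rep_dom_def G.chart_map_mem G.chart_inv_map act_one)

lemma generator_component_inv:
  assumes a: "a \<in> tangent_space B gone" and d: "d \<in> A" and y: "y \<in> chart_image d"
  shows "generator a (chart_inv d y) d = frechet_derivative (prod_rep (chart_at B gone) d d action_map)
    (at (chart_map (chart_at B gone) gone, y)) (a (chart_at B gone), 0)"
  using generator_component[OF a M.charts_atI[OF d M.chart_inv_mem[OF d y]]] M.chart_map_inv[OF d y] by simp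

lemma generator_smooth:
  assumes a: "a \<in> tangent_space B gone" and d: "d \<in> A"
  shows "smooth_on (\<lambda>y. generator a (chart_inv d y) d) (chart_image d)"
proof (rule smooth_on_cong[OF M.open_chart_image[OF d]])
  define c where "c = chart_at B gone"
  have c: "c \<in> charts_at B gone" unfolding c_def by (rule G.chart_at_mem)
  let ?U = "prod_rep_dom c d d action_map" and ?f = "prod_rep c d d action_map"
  have "smooth_on ?f ?U"
    by (rule prod_rep_open_smooth(2)[OF G.group_manifold manifold manifold smooth_act G.charts_atD(1)[OF c] d d])
  note D = smooth_on_directional_derivative[OF this, of "(a c, 0)"]
  show "smooth_on (\<lambda>y. frechet_derivative (prod_rep c d d action_map) (at (chart_map c gone, y)) (a c, 0)) (chart_image d)"
  proof (rule smooth_on_compose[OF fin_dim_prod[OF G.fin_dim_model M.fin_dim_model] M.open_chart_image[OF d] _ D])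
    show "(\<lambda>y. (chart_map c gone, y)) ` chart_image d \<subseteq> ?U" using action_rep_dom[OF c d] by blast
    show "smooth_on (\<lambda>y. (chart_map c gone, y)) (chart_image d)"
      by (intro smooth_on_Pair smooth_on_ident smooth_on_const M.open_chart_image d)
  qed
  show "frechet_derivative (prod_rep c d d action_map) (at (chart_map c gone, y)) (a c, 0) = generator a (chart_inv d y) d"
    if "y \<in> chart_image d" for y
    unfolding c_def by (rule generator_component_inv[OF a d that, symmetric])
qed

text \<open>
The relation \<open>X\<^bsub>[a,b]\<^esub> = - [X\<^sub>a, X\<^sub>b]\<close> in a chart. Antisymmetrising the second-order expansion
of the action removes the second derivative of the action in the group variable.
\<close>

lemma generator_lie_bracket:
  assumes a: "a \<in> tangent_space B gone" and b: "b \<in> tangent_space B gone" and d: "d \<in> charts_at A x"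
  shows "generator (lie_bracket B gmul gone a b) x d =
    frechet_derivative (\<lambda>y. generator a (chart_inv d y) d) (at (chart_map d x)) (generator b x d) -
    frechet_derivative (\<lambda>y. generator b (chart_inv d y) d) (at (chart_map d x)) (generator a x d)"
proof -
  define c where "c = chart_at B gone"
  have c: "c \<in> charts_at B gone" unfolding c_def by (rule G.chart_at_mem)
  note cD = G.charts_atD[OF c] and dD = M.charts_atD[OF d]
  define m where "m = (\<lambda>(g, h). gmul g h)"
  let ?m = "prod_rep c c c m" and ?V = "prod_rep_dom c c c m"
  let ?\<Phi> = "prod_rep c d d action_map" and ?U = "prod_rep_dom c d d action_map"
  define z0 where "z0 = chart_map c gone"
  define y0 where "y0 = chart_map d x"
  have inv0: "chart_inv c z0 = gone" "chart_inv d y0 = x"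
    unfolding z0_def y0_def by (rule G.chart_inv_map[OF cD] M.chart_inv_map[OF dD])+
  have im0: "z0 \<in> chart_image c" "y0 \<in> chart_image d"
    unfolding z0_def y0_def by (rule G.chart_map_mem[OF cD(2)] M.chart_map_mem[OF dD(2)])+
  note U = prod_rep_open_smooth[OF G.group_manifold manifold manifold smooth_act cD(1) dD(1) dD(1)]
  note V = prod_rep_open_smooth[OF G.group_manifold G.group_manifold G.group_manifold G.smooth_mult[folded m_def] cD(1) cD(1) cD(1)]
  have U0: "(z0, y0) \<in> ?U" unfolding z0_def by (rule action_rep_dom[OF c dD(1) im0(2)])
  have V0: "(z0, z0) \<in> ?V" using im0 inv0 cD by (simp add: prod_rep_dom_def m_def)
  have near: "\<forall>\<^sub>F z in nhds z0. z \<in> chart_image c"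
    by (rule eventually_nhds_in_open[OF G.open_chart_image[OF cD(1)] im0(1)])
  have m_right: "\<forall>\<^sub>F z in nhds z0. ?m (z, z0) = z"
    using near by eventually_elim (simp add: prod_rep_def m_def inv0 G.chart_map_inv cD)
  have m_left: "\<forall>\<^sub>F w in nhds z0. ?m (z0, w) = w"
    using near by eventually_elim (simp add: prod_rep_def m_def inv0 G.one_mul G.chart_map_inv cD)
  have \<Phi>_one: "?\<Phi> (z0, y0) = y0" by (simp add: prod_rep_def inv0 act_one) (simp add: y0_def)
  have cont_right: "isCont (\<lambda>w. (z, w)) w" for z :: 'h and w :: 'h
    by (intro continuous_intros)
  have cont_left: "isCont (\<lambda>z. (z, w)) z" for z :: 'h and w :: "'b::topological_space"
    by (intro continuous_intros)
  have ev1: "\<forall>\<^sub>F w in nhds z0. (w, y0) \<in> ?U"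
    by (rule isCont_eventually_mem[OF cont_left U(1) U0])
  have "\<forall>\<^sub>F z in nhds z0. (z, z0) \<in> ?V"
    by (rule isCont_eventually_mem[OF cont_left V(1) V0])
  then have action: "\<forall>\<^sub>F z in nhds z0. \<forall>\<^sub>F w in nhds z0. ?\<Phi> (?m (z, w), y0) = ?\<Phi> (z, ?\<Phi> (w, y0))"
  proof eventually_elim
    case (elim z)
    have "\<forall>\<^sub>F w in nhds z0. (z, w) \<in> ?V"
      by (rule isCont_eventually_mem[OF cont_right V(1) elim])
    with ev1 show ?case
    proof eventually_elim
      case (elim w)
      have "chart_inv c (?m (z, w)) = gmul (chart_inv c z) (chart_inv c w)"
        using elim(2) cD by (simp add: prod_rep_def prod_rep_dom_def m_def G.chart_inv_map)
      moreover have "chart_inv d (?\<Phi> (w, y0)) = act (chart_inv c w) x"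
        using elim(1) dD by (simp add: prod_rep_def prod_rep_dom_def inv0 M.chart_inv_map)
      ultimately show ?case by (simp add: prod_rep_def[of c d] inv0 act_mult)
    qed
  qed
  let ?D = "frechet_derivative ?\<Phi> (at (z0, y0))"
  let ?N = "\<lambda>v z. frechet_derivative ?m (at (z, z0)) (0, v)"
  have *: "second_derivative ?\<Phi> (z0, y0) (u c, 0) (v c, 0) + ?D (frechet_derivative (?N (v c)) (at z0) (u c), 0) =
      frechet_derivative (\<lambda>y. generator u (chart_inv d y) d) (at y0) (generator v x d)"
    if u: "u \<in> tangent_space B gone" and v: "v \<in> tangent_space B gone" for u v
  proof -
    have "frechet_derivative (\<lambda>y. generator u (chart_inv d y) d) (at y0) =
        frechet_derivative (\<lambda>y. frechet_derivative ?\<Phi> (at (z0, y)) (u c, 0)) (at y0)"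
    proof (rule frechet_derivative_transform_within_open[OF _ M.open_chart_image[OF dD(1)] im0(2)])
      show "(\<lambda>y. generator u (chart_inv d y) d) differentiable (at y0)"
        using smooth_on_has_derivative[OF generator_smooth[OF u dD(1)] im0(2)] by (auto simp: differentiable_def)
      show "generator u (chart_inv d y) d = frechet_derivative ?\<Phi> (at (z0, y)) (u c, 0)" if "y \<in> chart_image d" for y
        unfolding c_def z0_def by (rule generator_component_inv[OF u dD(1) that])
    qed
    moreover have "generator v x d = ?D (v c, 0)"
      unfolding c_def z0_def y0_def by (rule generator_component[OF v d])
    ultimately show ?thesis
      using local_action_second_order[OF G.fin_dim_model M.fin_dim_model U U0 V V0 m_right m_left \<Phi>_one action, of "u c" "v c"] by simp
  qed
  have sym: "second_derivative ?\<Phi> (z0, y0) (a c, 0) (b c, 0) = second_derivative ?\<Phi> (z0, y0) (b c, 0) (a c, 0)"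
    by (rule second_derivative_symmetric[OF _ U(1) U0]) (use U(2) in \<open>simp only: smooth_on_def\<close>)
  have lin: "linear ?D"
    by (rule has_derivative_linear[OF smooth_on_has_derivative[OF U(2) U0]])
  have "generator (lie_bracket B gmul gone a b) x d = ?D (lie_bracket B gmul gone a b c, 0)"
    unfolding c_def z0_def y0_def by (rule generator_component[OF G.lie_bracket_mem[OF a b] d])
  also have "lie_bracket B gmul gone a b c = frechet_derivative (?N (b c)) (at z0) (a c) - frechet_derivative (?N (a c)) (at z0) (b c)"
    unfolding c_def z0_def m_def by (rule G.lie_bracket_component[OF a b])
  also have "?D (frechet_derivative (?N (b c)) (at z0) (a c) - frechet_derivative (?N (a c)) (at z0) (b c), 0) =
      ?D (frechet_derivative (?N (b c)) (at z0) (a c), 0) - ?D (frechet_derivative (?N (a c)) (at z0) (b c), 0)"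
    using linear_diff[OF lin, of "(frechet_derivative (?N (b c)) (at z0) (a c), 0)" "(frechet_derivative (?N (a c)) (at z0) (b c), 0)"]
    by simp
  also have "\<dots> = frechet_derivative (\<lambda>y. generator a (chart_inv d y) d) (at y0) (generator b x d) -
      frechet_derivative (\<lambda>y. generator b (chart_inv d y) d) (at y0) (generator a x d)"
    unfolding *[OF a b, symmetric] *[OF b a, symmetric] sym by simp
  finally show ?thesis unfolding y0_def .
qed

end

section \<open>The symplectic form in a chart\<close>

lemma (in smooth_manifold) smooth_functionsI:
  assumes f: "\<And>c. c \<in> A \<Longrightarrow> smooth_on (\<lambda>y. f (chart_inv c y)) (chart_image c)"
  shows "f \<in> smooth_functions A"
proof -
  have "isCont f p" for p
  proof -
    define c where "c = chart_at A p"
    have c: "c \<in> charts_at A p" unfolding c_def by (rule chart_at_mem)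
    note cD = charts_atD[OF c]
    have "isCont (\<lambda>y. f (chart_inv c y)) (chart_map c p)"
      by (rule has_derivative_continuous[OF smooth_on_has_derivative[OF f[OF cD(1)] chart_map_mem[OF cD(2)]]])
    with isCont_chart_map[OF cD] have cont: "isCont (\<lambda>q. f (chart_inv c (chart_map c q))) p"
      by (rule isCont_o2)
    have "\<forall>\<^sub>F q in nhds p. q \<in> chart_dom c"
      by (rule eventually_nhds_in_open[OF open_chart_dom[OF cD(1)] cD(2)])
    then have ev: "\<forall>\<^sub>F q in nhds p. f (chart_inv c (chart_map c q)) = f q"
      by eventually_elim (simp add: chart_inv_map cD)
    from cont show ?thesis by (rule isCont_cong[OF ev, THEN iffD1])
  qed
  moreover have "id \<circ> f \<circ> chart_inv c = (\<lambda>y. f (chart_inv c y))" for c :: "('m, 'e) chart"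
    by (simp add: fun_eq_iff)
  ultimately show ?thesis
    using f unfolding smooth_functions_def smooth_map_def std_atlas_def
    by (simp add: continuous_on_eq_continuous_at chart_image_def[symmetric])
qed

context symplectic_manifold
begin

lemma form_in_chart_skew:
  assumes "c \<in> A" "y \<in> chart_image c"
  shows "form_in_chart A \<omega> c y u v = - form_in_chart A \<omega> c y v u"
  unfolding form_in_chart_def using assms
  by (intro form_skew coord_vec_mem_tangent_space charts_atI chart_inv_mem)

lemma linear_form_in_chart_left:
  assumes "c \<in> A" "y \<in> chart_image c"
  shows "linear (\<lambda>u. form_in_chart A \<omega> c y u v)"
proof -
  have c: "c \<in> charts_at A (chart_inv c y)" using assms by (intro charts_atI chart_inv_mem)
  have *: "form_in_chart A \<omega> c y (r *\<^sub>R u + s *\<^sub>R w) v = r * form_in_chart A \<omega> c y u v + s * form_in_chart A \<omega> c y w v" for r s u w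
    unfolding form_in_chart_def coord_vec_linear[OF c]
    by (rule form_linear) (rule coord_vec_mem_tangent_space[OF c])+
  show ?thesis using *[of 1 _ 1] *[of _ _ 0] by (intro linearI) simp_all
qed

lemma linear_form_in_chart_right:
  assumes "c \<in> A" "y \<in> chart_image c"
  shows "linear (\<lambda>v. form_in_chart A \<omega> c y u v)"
  using linear_compose_neg[OF linear_form_in_chart_left[OF assms, of u]]
  by (simp flip: form_in_chart_skew[OF assms])

lemma form_eq_form_in_chart:
  assumes c: "c \<in> charts_at A p" and "v \<in> tangent_space A p" "w \<in> tangent_space A p"
  shows "\<omega> p v w = form_in_chart A \<omega> c (chart_map c p) (v c) (w c)"
  using assms by (simp add: form_in_chart_def chart_inv_map charts_atD coord_vec_component)

lemma form_in_chart_fields: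
  assumes c: "c \<in> A" and y: "y \<in> chart_image c"
    and X: "\<And>p. X p \<in> tangent_space A p" and Y: "\<And>p. Y p \<in> tangent_space A p"
  shows "\<omega> (chart_inv c y) (X (chart_inv c y)) (Y (chart_inv c y)) =
    form_in_chart A \<omega> c y (X (chart_inv c y) c) (Y (chart_inv c y) c)"
  using form_eq_form_in_chart[OF charts_atI[OF c chart_inv_mem[OF c y]] X Y] chart_map_inv[OF c y] by simp

lemma form_on_fields_smooth:
  assumes c: "c \<in> A"
    and X: "\<And>p. X p \<in> tangent_space A p" "smooth_on (\<lambda>y. X (chart_inv c y) c) (chart_image c)"
    and Y: "\<And>p. Y p \<in> tangent_space A p" "smooth_on (\<lambda>y. Y (chart_inv c y) c) (chart_image c)"
  shows "smooth_on (\<lambda>y. \<omega> (chart_inv c y) (X (chart_inv c y)) (Y (chart_inv c y))) (chart_image c)"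
proof (rule smooth_on_cong[OF open_chart_image[OF c] form_in_chart_fields[OF c _ X(1) Y(1), symmetric]])
  show "smooth_on (\<lambda>y. form_in_chart A \<omega> c y (X (chart_inv c y) c) (Y (chart_inv c y) c)) (chart_image c)"
    unfolding smooth_on_def
  proof
    fix n
    note op = open_chart_image[OF c]
    have part: "ck_on n (\<lambda>y. form_in_chart A \<omega> c y (X (chart_inv c y) c) v) (chart_image c)" for v
    proof (rule ck_on_linear_family[OF fin_dim_model op linear_form_in_chart_left[OF c]])
      show "ck_on n (\<lambda>y. form_in_chart A \<omega> c y u v) (chart_image c)" for u
        using form_smooth[OF c] unfolding smooth_on_def by blast
      show "ck_on n (\<lambda>y. X (chart_inv c y) c) (chart_image c)" using X(2) unfolding smooth_on_def by blast
    qed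
    show "ck_on n (\<lambda>y. form_in_chart A \<omega> c y (X (chart_inv c y) c) (Y (chart_inv c y) c)) (chart_image c)"
    proof (rule ck_on_linear_family[where W = "\<lambda>y. form_in_chart A \<omega> c y (X (chart_inv c y) c)", OF fin_dim_model op _ part])
      show "linear (form_in_chart A \<omega> c y (X (chart_inv c y) c))" if "y \<in> chart_image c" for y
        by (rule linear_form_in_chart_right[OF c that])
      show "ck_on n (\<lambda>y. Y (chart_inv c y) c) (chart_image c)" using Y(2) unfolding smooth_on_def by blast
    qed
  qed
qed

text \<open>
The product rule for \<open>\<omega>(X, Y)\<close>. The first term differentiates \<open>\<omega>\<close> on the constant
coordinate fields with values \<open>X p\<close> and \<open>Y p\<close>; three such terms make up \<open>d\<omega>\<close>.
\<close>

lemma form_on_fields_derivative: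
  assumes c: "c \<in> charts_at A p"
    and X: "\<And>p. X p \<in> tangent_space A p" "smooth_on (\<lambda>y. X (chart_inv c y) c) (chart_image c)"
    and Y: "\<And>p. Y p \<in> tangent_space A p" "smooth_on (\<lambda>y. Y (chart_inv c y) c) (chart_image c)"
  shows "frechet_derivative (\<lambda>y. \<omega> (chart_inv c y) (X (chart_inv c y)) (Y (chart_inv c y))) (at (chart_map c p)) w =
    frechet_derivative (\<lambda>y. form_in_chart A \<omega> c y (X p c) (Y p c)) (at (chart_map c p)) w
    + form_in_chart A \<omega> c (chart_map c p) (frechet_derivative (\<lambda>y. X (chart_inv c y) c) (at (chart_map c p)) w) (Y p c)
    + form_in_chart A \<omega> c (chart_map c p) (X p c) (frechet_derivative (\<lambda>y. Y (chart_inv c y) c) (at (chart_map c p)) w)"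
proof -
  note cD = charts_atD[OF c]
  define y0 where "y0 = chart_map c p"
  have y0: "y0 \<in> chart_image c" "chart_inv c y0 = p"
    unfolding y0_def by (rule chart_map_mem[OF cD(2)] chart_inv_map[OF cD])+
  note op = open_chart_image[OF cD(1)]
  let ?W = "\<lambda>y. form_in_chart A \<omega> c y" and ?X = "\<lambda>y. X (chart_inv c y) c" and ?Y = "\<lambda>y. Y (chart_inv c y) c"
  note DX = smooth_on_has_derivative[OF X(2) y0(1)] and DY = smooth_on_has_derivative[OF Y(2) y0(1)]
  have DW: "((\<lambda>y. ?W y u v) has_derivative frechet_derivative (\<lambda>y. ?W y u v) (at y0)) (at y0)" for u v
    by (rule smooth_on_has_derivative[OF form_smooth[OF cD(1)] y0(1)])
  have 1: "((\<lambda>y. ?W y (?X y) v) has_derivative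
      (\<lambda>w. frechet_derivative (\<lambda>y. ?W y (?X y0) v) (at y0) w + ?W y0 (frechet_derivative ?X (at y0) w) v)) (at y0)" for v
    by (rule has_derivative_linear_family[OF fin_dim_model op y0(1) linear_form_in_chart_left[OF cD(1)] DW DX])
  have "((\<lambda>y. ?W y (?X y) (?Y y)) has_derivative
      (\<lambda>w. (frechet_derivative (\<lambda>y. ?W y (?X y0) (?Y y0)) (at y0) w + ?W y0 (frechet_derivative ?X (at y0) w) (?Y y0))
        + ?W y0 (?X y0) (frechet_derivative ?Y (at y0) w))) (at y0)"
    by (rule has_derivative_linear_family[OF fin_dim_model op y0(1) linear_form_in_chart_right[OF cD(1)] 1 DY])
  then have "((\<lambda>y. \<omega> (chart_inv c y) (X (chart_inv c y)) (Y (chart_inv c y))) has_derivative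
      (\<lambda>w. (frechet_derivative (\<lambda>y. ?W y (?X y0) (?Y y0)) (at y0) w + ?W y0 (frechet_derivative ?X (at y0) w) (?Y y0))
        + ?W y0 (?X y0) (frechet_derivative ?Y (at y0) w))) (at y0)"
    by (rule has_derivative_transform_within_open[OF _ op y0(1)])
      (rule form_in_chart_fields[OF cD(1) _ X(1) Y(1), symmetric])
  from frechet_derivative_eq[OF this] show ?thesis unfolding y0(2) y0_def[symmetric] by simp
qed

end

section \<open>The cocycle of generators\<close>

locale symplectic_action = smooth_left_action B gmul gone ginv A act + S: symplectic_manifold A \<omega>
  for B :: "('g::{t2_space, second_countable_topology}, 'h::{real_inner, banach}) chart set"
    and gmul :: "'g \<Rightarrow> 'g \<Rightarrow> 'g" and gone :: 'g and ginv :: "'g \<Rightarrow> 'g"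
    and A :: "('m::{t2_space, second_countable_topology}, 'e::{real_inner, banach}) chart set"
    and act :: "'g \<Rightarrow> 'm \<Rightarrow> 'm" and \<omega> :: "('m, 'e) two_form"
begin

abbreviation \<Omega> :: "('g, 'h) tvec \<Rightarrow> ('g, 'h) tvec \<Rightarrow> 'm \<Rightarrow> real" where
  "\<Omega> \<equiv> pullback_cochain B gmul A act \<omega>"

lemma pulled_back_form_cochain: "lie_cochain B gone A 2 (\<lambda>as. \<Omega> (as ! 0) (as ! 1))"
proof -
  have lin1: "\<Omega> (tvec_add (tvec_scale r u) (tvec_scale s v)) b x = r * \<Omega> u b x + s * \<Omega> v b x"
    if "u \<in> tangent_space B gone" "v \<in> tangent_space B gone" "b \<in> tangent_space B gone" for r s u v b x
    unfolding pullback_cochain_def generator_lincomb[OF that(1,2)]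
    by (rule S.form_linear) (rule generator_eq_tangent_map(2), fact that)+
  have skew: "\<Omega> a b x = - \<Omega> b a x"
    if "a \<in> tangent_space B gone" "b \<in> tangent_space B gone" for a b x
    unfolding pullback_cochain_def
    by (rule S.form_skew) (rule generator_eq_tangent_map(2), fact that)+
  have lin2: "\<Omega> b (tvec_add (tvec_scale r u) (tvec_scale s v)) x = r * \<Omega> b u x + s * \<Omega> b v x"
    if "u \<in> tangent_space B gone" "v \<in> tangent_space B gone" "b \<in> tangent_space B gone" for r s u v b x
  proof -
    have "\<Omega> b (tvec_add (tvec_scale r u) (tvec_scale s v)) x = - \<Omega> (tvec_add (tvec_scale r u) (tvec_scale s v)) b x"
      by (rule skew[OF that(3) G.tangent_space_lincomb[OF that(1,2)]])
    also have "\<dots> = r * (- \<Omega> u b x) + s * (- \<Omega> v b x)" by (simp add: lin1[OF that])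
    also have "\<dots> = r * \<Omega> b u x + s * \<Omega> b v x"
      unfolding skew[OF that(3,1)] skew[OF that(3,2)] ..
    finally show ?thesis .
  qed
  have alt: "\<Omega> a a x = 0" if "a \<in> tangent_space B gone" for a x
    using skew[OF that that, of x] by simp
  have smooth: "\<Omega> a b \<in> smooth_functions A"
    if a: "a \<in> tangent_space B gone" and b: "b \<in> tangent_space B gone" for a b
    unfolding pullback_cochain_def
    by (intro M.smooth_functionsI S.form_on_fields_smooth generator_eq_tangent_map(2) generator_smooth a b)
  show ?thesis
    unfolding lie_cochain_def
  proof (intro allI impI, elim conjE)
    fix as assume len: "length as = 2" and mem: "set as \<subseteq> tangent_space B gone"
    then obtain a b where as: "as = [a, b]" by (auto simp: length_Suc_conv numeral_2_eq_2)
    with mem have ab: "a \<in> tangent_space B gone" "b \<in> tangent_space B gone" by simp_all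
    show "\<Omega> (as ! 0) (as ! 1) \<in> smooth_functions A \<and>
      (\<forall>i<2. \<forall>r s. \<forall>u\<in>tangent_space B gone. \<forall>v\<in>tangent_space B gone. \<forall>x.
        \<Omega> (as[i := tvec_add (tvec_scale r u) (tvec_scale s v)] ! 0) (as[i := tvec_add (tvec_scale r u) (tvec_scale s v)] ! 1) x =
        r * \<Omega> (as[i := u] ! 0) (as[i := u] ! 1) x + s * \<Omega> (as[i := v] ! 0) (as[i := v] ! 1) x) \<and>
      (\<forall>j<2. \<forall>i<j. as ! i = as ! j \<longrightarrow> (\<forall>x. \<Omega> (as ! 0) (as ! 1) x = 0))"
      unfolding as using ab smooth lin1 lin2 alt by (auto simp: less_2_cases_iff)
  qed
qed

text \<open>
The Lie derivative is evaluated in the chart selected by \<open>chart_at\<close>; this is why the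
coboundary is computed in that chart.
\<close>

lemma lie_module_action_eq:
  "lie_module_action B gmul A act a f x =
    - frechet_derivative (\<lambda>y. f (chart_inv (chart_at A x) y)) (at (chart_map (chart_at A x) x)) (generator a x (chart_at A x))"
  by (simp add: lie_module_action_def lie_derivative_def differential_def o_def)

text \<open>
With \<open>\<xi> u\<close> and \<open>d\<xi> u\<close> for the value and the derivative of the generator of \<open>u\<close> in a chart, each
module term splits into a derivative of \<open>\<omega>\<close> and two terms in which a generator is
differentiated. The former add up to \<open>- d\<omega>\<close>. The latter cancel against the terms
\<open>\<Omega> [u, v] w\<close>, since \<open>X\<^bsub>[u,v]\<^esub>\<close> has the components \<open>d\<xi> u (\<xi> v) - d\<xi> v (\<xi> u)\<close>.
\<close>

lemma pulled_back_form_coboundary: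
  assumes a: "a \<in> tangent_space B gone" and b: "b \<in> tangent_space B gone" and c: "c \<in> tangent_space B gone"
  shows "lie_coboundary B gmul gone A act (\<lambda>as. \<Omega> (as ! 0) (as ! 1)) [a, b, c] x = 0"
proof -
  define d where "d = chart_at A x"
  have d: "d \<in> charts_at A x" unfolding d_def by (rule M.chart_at_mem)
  note dD = M.charts_atD[OF d]
  define y where "y = chart_map d x"
  define W where "W = form_in_chart A \<omega> d y"
  define dW where "dW w u v = frechet_derivative (\<lambda>z. form_in_chart A \<omega> d z u v) (at y) w" for w u v
  define \<xi> where "\<xi> u = generator u x d" for u
  define d\<xi> where "d\<xi> u = frechet_derivative (\<lambda>z. generator u (chart_inv d z) d) (at y)" for u
  have y: "y \<in> chart_image d" unfolding y_def by (rule M.chart_map_mem[OF dD(2)])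
  have skew: "W u v = - W v u" for u v unfolding W_def by (rule S.form_in_chart_skew[OF dD(1) y])
  have diff: "W (u - v) w = W u w - W v w" for u v w
    unfolding W_def using linear_diff[OF S.linear_form_in_chart_left[OF dD(1) y]] .
  have closed: "dW u v w - dW v u w + dW w u v = 0" for u v w
    using S.form_closed[OF dD(1) y, of u v w] by (simp add: ext_derivative_in_chart_def dW_def)
  have module: "lie_module_action B gmul A act u (\<Omega> v w) x =
      - (dW (\<xi> u) (\<xi> v) (\<xi> w) + W (d\<xi> v (\<xi> u)) (\<xi> w) + W (\<xi> v) (d\<xi> w (\<xi> u)))"
    if v: "v \<in> tangent_space B gone" and w: "w \<in> tangent_space B gone" for u v w
    unfolding lie_module_action_eq pullback_cochain_def d_def[symmetric]
    using S.form_on_fields_derivative[OF d generator_eq_tangent_map(2)[OF v] generator_smooth[OF v dD(1)]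
        generator_eq_tangent_map(2)[OF w] generator_smooth[OF w dD(1)], of "generator u x d"]
    by (simp add: dW_def W_def \<xi>_def d\<xi>_def y_def)
  have bracket: "\<Omega> (lie_bracket B gmul gone u v) w x = W (d\<xi> u (\<xi> v)) (\<xi> w) - W (d\<xi> v (\<xi> u)) (\<xi> w)"
    if u: "u \<in> tangent_space B gone" and v: "v \<in> tangent_space B gone" and w: "w \<in> tangent_space B gone" for u v w
  proof -
    have "\<Omega> (lie_bracket B gmul gone u v) w x = W (generator (lie_bracket B gmul gone u v) x d) (\<xi> w)"
      unfolding pullback_cochain_def W_def y_def \<xi>_def
      by (intro S.form_eq_form_in_chart d generator_eq_tangent_map(2) G.lie_bracket_mem u v w)
    also have "generator (lie_bracket B gmul gone u v) x d = d\<xi> u (\<xi> v) - d\<xi> v (\<xi> u)"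
      unfolding \<xi>_def d\<xi>_def y_def by (rule generator_lie_bracket[OF u v d])
    finally show ?thesis by (simp only: diff)
  qed
  show ?thesis
    unfolding lie_coboundary_2
    using closed[of "\<xi> a" "\<xi> b" "\<xi> c"] skew[of "\<xi> b" "d\<xi> c (\<xi> a)"]
      skew[of "\<xi> a" "d\<xi> c (\<xi> b)"] skew[of "\<xi> a" "d\<xi> b (\<xi> c)"]
    by (simp add: module bracket a b c)
qed

theorem pulled_back_form_cocycle: "lie_cocycle B gmul gone A act 2 (\<lambda>as. \<Omega> (as ! 0) (as ! 1))"
  unfolding lie_cocycle_def
proof (intro conjI pulled_back_form_cochain allI impI, elim conjE)
  fix as x assume len: "length as = Suc 2" and mem: "set as \<subseteq> tangent_space B gone"
  then obtain a b c where as: "as = [a, b, c]" by (auto simp: length_Suc_conv numeral_2_eq_2)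
  show "lie_coboundary B gmul gone A act (\<lambda>as. \<Omega> (as ! 0) (as ! 1)) as x = 0"
    unfolding as by (rule pulled_back_form_coboundary) (use mem as in simp_all)
qed

end

theorem proposition1:
  fixes A :: "('m::{t2_space, second_countable_topology}, 'e::{real_inner, banach}) chart set"
    and \<omega> :: "('m, 'e) two_form"
    and B :: "('g::{t2_space, second_countable_topology}, 'h::{real_inner, banach}) chart set"
    and gmul :: "'g \<Rightarrow> 'g \<Rightarrow> 'g" and gone :: 'g and ginv :: "'g \<Rightarrow> 'g"
    and act :: "'g \<Rightarrow> 'm \<Rightarrow> 'm"
  assumes "symplectic_manifold A \<omega>"
    and "lie_group B gmul gone ginv"
    and "smooth_left_action B gmul gone ginv A act"
  shows "lie_cocycle B gmul gone A act 2
           (\<lambda>as. pullback_cochain B gmul A act \<omega> (as ! 0) (as ! 1))"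
proof -
  interpret symplectic_action B gmul gone ginv A act \<omega>
    using assms by (simp add: symplectic_action_def)
  show ?thesis by (rule pulled_back_form_cocycle)
qed

end
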